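(* Let $0<p,q,s,t<\infty$, $\omega\in\mathcal D$, $n\in\mathbb N\cup\{0\}$, and let $K=K(\omega)\in\mathbb N\setminus\{1\}$ be such that, for some constant $C_0>1$, $\widehat\omega(r)\ge C_0\,\widehat\omega\left(1-\frac{1-r}K\right)$ for all $0\le r<1$. Let $r_j=1-K^{-j}$, $j\in\mathbb N\cup\{0\}$. Let $\{\mu_r\}_{0\le r<1}$ be positive Borel measures on $[0,2\pi]$ and $\nu$ a positive Borel measure on $[0,1)$. Then the following conditions are equivalent: (i) There exists a constant $C>0$ such that $$\left(\int_0^1\left(\int_0^{2\pi}|f^{(n)}(re^{i\theta})|^s\,d\mu_r(\theta)\right)^{\frac ts}d\nu(r)\right)^{\frac1t}\le C\|f\|_{A^{p,q}_\omega}\qquad\text{for all } f\in A^{p,q}_\omega.\tag{1}$$ (ii) There exists a constant $C>0$ such that $$\left(\sum_{j=1}^\infty\int_{[r_{j-1},r_j)}K^{jt(n+\frac1p)}\,\widehat\omega(r_j)^{-\frac tq}\left(\sum_{l=0}^{K^{j+2}-1}|a_{j,l}|^s\mu_r(I_{K^{j+2},l})\right)^{\frac ts}d\nu(r)\right)^{\frac1t}\le C\|\{a_{j,l}\}\|_{\ell^{p,q}}\tag{2}$$ for all $\{a_{j,l}\}\in\ell^{p,q}$ (indexed by $j\in\mathbb N$, $0\le l\le K^{j+2}-1$). Moreover, $$\inf\{C>0:\ (1)\text{ holds}\}\asymp\inf\{C>0:\ (2)\text{ holds}\},$$ with comparison constants independent of $\{\mu_r\}$ and $\nu$.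
   Context: $\mathbb D$ is the open unit disc and $\mathcal H(\mathbb D)$ the space of analytic functions in $\mathbb D$. $M_p(r,f)=\left(\int_0^{2\pi}|f(re^{i\theta})|^p\frac{d\theta}{2\pi}\right)^{1/p}$ for $0<p<\infty$. A radial weight is the extension $\omega(z)=\omega(|z|)$ to $\mathbb D$ of a non-negative $\omega\in L^1([0,1))$; write $\widehat\omega(z)=\int_{|z|}^1\omega(r)\,dr$, always assumed $>0$ for all $z\in\mathbb D$. $\omega\in\widehat{\mathcal D}$ means there is $C>0$ with $\widehat\omega(r)\le C\widehat\omega\left(\frac{1+r}2\right)$ for $0\le r<1$. $\omega\in\check{\mathcal D}$ means there are $K>1$, $C>1$ with $\widehat\omega(r)\ge C\widehat\omega\left(1-\frac{1-r}K\right)$ for $0\le r<1$. $\mathcal D=\widehat{\mathcal D}\cap\check{\mathcal D}$. For $0<p,q<\infty$, $A^{p,q}_\omega$ is the space of $f\in\mathcal H(\mathbb D)$ with $\|f\|_{A^{p,q}_\omega}^q=\int_0^1M_p^q(r,f)\,\omega(r)\,dr<\infty$. $I_{N,l}=\left[2\pi\frac lN,2\pi\frac{l+1}N\right]$ for $N\in\mathbb N$, $0\le l\le N-1$. $\ell^{p,q}$ is the set of double-indexed complex sequences with $\|\{a_{j,l}\}\|_{\ell^{p,q}}=\big\|\{\|\{a_{j,l}\}_l\|_{\ell^p}\}_j\big\|_{\ell^q}<\infty$. The family $\{\mu_r\}$ is implicitly assumed to depend measurably on $r$, so that all the iterated integrals make sense. $a\asymp b$ means $C^{-1}b\le a\le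 Cb$ for some constant $C>0$; the infimum of the empty set is $+\infty$. *)

theory Defs
  imports "HOL-Complex_Analysis.Complex_Analysis"
begin

text \<open>
  Norms and integrals take values in \<^typ>\<open>ennreal\<close>, so that divergence is the value \<open>\<infinity>\<close>.
  The following power extends \<^const>\<open>powr\<close> to \<^typ>\<open>ennreal\<close>; it is only meant for
  exponents \<open>a > 0\<close>.
\<close>

definition ennpow :: "ennreal \<Rightarrow> real \<Rightarrow> ennreal"
  where "ennpow x a = (if x = \<infinity> then \<infinity> else ennreal (enn2real x powr a))"


subsection \<open>Radial weights\<close>

text \<open>A radial weight is represented by its profile on \<open>[0,1)\<close>; values elsewhere are never used.\<close>

definition weight_hat :: "(real \<Rightarrow> real) \<Rightarrow> real \<Rightarrow> real"
  where "weight_hat \<omega> r = set_lebesgue_integral lebesgue {r..<1} \<omega>"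

definition radial_weight :: "(real \<Rightarrow> real) \<Rightarrow> bool"
  where "radial_weight \<omega> \<longleftrightarrow>
    (\<forall>r\<in>{0..<1}. 0 \<le> \<omega> r) \<and> \<omega> absolutely_integrable_on {0..<1} \<and>
    (\<forall>r\<in>{0..<1}. 0 < weight_hat \<omega> r)"

definition upper_doubling :: "(real \<Rightarrow> real) set"
  where "upper_doubling = {\<omega>. radial_weight \<omega> \<and>
    (\<exists>C>0. \<forall>r\<in>{0..<1}. weight_hat \<omega> r \<le> C * weight_hat \<omega> ((1 + r) / 2))}"

definition lower_doubling_with :: "real \<Rightarrow> real \<Rightarrow> (real \<Rightarrow> real) \<Rightarrow> bool"
  where "lower_doubling_with K C \<omega> \<longleftrightarrow>
    (\<forall>r\<in>{0..<1}. weight_hat \<omega> r \<ge> C * weight_hat \<omega> (1 - (1 - r) / K))"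

definition lower_doubling :: "(real \<Rightarrow> real) set"
  where "lower_doubling = {\<omega>. radial_weight \<omega> \<and>
    (\<exists>K>1. \<exists>C>1. lower_doubling_with K C \<omega>)}"

definition doubling_weights :: "(real \<Rightarrow> real) set"
  where "doubling_weights = upper_doubling \<inter> lower_doubling"


subsection \<open>The weighted mixed norm spaces\<close>

definition integral_mean :: "real \<Rightarrow> real \<Rightarrow> (complex \<Rightarrow> complex) \<Rightarrow> ennreal"
  where "integral_mean p r f =
    ennpow (\<integral>\<^sup>+\<theta>\<in>{0..2*pi}. ennreal (norm (f (of_real r * cis \<theta>)) powr p / (2*pi)) \<partial>lborel)
      (1 / p)"

definition mixed_norm :: "real \<Rightarrow> real \<Rightarrow> (real \<Rightarrow> real) \<Rightarrow> (complex \<Rightarrow> complex) \<Rightarrow> ennreal"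
  where "mixed_norm p q \<omega> f =
    ennpow (\<integral>\<^sup>+r\<in>{0..<1}. ennpow (integral_mean p r f) q * ennreal (\<omega> r) \<partial>lebesgue) (1 / q)"

definition mixed_norm_space :: "real \<Rightarrow> real \<Rightarrow> (real \<Rightarrow> real) \<Rightarrow> (complex \<Rightarrow> complex) set"
  where "mixed_norm_space p q \<omega> = {f. f holomorphic_on ball 0 1 \<and> mixed_norm p q \<omega> f < \<infinity>}"


subsection \<open>The sequence spaces\<close>

text \<open>
  The sequences are indexed by \<open>j \<ge> 1\<close> and \<open>l < L j\<close>; the values of \<open>a j l\<close> at other indices
  are ignored.
\<close>

definition seq_norm :: "real \<Rightarrow> real \<Rightarrow> (nat \<Rightarrow> nat) \<Rightarrow> (nat \<Rightarrow> nat \<Rightarrow> complex) \<Rightarrow> ennreal"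
  where "seq_norm p q L a =
    ennpow (\<Sum>\<^sub>\<infinity>j\<in>{1..}. ennpow (ennpow (\<Sum>l<L j. ennreal (norm (a j l) powr p)) (1 / p)) q) (1 / q)"

definition seq_space :: "real \<Rightarrow> real \<Rightarrow> (nat \<Rightarrow> nat) \<Rightarrow> (nat \<Rightarrow> nat \<Rightarrow> complex) set"
  where "seq_space p q L = {a. seq_norm p q L a < \<infinity>}"


subsection \<open>The families of measures and the two inequalities\<close>

text \<open>
  Borel measures are not assumed to be finite or \<open>\<sigma>\<close>-finite. Measurable dependence on \<open>r\<close> means
  that \<open>r \<mapsto> \<mu>\<^sub>r(E)\<close> is Borel measurable for every Borel set \<open>E\<close>. The inner integrands that occur
  below are continuous in \<open>(r, \<theta>)\<close>, so this makes the inner integrals Borel measurable in \<open>r\<close>.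
\<close>

definition measure_data :: "(real \<Rightarrow> real measure) \<Rightarrow> real measure \<Rightarrow> bool"
  where "measure_data \<mu> \<nu> \<longleftrightarrow>
    (\<forall>r\<in>{0..<1}. sets (\<mu> r) = sets (restrict_space borel {0..2*pi})) \<and>
    (\<forall>E\<in>sets (restrict_space borel {0..2*pi}).
      (\<lambda>r. emeasure (\<mu> r) E) \<in> borel_measurable (restrict_space borel {0..<1})) \<and>
    sets \<nu> = sets (restrict_space borel {0..<1})"

definition arc_interval :: "nat \<Rightarrow> nat \<Rightarrow> real set"
  where "arc_interval N l = {2*pi * (real l / real N) .. 2*pi * (real (l + 1) / real N)}"

definition radius :: "nat \<Rightarrow> nat \<Rightarrow> real"
  where "radius K j = 1 - 1 / real K ^ j"

definition function_inequality ::
  "real \<Rightarrow> real \<Rightarrow> real \<Rightarrow> real \<Rightarrow> (real \<Rightarrow> real) \<Rightarrow> nat \<Rightarrow>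
    (real \<Rightarrow> real measure) \<Rightarrow> real measure \<Rightarrow> real \<Rightarrow> bool"
  where "function_inequality p q s t \<omega> n \<mu> \<nu> C \<longleftrightarrow>
    (\<forall>f\<in>mixed_norm_space p q \<omega>.
      ennpow (\<integral>\<^sup>+r. ennpow (\<integral>\<^sup>+\<theta>. ennreal (norm ((deriv ^^ n) f (of_real r * cis \<theta>)) powr s) \<partial>\<mu> r)
                     (t / s) \<partial>\<nu>) (1 / t)
      \<le> ennreal C * mixed_norm p q \<omega> f)"

definition sequence_inequality ::
  "real \<Rightarrow> real \<Rightarrow> real \<Rightarrow> real \<Rightarrow> (real \<Rightarrow> real) \<Rightarrow> nat \<Rightarrow> nat \<Rightarrow>
    (real \<Rightarrow> real measure) \<Rightarrow> real measure \<Rightarrow> real \<Rightarrow> bool"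
  where "sequence_inequality p q s t \<omega> n K \<mu> \<nu> C \<longleftrightarrow>
    (\<forall>a\<in>seq_space p q (\<lambda>j. K ^ (j + 2)).
      ennpow (\<Sum>\<^sub>\<infinity>j\<in>{1..}. \<integral>\<^sup>+r\<in>{radius K (j - 1)..<radius K j}.
          ennreal (real K powr (real j * t * (real n + 1 / p)) *
                   weight_hat \<omega> (radius K j) powr (- t / q)) *
          ennpow (\<Sum>l<K ^ (j + 2). ennreal (norm (a j l) powr s) *
                   emeasure (\<mu> r) (arc_interval (K ^ (j + 2)) l)) (t / s) \<partial>\<nu>) (1 / t)
      \<le> ennreal C * seq_norm p q (\<lambda>j. K ^ (j + 2)) a)"

text \<open>The infimum over the empty set is \<open>\<infinity>\<close> in \<^typ>\<open>ennreal\<close>.\<close>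

definition best_constant :: "(real \<Rightarrow> bool) \<Rightarrow> ennreal"
  where "best_constant P = (INF C\<in>{C. 0 < C \<and> P C}. ennreal C)"

end

theory Submission
  imports Defs
begin

text \<open>
All estimates of the weight go through the numbers \<open>W j\<close>, its integrals from the radii \<open>r\<^sub>j = 1 - K\<^sup>-\<^sup>j\<close> to \<open>1\<close>.
The two doubling conditions say that \<open>W j\<close> decreases at least geometrically in \<open>j\<close> and at most
geometrically, and this is what the locale \<open>lacunary_weight\<close> records. Each implication is a comparison
of the two norms, uniform in \<open>\<mu>\<close> and \<open>\<nu>\<close>, between functions on the disc and sequences
indexed by the polar boxes \<open>r\<^sub>j\<^sub>-\<^sub>1 \<le> r \<le> r\<^sub>j\<close>, \<open>\<theta> \<in> I\<^sub>j\<^sub>,\<^sub>l\<close>.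

From sequences to functions: for \<open>f\<close> in the space let \<open>a\<^sub>j\<^sub>,\<^sub>l\<close> be the maximum of the modulus of the
\<open>n\<close>-th derivative over the box, suitably normalised. The left side for \<open>f\<close> is then dominated by the left side
for \<open>a\<close>, and it remains to bound the norm of \<open>a\<close> by that of \<open>f\<close> (\<open>sampled_seq_norm_le\<close>). The key is
that \<open>|f|\<^sup>p\<close> lies below its Poisson integral for every \<open>p > 0\<close> (\<open>powr_submean\<close>), which is proved by
dividing out the zeros with Blaschke factors. Together with Cauchy's estimate it bounds the maximum over a box
by a Poisson average of \<open>|f|\<^sup>p\<close> over the circle of radius \<open>R\<close>, for every \<open>R\<close> between \<open>r\<^sub>j\<^sub>+\<^sub>1\<close> and
\<open>r\<^sub>j\<^sub>+\<^sub>2\<close>. The Poisson kernels of the boxes of one level add up to a bounded multiple of their number,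
because their sum over equidistributed points is again a Poisson kernel (\<open>sum_poisson_roots_le\<close>).
Integrating over these \<open>R\<close> against \<open>\<omega>\<close> and using that \<open>W j\<close> is comparable to the mass of \<open>\<omega>\<close> there gives the claim.

From functions to sequences: attach to each box a kernel concentrated near it, a high power of
\<open>(1 - \<rho>) / (1 - \<rho> e\<^sup>-\<^sup>i\<^sup>\<alpha> z)\<close>. A finite combination of these with the normalised coefficients \<open>\<plusminus> a\<^sub>j\<^sub>,\<^sub>l\<close> has norm at
most a constant times the norm of \<open>a\<close>, whatever the signs (\<open>synthesis_norm_le\<close>): the off-diagonal
terms decay geometrically in the difference of the levels, faster than \<open>W\<close> can vary. The
\<open>n\<close>-th derivative of the kernel of a box is large on that box (\<open>grid_kernel_deriv_lower\<close>), and the other terms are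
disposed of by averaging over the signs: for each term of a sum, at least half of all choices of signs
make the sum at least as large as that term (\<open>half_of_signs\<close>). A quantity between \<open>0\<close> and \<open>T\<close> with
mean at least \<open>T / 2\<close> has \<open>e\<close>-th moment at least a constant times \<open>T\<^sup>e\<close> (\<open>average_powr_ge\<close>), for
every \<open>e > 0\<close>. This takes the place of Khinchine's inequality and treats all exponents \<open>s\<close>, \<open>t\<close> alike.

In place of Minkowski's and Hoelder's inequalities, which would force a distinction between exponents below and above
\<open>1\<close>, all sums are raised to powers by \<open>powr_sum_le_weighted\<close>: any power of a sum is at most a constant times
the weighted sum of the powers, provided that the weights grow fast enough.
\<close>

section \<open>The submean value inequality for powers of holomorphic functions\<close>

definition poisson :: "real \<Rightarrow> complex \<Rightarrow> real \<Rightarrow> real"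
  where "poisson R z \<phi> = (R\<^sup>2 - (norm z)\<^sup>2) / (norm (of_real R * cis \<phi> - z))\<^sup>2"

lemma norm_circle_diff_pos:
  assumes "norm z < R"
  shows "0 < norm (of_real R * cis \<phi> - z)"
proof -
  have "norm (of_real R * cis \<phi>) = R" using assms norm_ge_zero[of z] by (simp add: norm_mult del: norm_ge_zero)
  with assms have "of_real R * cis \<phi> \<noteq> z" by auto
  then show ?thesis by simp
qed

lemma poisson_nonneg:
  assumes "norm z < R" shows "0 \<le> poisson R z \<phi>"
proof -
  have "(norm z)\<^sup>2 \<le> R\<^sup>2" using assms by (intro power_mono) auto
  then show ?thesis unfolding poisson_def by simp
qed

text \<open>
Cauchy's formula at \<open>z\<close> for the function \<open>g(u) (R\<^sup>2 - |z|\<^sup>2) / (R\<^sup>2 - cnj z u)\<close>, which agrees with \<open>g\<close> at \<open>z\<close>.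
On the circle \<open>|u| = R\<close> the denominator is \<open>u cnj (u - z)\<close>, so that together with the factor
\<open>u - z\<close> of Cauchy's formula it produces the square \<open>|u - z|\<^sup>2\<close> of the Poisson kernel.
\<close>

lemma poisson_formula:
  assumes contg: "continuous_on (cball 0 R) g" and holg: "g holomorphic_on ball 0 R"
    and z: "norm z < R"
  shows "((\<lambda>\<phi>. g (of_real R * cis \<phi>) * of_real (poisson R z \<phi>)) has_integral 2 * of_real pi * g z) {0..2*pi}"
proof -
  have R: "0 < R" using z norm_ge_zero[of z] by linarith
  define G where "G = (\<lambda>u. g u * of_real (R\<^sup>2 - (norm z)\<^sup>2) / (of_real (R\<^sup>2) - cnj z * u))"
  have nz: "of_real (R\<^sup>2) - cnj z * u \<noteq> 0" if "norm u \<le> R" for u :: complex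
  proof
    assume "of_real (R\<^sup>2) - cnj z * u = 0"
    then have "of_real (R\<^sup>2) = cnj z * u" by simp
    then have "norm (of_real (R\<^sup>2) :: complex) = norm (cnj z * u)" by (rule arg_cong)
    then have "R\<^sup>2 = norm z * norm u" by (simp only: norm_of_real norm_mult complex_mod_cnj) simp
    also have "\<dots> \<le> norm z * R" using that by (intro mult_left_mono) auto
    also have "\<dots> < R * R" using z R by simp
    finally show False by (simp add: power2_eq_square)
  qed
  have cG: "continuous_on (cball 0 R) G"
    unfolding G_def by (intro continuous_intros contg) (use nz in auto)
  have hG: "G holomorphic_on ball 0 R"
    unfolding G_def by (intro holomorphic_intros holg) (use nz in auto)
  have "((\<lambda>u. G u / (u - z)) has_contour_integral (2 * of_real pi * \<i> * G z)) (circlepath 0 R)"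
    by (rule Cauchy_integral_circlepath[OF cG hG]) (use z in auto)
  then have "((\<lambda>t. G (0 + R * cis t) / (0 + R * cis t - z) * R * \<i> * cis t) has_integral (2 * of_real pi * \<i> * G z)) {0..2*pi}"
    unfolding circlepath_def by (subst (asm) has_contour_integral_part_circlepath_iff) auto
  then have "((\<lambda>t. (- \<i>) * (G (0 + R * cis t) / (0 + R * cis t - z) * R * \<i> * cis t)) has_integral (- \<i>) * (2 * of_real pi * \<i> * G z)) {0..2*pi}"
    by (rule has_integral_mult_right)
  moreover have "(- \<i>) * (G (0 + R * cis t) / (0 + R * cis t - z) * R * \<i> * cis t) = g (of_real R * cis t) * of_real (poisson R z t)" for t
  proof -
    define u where "u = of_real R * cis t"
    have u: "u * cnj u = of_real (R\<^sup>2)" unfolding u_def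
      by (simp add: power2_eq_square algebra_simps cis_cnj cis_mult)
    have unz: "u \<noteq> 0" using R unfolding u_def by simp
    have uz: "u - z \<noteq> 0" using norm_circle_diff_pos[OF z, of t] unfolding u_def by auto
    have d: "of_real (R\<^sup>2) - cnj z * u = u * cnj (u - z)" using u by (simp add: algebra_simps)
    have "(u - z) * cnj (u - z) = of_real ((norm (u - z))\<^sup>2)"
      by (simp only: complex_norm_square)
    then have e: "of_real ((norm (u - z))\<^sup>2) = (u - z) * cnj (u - z)" by simp
    have "(- \<i>) * (G u / (u - z) * R * \<i> * cis t) = G u * u / (u - z)"
      unfolding u_def by (simp add: field_simps)
    also have "\<dots> = g u * of_real (R\<^sup>2 - (norm z)\<^sup>2) / ((u - z) * cnj (u - z))"
    proof -
      have "X / (u * b) * u / a = X / (a * b)" for X a b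
        using unz by (simp add: field_simps)
      then show ?thesis unfolding G_def d .
    qed
    also have "\<dots> = g u * of_real (poisson R z t)"
      unfolding poisson_def u_def[symmetric] of_real_divide e by simp
    finally show ?thesis by (simp add: u_def)
  qed
  moreover have "G z = g z"
  proof -
    have "of_real (R\<^sup>2) - cnj z * z = of_real (R\<^sup>2 - (norm z)\<^sup>2)"
      by (simp only: of_real_diff complex_norm_square) (simp add: mult.commute)
    moreover have "of_real (R\<^sup>2) - cnj z * z \<noteq> 0" using nz z by simp
    ultimately show ?thesis unfolding G_def by (metis nonzero_mult_div_cancel_right)
  qed
  ultimately show ?thesis by (simp add: algebra_simps)
qed

lemma poisson_integral:
  assumes "norm z < R"
  shows "(poisson R z has_integral 2 * pi) {0..2*pi}"
proof -
  have "((\<lambda>\<phi>. (1::complex) * of_real (poisson R z \<phi>)) has_integral 2 * of_real pi * 1) {0..2*pi}"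
    by (rule poisson_formula[where g="\<lambda>_. 1"]) (use assms in auto)
  then have "((\<lambda>\<phi>. of_real (poisson R z \<phi>) :: complex) has_integral of_real (2 * pi)) {0..2*pi}" by simp
  then have "((\<lambda>\<phi>. Re (of_real (poisson R z \<phi>))) has_integral Re (of_real (2 * pi))) {0..2*pi}"
    using has_integral_linear[OF _ bounded_linear_Re] unfolding o_def by blast
  then show ?thesis by simp
qed

lemma continuous_on_poisson:
  assumes "norm z < R"
  shows "continuous_on ({norm z<..R} \<times> UNIV) (\<lambda>(\<rho>,\<phi>). poisson \<rho> z \<phi>)"
  unfolding poisson_def split_beta
  by (intro continuous_intros) (use norm_circle_diff_pos in force)

text \<open>
The branch of a power of \<open>f\<close> lives on the open disc only, and \<open>f\<close> may vanish on the circle itself. Hence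
the inequality is proved on smaller circles, and the integral is continuous in the radius.
\<close>

lemma poisson_submean_limit:
  assumes holf: "f holomorphic_on ball 0 1" and p: "0 < p" and R: "R < 1" and z: "norm z < R"
    and le: "\<And>\<rho>. norm z < \<rho> \<Longrightarrow> \<rho> < R \<Longrightarrow>
      2 * pi * norm (f z) powr p \<le> integral {0..2*pi} (\<lambda>\<phi>. norm (f (of_real \<rho> * cis \<phi>)) powr p * poisson \<rho> z \<phi>)"
  shows "2 * pi * norm (f z) powr p \<le> integral {0..2*pi} (\<lambda>\<phi>. norm (f (of_real R * cis \<phi>)) powr p * poisson R z \<phi>)"
proof -
  define I where "I = (\<lambda>\<rho>. integral (cbox 0 (2*pi)) (\<lambda>\<phi>. norm (f (of_real \<rho> * cis \<phi>)) powr p * poisson \<rho> z \<phi>))"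
  have cf: "continuous_on (ball 0 1) f" using holf by (rule holomorphic_on_imp_continuous_on)
  have "continuous_on {norm z<..R} I" unfolding I_def
  proof (rule integral_continuous_on_param)
    have 1: "continuous_on ({norm z<..R} \<times> cbox 0 (2*pi)) (\<lambda>x. f (of_real (fst x) * cis (snd x)))"
    proof (rule continuous_on_compose2[OF cf])
      show "continuous_on ({norm z<..R} \<times> cbox 0 (2*pi)) (\<lambda>x. complex_of_real (fst x) * cis (snd x))"
        by (intro continuous_intros)
    next
      have "norm (complex_of_real a * cis b) < 1" if "norm z < a" "a \<le> R" for a b
      proof -
        have "norm (complex_of_real a * cis b) = \<bar>a\<bar>" by (simp add: norm_mult)
        moreover have "0 < a" using that norm_ge_zero[of z] by linarith
        ultimately show ?thesis using that R by simp
      qed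
      then show "(\<lambda>x. complex_of_real (fst x) * cis (snd x)) ` ({norm z<..R} \<times> cbox 0 (2*pi)) \<subseteq> ball 0 1"
        by auto
    qed
    have 2: "continuous_on ({norm z<..R} \<times> cbox 0 (2*pi)) (\<lambda>x. poisson (fst x) z (snd x))"
      using continuous_on_subset[OF continuous_on_poisson[OF z], of "{norm z<..R} \<times> cbox 0 (2*pi)"]
      by (simp add: split_beta Sigma_mono)
    show "continuous_on ({norm z<..R} \<times> cbox 0 (2*pi)) (\<lambda>(\<rho>, \<phi>). norm (f (of_real \<rho> * cis \<phi>)) powr p * poisson \<rho> z \<phi>)"
      unfolding split_beta using 1 2 p
      by (intro continuous_on_mult continuous_on_powr' continuous_on_norm continuous_on_const) auto
  qed
  then have "(I \<longlongrightarrow> I R) (at R within {norm z<..R})" using z by (simp add: continuous_on)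
  then have lim: "(I \<longlongrightarrow> I R) (at R within {norm z<..<R})"
    by (rule tendsto_within_subset) auto
  have ne: "at R within {norm z<..<R} \<noteq> bot"
    using islimpt_greaterThanLessThan2[OF z] by (simp add: trivial_limit_within)
  have "2 * pi * norm (f z) powr p \<le> I R"
  proof (rule tendsto_lowerbound[OF lim _ ne])
    show "\<forall>\<^sub>F \<rho> in at R within {norm z<..<R}. 2 * pi * norm (f z) powr p \<le> I \<rho>"
      unfolding eventually_at_filter using le by (auto simp: I_def cbox_interval intro!: always_eventually)
  qed
  then show ?thesis by (simp add: I_def cbox_interval)
qed

text \<open>
A zero-free \<open>f\<close> is \<open>exp h\<close>, so \<open>|f|\<^sup>p\<close> is the modulus of the holomorphic function \<open>exp (p h)\<close>, to which the Poisson
formula applies.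
\<close>

lemma powr_submean_nonvanishing:
  assumes holf: "f holomorphic_on ball 0 1" and p: "0 < p" and R: "R < 1" and z: "norm z < R"
    and nz: "\<And>w. norm w < R \<Longrightarrow> f w \<noteq> 0"
  shows "2 * pi * norm (f z) powr p \<le> integral {0..2*pi} (\<lambda>\<phi>. norm (f (of_real R * cis \<phi>)) powr p * poisson R z \<phi>)"
proof (rule poisson_submean_limit[OF holf p R z])
  fix \<rho> assume \<rho>: "norm z < \<rho>" "\<rho> < R"
  have "f holomorphic_on ball 0 R" using holf R by (auto intro: holomorphic_on_subset)
  then obtain h where h: "h holomorphic_on ball 0 R" "\<And>w. w \<in> ball 0 R \<Longrightarrow> f w = exp (h w)"
    using contractible_imp_holomorphic_log[of f "ball 0 R"] nz
    by (metis convex_ball convex_imp_contractible mem_ball_0)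
  define g where "g = (\<lambda>w. exp (of_real p * h w))"
  have ng: "norm (g w) = norm (f w) powr p" if "norm w < R" for w
  proof -
    have "norm (f w) = exp (Re (h w))" using h(2)[of w] that by simp
    then show ?thesis by (simp add: g_def powr_def)
  qed
  have hg: "g holomorphic_on ball 0 R" unfolding g_def by (intro holomorphic_intros h)
  have cg: "continuous_on (cball 0 \<rho>) g"
    by (rule continuous_on_subset[OF holomorphic_on_imp_continuous_on[OF hg]]) (use \<rho> in auto)
  have "g holomorphic_on ball 0 \<rho>" using hg \<rho> by (auto intro: holomorphic_on_subset)
  from poisson_formula[OF cg this \<rho>(1)]
  have int: "((\<lambda>\<phi>. g (of_real \<rho> * cis \<phi>) * of_real (poisson \<rho> z \<phi>)) has_integral 2 * of_real pi * g z) {0..2*pi}" .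
  have eq: "norm (g (of_real \<rho> * cis \<phi>) * of_real (poisson \<rho> z \<phi>)) = norm (f (of_real \<rho> * cis \<phi>)) powr p * poisson \<rho> z \<phi>" for \<phi>
  proof -
    have "0 < \<rho>" using \<rho> norm_ge_zero[of z] by linarith
    then have "norm (of_real \<rho> * cis \<phi>) < R" using \<rho> by (simp add: norm_mult)
    then show ?thesis using poisson_nonneg[OF \<rho>(1), of \<phi>] ng by (simp add: norm_mult)
  qed
  have cont: "continuous_on {0..2*pi} (\<lambda>\<phi>. g (of_real \<rho> * cis \<phi>) * of_real (poisson \<rho> z \<phi>))"
  proof -
    have "0 < \<rho>" using \<rho> norm_ge_zero[of z] by linarith
    then have 1: "continuous_on {0..2*pi} (\<lambda>\<phi>. g (of_real \<rho> * cis \<phi>))"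
      by (intro continuous_on_compose2[OF cg] continuous_intros) (auto simp: norm_mult)
    have 2: "continuous_on {0..2*pi} (\<lambda>\<phi>. poisson \<rho> z \<phi>)"
      unfolding poisson_def by (intro continuous_intros) (use norm_circle_diff_pos[OF \<rho>(1)] in force)
    show ?thesis by (intro continuous_intros 1 2)
  qed
  have "2 * pi * norm (f z) powr p = norm (2 * of_real pi * g z)"
    using ng[of z] z by (simp add: norm_mult)
  also have "\<dots> = norm (integral {0..2*pi} (\<lambda>\<phi>. g (of_real \<rho> * cis \<phi>) * of_real (poisson \<rho> z \<phi>)))"
    using int by (simp add: integral_unique)
  also have "\<dots> \<le> integral {0..2*pi} (\<lambda>\<phi>. norm (g (of_real \<rho> * cis \<phi>) * of_real (poisson \<rho> z \<phi>)))"
    by (rule continuous_on_imp_absolutely_integrable_on[OF cont])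
  finally show "2 * pi * norm (f z) powr p \<le> integral {0..2*pi} (\<lambda>\<phi>. norm (f (of_real \<rho> * cis \<phi>)) powr p * poisson \<rho> z \<phi>)"
    unfolding eq .
qed

text \<open>
The local factorisation at a zero is global, because the quotient is holomorphic away from the zero anyway.
\<close>

lemma holomorphic_divide_zero:
  assumes holf: "f holomorphic_on S" and S: "open S" "connected S"
    and a: "a \<in> S" "f a = 0" and w: "w \<in> S" "f w \<noteq> 0"
  obtains g m where "g holomorphic_on S" "\<And>u. u \<in> S \<Longrightarrow> f u = (u - a) ^ m * g u" "g a \<noteq> 0"
proof -
  have nc: "\<not> f constant_on S" using a w unfolding constant_on_def by metis
  obtain g r n where gr: "0 < n" "0 < r" "ball a r \<subseteq> S" "g holomorphic_on ball a r"
     "\<And>w. w \<in> ball a r \<Longrightarrow> f w = (w - a)^n * g w" "\<And>w. w \<in> ball a r \<Longrightarrow> g w \<noteq> 0"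
    by (rule holomorphic_factor_zero_nonconstant[OF holf S a nc]) (rule that)
  define h where "h = (\<lambda>u. if u \<in> ball a r then g u else f u / (u - a) ^ n)"
  have hh: "h u = f u / (u - a) ^ n" if "u \<noteq> a" for u
    using gr(5)[of u] that by (auto simp: h_def)
  have "h holomorphic_on (ball a r \<union> (S - {a}))"
  proof (rule holomorphic_on_Un)
    show "h holomorphic_on ball a r" using gr(4) by (rule holomorphic_transform) (simp add: h_def)
    have "(\<lambda>u. f u / (u - a) ^ n) holomorphic_on S - {a}"
      by (intro holomorphic_intros holomorphic_on_subset[OF holf]) auto
    then show "h holomorphic_on S - {a}" by (rule holomorphic_transform) (simp add: hh)
    show "open (ball a r)" "open (S - {a})" using S by auto
  qed
  moreover have "ball a r \<union> (S - {a}) = S" using gr(2,3) a by auto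
  moreover have "f u = (u - a) ^ n * h u" if "u \<in> S" for u
    using hh[of u] a gr(1) by (cases "u = a") (auto simp: field_simps)
  moreover have "h a \<noteq> 0" using gr(2,6) by (simp add: h_def)
  ultimately show ?thesis using that[of h n] by simp
qed

text \<open>
Both parts come from the identity
\<open>|R\<^sup>2 - cnj a u|\<^sup>2 - R\<^sup>2 |u - a|\<^sup>2 = (R\<^sup>2 - |u|\<^sup>2) (R\<^sup>2 - |a|\<^sup>2)\<close>.
\<close>

lemma blaschke_factor_norm:
  fixes a u :: complex
  assumes "norm a < R" "norm u \<le> R"
  shows "R * norm (u - a) \<le> norm (of_real (R\<^sup>2) - cnj a * u)"
    and "norm u = R \<Longrightarrow> R * norm (u - a) = norm (of_real (R\<^sup>2) - cnj a * u)"
proof -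
  have id: "(norm (of_real (R\<^sup>2) - cnj a * u))\<^sup>2 - (R * norm (u - a))\<^sup>2 = (R\<^sup>2 - (norm u)\<^sup>2) * (R\<^sup>2 - (norm a)\<^sup>2)"
    unfolding power_mult_distrib cmod_power2 by (simp add: power2_eq_square algebra_simps)
  have "R \<ge> 0" using assms norm_ge_zero[of a] by linarith
  { have "(norm u)\<^sup>2 \<le> R\<^sup>2" "(norm a)\<^sup>2 \<le> R\<^sup>2" using assms by (intro power_mono; simp)+
    then have "0 \<le> (R\<^sup>2 - (norm u)\<^sup>2) * (R\<^sup>2 - (norm a)\<^sup>2)" by simp
    then have "(R * norm (u - a))\<^sup>2 \<le> (norm (of_real (R\<^sup>2) - cnj a * u))\<^sup>2" using id by linarith
    then show "R * norm (u - a) \<le> norm (of_real (R\<^sup>2) - cnj a * u)" by (rule power2_le_imp_le) simp }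
  { assume "norm u = R"
    then have "(R * norm (u - a))\<^sup>2 = (norm (of_real (R\<^sup>2) - cnj a * u))\<^sup>2" using id by simp
    then show "R * norm (u - a) = norm (of_real (R\<^sup>2) - cnj a * u)"
      using \<open>R \<ge> 0\<close> by (simp add: power2_eq_iff_nonneg) }
qed

text \<open>
Induction on the number of distinct zeros in the open disc. Replacing the factor \<open>(u - a)\<^sup>m\<close> of a zero by
\<open>((R\<^sup>2 - cnj a u) / R)\<^sup>m\<close> removes that zero, does not change the modulus on the circle and does not decrease it inside.
\<close>

lemma powr_submean:
  assumes holf: "f holomorphic_on ball 0 1" and p: "0 < p" and R: "R < 1" and z: "norm z < R"
  shows "2 * pi * norm (f z) powr p \<le> integral {0..2*pi} (\<lambda>\<phi>. norm (f (of_real R * cis \<phi>)) powr p * poisson R z \<phi>)"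
proof -
  have R0: "0 < R" using z norm_ge_zero[of z] by linarith
  have main: "2 * pi * norm (f z) powr p \<le> integral {0..2*pi} (\<lambda>\<phi>. norm (f (of_real R * cis \<phi>)) powr p * poisson R z \<phi>)"
    if "f holomorphic_on ball 0 1" "finite {w \<in> ball 0 R. f w = 0}" "card {w \<in> ball 0 R. f w = 0} = k" for k f
    using that
  proof (induction k arbitrary: f)
    case 0
    then have "\<And>w. norm w < R \<Longrightarrow> f w \<noteq> 0" by auto
    then show ?case by (intro powr_submean_nonvanishing[OF 0(1) p R z])
  next
    case (Suc k)
    have "{w \<in> ball 0 R. f w = 0} \<noteq> {}" using Suc(4) by (metis card.empty nat.distinct(1))
    then obtain a where a: "norm a < R" "f a = 0" by auto
    have "\<exists>w\<in>ball 0 R. f w \<noteq> 0"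
    proof (rule ccontr)
      assume "\<not> ?thesis"
      then have "{w \<in> ball 0 R. f w = 0} = ball 0 R" by auto
      with Suc(3) have "finite (ball (0::complex) R)" by simp
      moreover have "uncountable (ball (0::complex) R)" using R0 by (rule uncountable_ball)
      ultimately show False by (simp add: countable_finite)
    qed
    then obtain w where w: "norm w < R" "f w \<noteq> 0" by auto
    obtain g m where g: "g holomorphic_on ball 0 1" "\<And>u. u \<in> ball 0 1 \<Longrightarrow> f u = (u - a) ^ m * g u" "g a \<noteq> 0"
      using holomorphic_divide_zero[OF Suc(2) open_ball connected_ball, of a w] a w R by auto
    \<comment> \<open>the zero factor is exchanged for a Blaschke factor of the same modulus on the circle\<close>
    define F where "F = (\<lambda>u. ((of_real (R\<^sup>2) - cnj a * u) / of_real R) ^ m * g u)"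
    have hF: "F holomorphic_on ball 0 1" unfolding F_def using R0 by (intro holomorphic_intros g) auto
    have m: "m > 0" using g(2)[of a] g(3) a R by (cases m) auto
    have fac: "of_real (R\<^sup>2) - cnj a * u \<noteq> 0" if "norm u < R" for u
    proof
      assume *: "of_real (R\<^sup>2) - cnj a * u = 0"
      then have "R * norm (u - a) \<le> 0" using blaschke_factor_norm(1)[OF a(1), of u] that by simp
      then have "u = a" using R0 by (simp add: mult_le_0_iff)
      with * have "of_real (R\<^sup>2) = (of_real ((norm a)\<^sup>2) :: complex)"
        unfolding complex_norm_square by (simp add: mult.commute)
      then have "R\<^sup>2 = (norm a)\<^sup>2" by (simp only: of_real_eq_iff)
      then show False using a R0 by simp
    qed
    have Z: "{u \<in> ball 0 R. F u = 0} = {u \<in> ball 0 R. f u = 0} - {a}"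
      using fac g(3) a R R0 m by (auto simp: F_def g(2))
    have "finite {u \<in> ball 0 R. F u = 0}" "card {u \<in> ball 0 R. F u = 0} = k"
      unfolding Z using Suc(3,4) a by auto
    from Suc.IH[OF hF this]
    have IH: "2 * pi * norm (F z) powr p \<le> integral {0..2*pi} (\<lambda>\<phi>. norm (F (of_real R * cis \<phi>)) powr p * poisson R z \<phi>)" .
    have "norm (f z) \<le> norm (F z)"
    proof -
      have "norm (z - a) \<le> norm ((of_real (R\<^sup>2) - cnj a * z) / of_real R)"
        using blaschke_factor_norm(1)[OF a(1), of z] z R0 by (simp add: norm_divide field_simps)
      then show ?thesis using g(2)[of z] z R
        by (simp add: F_def norm_mult norm_power mult_right_mono power_mono del: of_real_power)
    qed
    then have le: "2 * pi * norm (f z) powr p \<le> 2 * pi * norm (F z) powr p"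
      using p by (intro mult_left_mono powr_mono2) auto
    have "norm (F (of_real R * cis \<phi>)) = norm (f (of_real R * cis \<phi>))" for \<phi>
    proof -
      let ?u = "of_real R * cis \<phi>"
      have u: "norm ?u = R" using R0 by (simp add: norm_mult)
      then have "norm (?u - a) = norm ((of_real (R\<^sup>2) - cnj a * ?u) / of_real R)"
        using blaschke_factor_norm(2)[OF a(1), of ?u] R0 by (simp add: norm_divide field_simps)
      then show ?thesis using g(2)[of ?u] u R
        by (simp add: F_def norm_mult norm_power del: of_real_power)
    qed
    then show ?case using order_trans[OF le IH] by simp
  qed
  show ?thesis
  proof (cases "\<exists>w\<in>ball 0 R. f w \<noteq> 0")
    case False
    then have "f z = 0" using z by auto
    moreover have "0 \<le> integral {0..2*pi} (\<lambda>\<phi>. norm (f (of_real R * cis \<phi>)) powr p * poisson R z \<phi>)"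
      by (cases "(\<lambda>\<phi>. norm (f (of_real R * cis \<phi>)) powr p * poisson R z \<phi>) integrable_on {0..2*pi}")
        (auto intro!: integral_nonneg mult_nonneg_nonneg poisson_nonneg[OF z] simp: not_integrable_integral)
    ultimately show ?thesis by simp
  next
    case True
    have "finite {w \<in> ball 0 R. f w = 0}"
    proof (cases "f constant_on ball 0 1")
      case True
      with \<open>\<exists>w\<in>ball 0 R. f w \<noteq> 0\<close> R have "{w \<in> ball 0 R. f w = 0} = {}"
        unfolding constant_on_def by force
      then show ?thesis by (metis finite.emptyI)
    next
      case False
      have "finite {w \<in> cball 0 R. f w = 0}"
        by (rule holomorphic_compact_finite_zeros[OF holf _ _ _ _ False]) (use R in auto)
      then show ?thesis by (rule rev_finite_subset) auto
    qed
    then show ?thesis using main[OF holf] by blast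
  qed
qed

section \<open>Powers of extended nonnegative reals\<close>

lemma ennpow_ennreal: "0 \<le> x \<Longrightarrow> ennpow (ennreal x) a = ennreal (x powr a)"
  by (simp add: ennpow_def)

lemma ennpow_0 [simp]: "ennpow 0 a = 0"
  by (simp add: ennpow_def)

lemma ennpow_top [simp]: "ennpow top a = top"
  by (simp add: ennpow_def)

lemma ennpow_mono:
  assumes "0 < a" "x \<le> y" shows "ennpow x a \<le> ennpow y a"
proof (cases "y = top")
  case False
  then obtain u v where "x = ennreal u" "0 \<le> u" "y = ennreal v" "0 \<le> v"
    using assms(2) by (metis ennreal_cases top.extremum_unique)
  then show ?thesis using assms by (simp add: ennpow_ennreal powr_mono2)
qed simp

lemma ennpow_ennpow:
  assumes "0 < a" "0 < b"
  shows "ennpow (ennpow x a) b = ennpow x (a * b)"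
  by (cases x) (simp_all add: ennpow_ennreal powr_powr)

lemma ennpow_1 [simp]: "ennpow x 1 = x"
  by (cases x) (simp_all add: ennpow_ennreal)

lemma ennpow_inverse: "0 < a \<Longrightarrow> ennpow (ennpow x a) (1 / a) = x"
  "0 < a \<Longrightarrow> ennpow (ennpow x (1 / a)) a = x"
  by (simp_all add: ennpow_ennpow)

lemma ennpow_mult:
  assumes "0 < a"
  shows "ennpow (x * y) a = ennpow x a * ennpow y a"
proof -
  have *: "ennpow (top * y) a = top * ennpow y a" for y
  proof (cases "y = 0")
    case False
    then have "ennpow y a \<noteq> 0"
      by (cases y) (auto simp: ennpow_ennreal)
    with False show ?thesis by (simp add: ennreal_top_mult)
  qed simp
  show ?thesis
  proof (cases x)
    case (real r)
    show ?thesis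
    proof (cases y)
      case (real s)
      with \<open>x = ennreal r\<close> \<open>0 \<le> r\<close> show ?thesis
        by (simp add: ennpow_ennreal powr_mult flip: ennreal_mult)
    next
      case top
      with *[of x] show ?thesis by (simp add: mult.commute)
    qed
  next
    case top
    with * show ?thesis by simp
  qed
qed

lemma borel_measurable_ennpow [measurable]:
  assumes [measurable]: "f \<in> borel_measurable M"
  shows "(\<lambda>x. ennpow (f x) a) \<in> borel_measurable M"
  unfolding ennpow_def by measurable

lemma ennpow_ineq_iff:
  assumes "0 < a"
  shows "ennpow x (1 / a) \<le> y \<longleftrightarrow> x \<le> ennpow y a"
  by (metis assms divide_pos_pos ennpow_inverse ennpow_mono zero_less_one)

lemma infsum_ennreal_eq_SUP:
  fixes f :: "'a \<Rightarrow> ennreal"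
  shows "infsum f A = (SUP F\<in>{F. finite F \<and> F \<subseteq> A}. sum f F)"
  by (rule nonneg_infsum_complete) simp

lemma infsum_ennreal_le_iff:
  fixes f :: "'a \<Rightarrow> ennreal"
  shows "infsum f A \<le> B \<longleftrightarrow> (\<forall>F. finite F \<and> F \<subseteq> A \<longrightarrow> sum f F \<le> B)"
  unfolding infsum_ennreal_eq_SUP by (auto simp: SUP_le_iff)

lemma sum_le_infsum_ennreal:
  fixes f :: "'a \<Rightarrow> ennreal"
  assumes "finite F" "F \<subseteq> A"
  shows "sum f F \<le> infsum f A"
  using infsum_ennreal_le_iff[of f A "infsum f A"] assms by simp

section \<open>Powers of weighted sums\<close>

text \<open>
If \<open>M\<close> is the largest of the numbers \<open>u i * x i\<close>, then each \<open>x i\<close> is at most \<open>M / u i\<close>, and the power of \<open>M\<close>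
is one of the summands on the right. The argument makes no difference between \<open>e < 1\<close> and \<open>e \<ge> 1\<close>.
\<close>

lemma powr_sum_le_weighted:
  fixes x u :: "'a \<Rightarrow> real"
  assumes "finite F" "0 < e" "\<And>i. i \<in> F \<Longrightarrow> 0 \<le> x i" "\<And>i. i \<in> F \<Longrightarrow> 0 < u i"
    and S: "(\<Sum>i\<in>F. 1 / u i) \<le> S"
  shows "(\<Sum>i\<in>F. x i) powr e \<le> S powr e * (\<Sum>i\<in>F. u i powr e * x i powr e)"
proof (cases "F = {}")
  case False
  define M where "M = Max ((\<lambda>i. u i * x i) ` F)"
  have M: "u i * x i \<le> M" if "i \<in> F" for i unfolding M_def using assms(1) that by simp
  have "M \<in> (\<lambda>i. u i * x i) ` F" unfolding M_def using assms(1) False by (intro Max_in) auto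
  then obtain k where k: "k \<in> F" "M = u k * x k" by auto
  have M0: "0 \<le> M" using k assms by (simp add: less_imp_le)
  have S0: "0 \<le> S" using S sum_nonneg[of F "\<lambda>i. 1 / u i"] assms(4) by (simp add: less_imp_le)
  have "(\<Sum>i\<in>F. x i) \<le> (\<Sum>i\<in>F. (1 / u i) * M)"
    using M assms(4) by (intro sum_mono) (simp add: field_simps)
  also have "\<dots> \<le> S * M" unfolding sum_distrib_right[symmetric] using S M0 by (rule mult_right_mono)
  finally have "(\<Sum>i\<in>F. x i) powr e \<le> (S * M) powr e"
    using assms by (intro powr_mono2) (auto intro: sum_nonneg)
  also have "\<dots> = S powr e * (u k powr e * x k powr e)"
    using k S0 M0 assms by (simp add: powr_mult less_imp_le)
  also have "\<dots> \<le> S powr e * (\<Sum>i\<in>F. u i powr e * x i powr e)"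
    using assms(1) k by (intro mult_left_mono member_le_sum) auto
  finally show ?thesis .
qed (use assms in simp)

text \<open>
The distance of two indices; as a natural number it can serve as an exponent.
\<close>

definition gap :: "nat \<Rightarrow> nat \<Rightarrow> nat"
  where "gap j k = (j - k) + (k - j)"

lemma sum_power_gap_le:
  fixes \<eta> :: real
  assumes "finite F" "0 < \<eta>" "\<eta> < 1"
  shows "(\<Sum>j\<in>F. \<eta> ^ gap j k) \<le> 2 / (1 - \<eta>)"
proof -
  have part: "(\<Sum>j\<in>A. \<eta> ^ gap j k) \<le> 1 / (1 - \<eta>)" if "finite A" "inj_on (\<lambda>j. gap j k) A" for A
  proof -
    have "(\<Sum>j\<in>A. \<eta> ^ gap j k) = (\<Sum>i\<in>(\<lambda>j. gap j k) ` A. \<eta> ^ i)"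
      using that by (simp add: sum.reindex)
    also have "\<dots> \<le> (\<Sum>i. \<eta> ^ i)"
      by (rule sum_le_suminf) (use that assms in auto)
    also have "\<dots> = 1 / (1 - \<eta>)" using assms by (intro suminf_geometric) auto
    finally show ?thesis .
  qed
  have "(\<Sum>j\<in>F. \<eta> ^ gap j k) = (\<Sum>j\<in>F \<inter> {..k}. \<eta> ^ gap j k) + (\<Sum>j\<in>F - {..k}. \<eta> ^ gap j k)"
    using assms(1) by (rule sum.Int_Diff)
  also have "\<dots> \<le> 1 / (1 - \<eta>) + 1 / (1 - \<eta>)"
    by (intro add_mono part) (use assms(1) in \<open>auto simp: inj_on_def gap_def\<close>)
  finally show ?thesis by simp
qed

text \<open>
Geometric weights in \<open>powr_sum_le_weighted\<close>: the loss away from the index \<open>k\<close> is geometric, but with a ratio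
as close to \<open>1\<close> as desired, so that any geometric decay of the terms absorbs it.
\<close>

lemma powr_sum_le_gap:
  fixes e \<beta> :: real
  assumes "0 < e" "1 < \<beta>"
  obtains C where "0 < C" "\<And>F x k. finite F \<Longrightarrow> (\<And>j. j \<in> F \<Longrightarrow> 0 \<le> x j) \<Longrightarrow>
    (\<Sum>j\<in>F. x j) powr e \<le> C * (\<Sum>j\<in>F. \<beta> ^ gap j k * x j powr e)"
proof -
  define b where "b = \<beta> powr (1 / e)"
  have b: "1 < b" using assms powr_less_mono[of 0 "1/e" \<beta>] by (simp add: b_def)
  have be: "(b ^ n) powr e = \<beta> ^ n" for n
    using assms b by (simp add: b_def powr_powr flip: powr_realpow)
  define S where "S = 2 / (1 - 1 / b)"
  have S: "0 < S" using b by (simp add: S_def)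
  show ?thesis
  proof (rule that[of "S powr e"])
    show "0 < S powr e" using S by simp
    fix F :: "nat set" and x :: "nat \<Rightarrow> real" and k
    assume F: "finite F" "\<And>j. j \<in> F \<Longrightarrow> 0 \<le> x j"
    have "(\<Sum>j\<in>F. 1 / b ^ gap j k) \<le> S"
      using sum_power_gap_le[OF F(1), of "1 / b" k] b by (simp add: S_def power_one_over)
    from powr_sum_le_weighted[OF F(1) assms(1) F(2) _ this] b
    show "(\<Sum>j\<in>F. x j) powr e \<le> S powr e * (\<Sum>j\<in>F. \<beta> ^ gap j k * x j powr e)"
      by (simp add: be)
  qed
qed

section \<open>Averages over signs\<close>

definition signed :: "'a set \<Rightarrow> 'a \<Rightarrow> complex"
  where "signed S x = (if x \<in> S then 1 else - 1)"

lemma norm_signed [simp]: "norm (signed S x) = 1"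
  by (simp add: signed_def)

text \<open>
Changing the sign of the summand at \<open>y\<close> changes the sum by \<open>2 b(y)\<close>, so one of the two sums has norm at least \<open>|b(y)|\<close>.
\<close>

lemma half_of_signs:
  fixes b :: "'a \<Rightarrow> complex"
  assumes fin: "finite L" and y: "y \<in> L"
  shows "2 ^ card L \<le> 2 * card {S \<in> Pow L. norm (b y) \<le> norm (\<Sum>x\<in>L. signed S x * b x)}"
proof -
  define G where "G = {S \<in> Pow L. norm (b y) \<le> norm (\<Sum>x\<in>L. signed S x * b x)}"
  \<comment> \<open>an involution on the choices of signs that flips the sign at \<open>y\<close>\<close>
  define \<tau> where "\<tau> = (\<lambda>S. if y \<in> S then S - {y} else insert y S)"
  have finG: "finite G" using fin by (simp add: G_def)
  have "\<tau> S \<in> G" if S: "S \<in> Pow L" "S \<notin> G" for S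
  proof (rule ccontr)
    assume "\<tau> S \<notin> G"
    moreover have "\<tau> S \<in> Pow L" using S y by (auto simp: \<tau>_def)
    ultimately have lt: "norm (\<Sum>x\<in>L. signed (\<tau> S) x * b x) < norm (b y)" "norm (\<Sum>x\<in>L. signed S x * b x) < norm (b y)"
      using S by (auto simp: G_def not_le)
    define X where "X = (\<Sum>x\<in>L - {y}. signed S x * b x)"
    have "(\<Sum>x\<in>L - {y}. signed (\<tau> S) x * b x) = X" unfolding X_def
      by (rule sum.cong) (auto simp: signed_def \<tau>_def)
    then have e: "(\<Sum>x\<in>L. signed (\<tau> S) x * b x) = signed (\<tau> S) y * b y + X"
       "(\<Sum>x\<in>L. signed S x * b x) = signed S y * b y + X"
      using fin y by (simp_all add: sum.remove X_def)
    have "signed (\<tau> S) y = - signed S y" by (simp add: signed_def \<tau>_def)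
    then have "norm (2 * signed S y * b y) = norm ((signed S y * b y + X) - (signed (\<tau> S) y * b y + X))"
      by (simp add: algebra_simps)
    also have "\<dots> \<le> norm (signed S y * b y + X) + norm (signed (\<tau> S) y * b y + X)"
      by (rule norm_triangle_ineq4)
    also have "\<dots> < 2 * norm (b y)" using lt unfolding e by simp
    finally show False by (simp add: norm_mult)
  qed
  moreover have "\<tau> (\<tau> S) = S" for S by (auto simp: \<tau>_def)
  ultimately have "Pow L \<subseteq> G \<union> \<tau> ` G" by (metis UnCI image_eqI subsetI)
  then have "card (Pow L) \<le> card (G \<union> \<tau> ` G)" using finG by (intro card_mono) auto
  also have "\<dots> \<le> card G + card (\<tau> ` G)" by (rule card_Un_le)
  also have "\<dots> \<le> 2 * card G" using card_image_le[OF finG, of \<tau>] by simp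
  finally show ?thesis using fin by (simp add: G_def card_Pow)
qed

text \<open>
Since the values are at most \<open>T\<close> and their mean is at least \<open>T / 2\<close>, at least a quarter of them are at least \<open>T / 4\<close>. If
\<open>T\<close> is infinite, then so is one of the finitely many values.
\<close>

lemma average_powr_ge:
  fixes Y :: "'a \<Rightarrow> ennreal"
  assumes fin: "finite M" and e: "0 < e" and le: "\<And>S. S \<in> M \<Longrightarrow> Y S \<le> T"
    and avg: "ennreal (card M / 2) * T \<le> (\<Sum>S\<in>M. Y S)"
  shows "ennreal (card M * ((1 / 4) powr e / 4)) * ennpow T e \<le> (\<Sum>S\<in>M. ennpow (Y S) e)"
proof (cases "card M = 0")
  case False
  then have cM: "0 < card M" by simp
  show ?thesis
  proof (cases T)
    case top
    then have "(\<Sum>S\<in>M. Y S) = top" using avg cM by (simp add: ennreal_mult_top top_unique)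
    then obtain S where S: "S \<in> M" "Y S = top"
      using fin ennreal_sum_eq_top by auto
    then have "ennpow (Y S) e \<le> (\<Sum>S\<in>M. ennpow (Y S) e)" using fin by (intro member_le_sum) auto
    with S have "(\<Sum>S\<in>M. ennpow (Y S) e) = top" by (simp add: top_unique)
    then show ?thesis by simp
  next
    case (real \<tau>)
    have "\<exists>r. 0 \<le> r \<and> Y S = ennreal r" if "S \<in> M" for S
      using le[OF that] real by (metis ennreal_cases ennreal_less_top leD)
    then obtain y where y: "\<And>S. S \<in> M \<Longrightarrow> 0 \<le> y S" "\<And>S. S \<in> M \<Longrightarrow> Y S = ennreal (y S)" by metis
    have le': "y S \<le> \<tau>" if "S \<in> M" for S using le[OF that] y[OF that] real by (simp add: ennreal_le_iff)
    have "ennreal (card M / 2 * \<tau>) \<le> ennreal (\<Sum>S\<in>M. y S)"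
    proof -
      have "ennreal (card M / 2 * \<tau>) = ennreal (card M / 2) * T"
        unfolding real(2) using real(1) by (intro ennreal_mult) auto
      also have "\<dots> \<le> (\<Sum>S\<in>M. ennreal (y S))" using avg y by simp
      also have "\<dots> = ennreal (\<Sum>S\<in>M. y S)" using y by (intro sum_ennreal) auto
      finally show ?thesis .
    qed
    then have avg': "card M / 2 * \<tau> \<le> (\<Sum>S\<in>M. y S)"
      by (subst (asm) ennreal_le_iff) (auto intro: sum_nonneg y)
    define G where "G = {S\<in>M. \<tau> / 4 \<le> y S}"
    have finG: "finite G" using fin by (simp add: G_def)
    have "card M * ((1 / 4) powr e / 4) * \<tau> powr e \<le> (\<Sum>S\<in>M. y S powr e)"
    proof (cases "\<tau> = 0")
      case True
      then show ?thesis using e by (simp add: sum_nonneg)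
    next
      case False
      have "(\<Sum>S\<in>M. y S) \<le> (\<Sum>S\<in>M. \<tau> / 4 + (if S \<in> G then \<tau> else 0))"
      proof (rule sum_mono)
        fix S assume "S \<in> M"
        then show "y S \<le> \<tau> / 4 + (if S \<in> G then \<tau> else 0)"
          using le'[of S] real(1) by (auto simp: G_def)
      qed
      also have "\<dots> = card M * \<tau> / 4 + card G * \<tau>"
      proof -
        have "(\<Sum>S\<in>M. if S \<in> G then \<tau> else 0) = (\<Sum>S\<in>G. \<tau>)"
          by (rule sum.mono_neutral_cong_right) (use fin in \<open>auto simp: G_def\<close>)
        then show ?thesis by (simp add: sum.distrib)
      qed
      finally have "card M * \<tau> / 4 \<le> card G * \<tau>" using avg' by (simp add: field_simps)
      then have "card M / 4 * \<tau> \<le> card G * \<tau>" by simp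
      then have cG: "card M / 4 \<le> card G" using False real by (simp only: mult_le_cancel_right)
      have "card M * ((1 / 4) powr e / 4) * \<tau> powr e = card M / 4 * (\<tau> / 4) powr e"
        using real by (simp add: powr_divide powr_one_eq_one)
      also have "\<dots> \<le> card G * (\<tau> / 4) powr e" using cG by (intro mult_right_mono) auto
      also have "\<dots> = (\<Sum>S\<in>G. (\<tau> / 4) powr e)" by simp
      also have "\<dots> \<le> (\<Sum>S\<in>G. y S powr e)"
        using e real by (intro sum_mono powr_mono2) (auto simp: G_def)
      also have "\<dots> \<le> (\<Sum>S\<in>M. y S powr e)" by (rule sum_mono2) (use fin in \<open>auto simp: G_def\<close>)
      finally show ?thesis .
    qed
    then have "ennreal (card M * ((1 / 4) powr e / 4) * \<tau> powr e) \<le> ennreal (\<Sum>S\<in>M. y S powr e)"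
      by (rule ennreal_leI)
    also have "ennreal (card M * ((1 / 4) powr e / 4) * \<tau> powr e) = ennreal (card M * ((1 / 4) powr e / 4)) * ennpow T e"
      unfolding real(2) ennpow_ennreal[OF real(1)] by (intro ennreal_mult) auto
    also have "ennreal (\<Sum>S\<in>M. y S powr e) = (\<Sum>S\<in>M. ennpow (Y S) e)"
      using y by (simp add: ennpow_ennreal flip: sum_ennreal)
    finally show ?thesis .
  qed
qed simp

section \<open>Poisson kernels at equidistributed points\<close>

definition root_angle :: "nat \<Rightarrow> nat \<Rightarrow> real"
  where "root_angle N l = 2 * pi * (real l / real N)"

text \<open>
For each root of unity \<open>w\<close> the quotient \<open>1 / (1 - w x)\<close> is \<open>(1 + w x + \<dots> + (w x)\<^sup>N\<^sup>-\<^sup>1) / (1 - x\<^sup>N)\<close>; summing over \<open>w\<close>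
kills all powers but the zeroth.
\<close>

lemma sum_inverse_roots_of_unity:
  fixes x :: complex
  assumes N: "0 < N" and x: "norm x < 1"
  shows "(\<Sum>l<N. 1 / (1 - cis (root_angle N l) * x)) = of_nat N / (1 - x ^ N)"
proof -
  define w where "w = cis (2 * pi / N)"
  have wl: "cis (root_angle N l) = w ^ l" for l
    by (simp add: w_def root_angle_def Complex.DeMoivre mult.commute)
  have wN: "w ^ N = 1" using N by (simp add: w_def Complex.DeMoivre)
  have nw: "norm (w ^ l) = 1" for l by (simp add: w_def norm_power)
  have x1: "x ^ N \<noteq> 1"
  proof
    assume "x ^ N = 1"
    then have "norm x ^ N = 1" by (metis norm_one norm_power)
    moreover have "norm x ^ N < 1" using x N by (simp add: power_less_one_iff)
    ultimately show False by simp
  qed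
  have inv: "1 / (1 - w ^ l * x) = (\<Sum>k<N. (w ^ k) ^ l * x ^ k) / (1 - x ^ N)" for l
  proof -
    have "w ^ l * x \<noteq> 1"
    proof
      assume "w ^ l * x = 1"
      then have "norm (w ^ l * x) = 1" by simp
      then show False using x nw by (simp add: norm_mult)
    qed
    then have y: "1 - w ^ l * x \<noteq> 0" by simp
    have e: "(w ^ l * x) ^ k = (w ^ k) ^ l * x ^ k" for k
      by (simp only: power_mult_distrib power_mult[symmetric] mult.commute)
    have "1 - x ^ N = (1 - w ^ l * x) * (\<Sum>k<N. (w ^ k) ^ l * x ^ k)"
      using one_diff_power_eq[of "w ^ l * x" N] unfolding e by (simp add: wN)
    note eq = this
    have "(\<Sum>k<N. (w ^ k) ^ l * x ^ k) \<noteq> 0"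
    proof
      assume "(\<Sum>k<N. (w ^ k) ^ l * x ^ k) = 0"
      then show False using eq x1 by simp
    qed
    then show ?thesis unfolding eq by simp
  qed
  have orth: "(\<Sum>l<N. (w ^ k) ^ l) = (if k = 0 then of_nat N else 0)" if k: "k < N" for k
  proof (cases "k = 0")
    case False
    have wk: "w ^ k = cis (real k * (2 * pi / N))" by (simp only: w_def Complex.DeMoivre)
    have "w ^ k \<noteq> 1"
    proof
      assume "w ^ k = 1"
      then have "exp (2 * of_real pi * \<i> * of_nat k / of_nat N) = 1"
        unfolding wk cis_conv_exp by (simp add: mult_ac)
      then have "N dvd k" using complex_root_unity_eq_1[of N k] N by simp
      then show False using k False by (auto dest: dvd_imp_le)
    qed
    moreover have "1 - (w ^ k) ^ N = (1 - w ^ k) * (\<Sum>l<N. (w ^ k) ^ l)" by (rule one_diff_power_eq)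
    moreover have "(w ^ k) ^ N = (w ^ N) ^ k" by (simp add: mult.commute flip: power_mult)
    then have "(w ^ k) ^ N = 1" by (simp add: wN)
    ultimately show ?thesis using False by simp
  qed simp
  have "(\<Sum>l<N. 1 / (1 - cis (root_angle N l) * x)) = (\<Sum>l<N. \<Sum>k<N. (w ^ k) ^ l * x ^ k) / (1 - x ^ N)"
    unfolding wl inv by (rule sum_divide_distrib[symmetric])
  also have "(\<Sum>l<N. \<Sum>k<N. (w ^ k) ^ l * x ^ k) = (\<Sum>k<N. (\<Sum>l<N. (w ^ k) ^ l) * x ^ k)"
    by (subst sum.swap) (simp add: sum_distrib_right)
  also have "\<dots> = (\<Sum>k<N. if k = 0 then of_nat N else 0)"
    by (rule sum.cong) (auto simp: orth)
  also have "\<dots> = of_nat N" using N by simp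
  finally show ?thesis .
qed

lemma norm_cis_diff_le: "norm (cis a - cis b) \<le> \<bar>a - b\<bar>"
proof -
  have "sin ((b - a) / 2) = - sin ((a - b) / 2)"
    by (metis minus_diff_eq minus_divide_left sin_minus)
  then have "cis a - cis b = cis ((a + b) / 2) * (2 * \<i> * sin ((a - b) / 2))"
    by (simp add: complex_eq_iff cos_diff_cos sin_diff_sin)
  then have "norm (cis a - cis b) = 2 * \<bar>sin ((a - b) / 2)\<bar>"
    by (simp add: norm_mult)
  also have "\<dots> \<le> 2 * \<bar>(a - b) / 2\<bar>" by (intro mult_left_mono abs_sin_x_le_abs_x) auto
  finally show ?thesis by simp
qed

lemma poisson_eq_Re_inverse:
  assumes z: "norm z < 1"
  shows "poisson 1 z \<phi> = 2 * Re (1 / (1 - z * cis (- \<phi>))) - 1"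
proof -
  define x where "x = z * cis (- \<phi>)"
  have nx: "norm x = norm z" by (simp add: x_def norm_mult)
  have "cis \<phi> - z = cis \<phi> * (1 - x)" by (simp add: x_def algebra_simps cis_mult)
  then have d: "norm (cis \<phi> - z) = norm (1 - x)" by (simp add: norm_mult)
  have "1 - x \<noteq> 0" using z nx by auto
  then have pos: "0 < (norm (1 - x))\<^sup>2" by simp
  have e: "1 - (norm x)\<^sup>2 = 2 * (1 - Re x) - (norm (1 - x))\<^sup>2"
    unfolding cmod_power2 by (simp add: power2_eq_square algebra_simps)
  have "Re (1 / (1 - x)) = (1 - Re x) / (norm (1 - x))\<^sup>2"
    by (simp add: Re_divide cmod_power2)
  then show ?thesis unfolding poisson_def x_def[symmetric] using d nx e pos
    by (simp add: field_simps)
qed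

text \<open>
The Poisson kernel is \<open>2 Re (1 / (1 - x)) - 1\<close>, so its average over the \<open>N\<close>-th roots of unity is the Poisson kernel
of radius \<open>\<rho>\<^sup>N\<close>, which is bounded as long as \<open>\<rho>\<^sup>N\<close> stays away from \<open>1\<close>.
\<close>

lemma sum_poisson_roots_le:
  assumes \<rho>: "0 \<le> \<rho>" "\<rho> < 1" and N: "1 \<le> real N * (1 - \<rho>)"
  shows "(\<Sum>l<N. poisson 1 (of_real \<rho> * cis (root_angle N l)) \<phi>) \<le> 4 * N"
proof -
  have N0: "0 < N" using N by (cases N) auto
  define x where "x = of_real \<rho> * cis (- \<phi>)"
  have nx: "norm x = \<rho>" using \<rho> by (simp add: x_def norm_mult)
  have "(\<Sum>l<N. poisson 1 (of_real \<rho> * cis (root_angle N l)) \<phi>)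
    = (\<Sum>l<N. 2 * Re (1 / (1 - cis (root_angle N l) * x)) - 1)"
    using \<rho> by (intro sum.cong refl) (simp add: poisson_eq_Re_inverse norm_mult x_def mult_ac)
  also have "\<dots> = 2 * Re (\<Sum>l<N. 1 / (1 - cis (root_angle N l) * x)) - N"
    by (simp add: sum_subtractf sum_distrib_left)
  also have "\<dots> \<le> 2 * Re (\<Sum>l<N. 1 / (1 - cis (root_angle N l) * x))" by simp
  also have "(\<Sum>l<N. 1 / (1 - cis (root_angle N l) * x)) = of_nat N / (1 - x ^ N)"
    using sum_inverse_roots_of_unity[OF N0, of x] nx \<rho> by simp
  also have "2 * Re (of_nat N / (1 - x ^ N)) \<le> 2 * (N / (1 / 2))"
  proof -
    have "\<rho> ^ N \<le> exp (- (1 - \<rho>)) ^ N"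
      using \<rho> exp_ge_add_one_self[of "- (1 - \<rho>)"] by (intro power_mono) auto
    also have "\<dots> = exp (- (N * (1 - \<rho>)))" by (simp add: algebra_simps flip: exp_of_nat_mult)
    also have "\<dots> \<le> exp (- 1)" using N by simp
    also have "\<dots> \<le> 1 / 2" using exp_ge_add_one_self[of 1] by (simp add: exp_minus field_simps)
    finally have "norm (x ^ N) \<le> 1 / 2" by (simp add: norm_power nx)
    then have ge: "1 / 2 \<le> norm (1 - x ^ N)"
      using norm_triangle_ineq2[of 1 "x ^ N"] by simp
    have "Re (of_nat N / (1 - x ^ N)) \<le> norm (of_nat N / (1 - x ^ N))" by (rule complex_Re_le_cmod)
    also have "\<dots> = N / norm (1 - x ^ N)" by (simp add: norm_divide)
    also have "\<dots> \<le> N / (1 / 2)" using ge by (intro divide_left_mono) auto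
    finally show ?thesis by simp
  qed
  finally show ?thesis by simp
qed

lemma continuous_on_poisson_angle [continuous_intros]:
  "norm z < R \<Longrightarrow> continuous_on A (poisson R z)"
  unfolding poisson_def by (intro continuous_intros) (use norm_circle_diff_pos[of z R] in force)

lemma borel_measurable_poisson [measurable]:
  "norm z < R \<Longrightarrow> poisson R z \<in> borel_measurable borel"
  by (intro borel_measurable_continuous_onI continuous_on_poisson_angle)

lemma nn_integral_poisson:
  assumes "norm z < R"
  shows "(\<integral>\<^sup>+\<phi>\<in>{0..2*pi}. ennreal (poisson R z \<phi>) \<partial>lborel) = ennreal (2 * pi)"
  by (rule nn_integral_has_integral_lebesgue'[OF poisson_nonneg[OF assms] poisson_integral[OF assms]])

section \<open>Sums of concentrated kernels on the circle\<close>

text \<open>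
The kernel \<open>(1 - \<rho>) / |1 - \<rho> e\<^sup>i\<^sup>(\<^sup>\<theta>\<^sup>-\<^sup>\<alpha>\<^sup>)|\<close>: it has maximum \<open>1\<close> at \<open>\<alpha>\<close>, is concentrated on an arc of length
about \<open>1 - \<rho>\<close>, and its square is controlled by a Poisson kernel.
\<close>

definition bump :: "real \<Rightarrow> real \<Rightarrow> real \<Rightarrow> real"
  where "bump \<rho> \<alpha> \<theta> = (1 - \<rho>) / norm (cis \<theta> - of_real \<rho> * cis \<alpha>)"

lemma bump_pos:
  assumes "0 \<le> \<rho>" "\<rho> < 1" shows "0 < bump \<rho> \<alpha> \<theta>"
  using norm_circle_diff_pos[of "of_real \<rho> * cis \<alpha>" 1 \<theta>] assms by (simp add: bump_def norm_mult)

lemma bump_le_1: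
  assumes "0 \<le> \<rho>" "\<rho> < 1" shows "bump \<rho> \<alpha> \<theta> \<le> 1"
proof -
  have "1 - \<rho> \<le> norm (cis \<theta> - of_real \<rho> * cis \<alpha>)"
    using norm_triangle_ineq2[of "cis \<theta>" "of_real \<rho> * cis \<alpha>"] assms by (simp add: norm_mult)
  then show ?thesis using assms by (simp add: bump_def divide_le_eq_1)
qed

lemma bump_square_le_poisson:
  assumes "0 \<le> \<rho>" "\<rho> < 1"
  shows "(bump \<rho> \<alpha> \<theta>)\<^sup>2 \<le> (1 - \<rho>) * poisson 1 (of_real \<rho> * cis \<alpha>) \<theta>"
proof -
  have "1 - \<rho> \<le> 1 - \<rho>\<^sup>2" using assms by (simp add: power2_eq_square mult_left_le_one_le)
  then have "(1 - \<rho>)\<^sup>2 \<le> (1 - \<rho>) * (1 - \<rho>\<^sup>2)" using assms by (simp add: power2_eq_square)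
  then show ?thesis using assms
    by (simp add: bump_def poisson_def norm_mult power_divide divide_right_mono)
qed

text \<open>
The weights \<open>1 / bump\<^sup>2\<close> in \<open>powr_sum_le_weighted\<close> are admissible because the squares of the bumps sum to at most
\<open>4 N (1 - \<rho>)\<close>. They cost two powers of the bump; the remaining \<open>m\<close> powers, raised to \<open>p\<close>, are dominated
by a square again, which a Poisson kernel dominates in turn.
\<close>

lemma powr_mean_sum_bump_le:
  fixes b :: "nat \<Rightarrow> real"
  assumes \<rho>: "0 \<le> \<rho>" "\<rho> < 1" and N: "1 \<le> real N * (1 - \<rho>)"
    and p: "0 < p" and M: "2 \<le> p * real m" and b: "\<And>l. 0 \<le> b l"
  shows "(\<integral>\<^sup>+\<theta>\<in>{0..2*pi}. ennreal ((\<Sum>l<N. b l * bump \<rho> (root_angle N l) \<theta> ^ (m + 2)) powr p / (2*pi)) \<partial>lborel)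
    \<le> ennreal ((4 * N * (1 - \<rho>)) powr p * (1 - \<rho>) * (\<Sum>l<N. b l powr p))"
proof -
  define v where "v = (\<lambda>l. bump \<rho> (root_angle N l))"
  define P where "P = (\<lambda>l. poisson 1 (of_real \<rho> * cis (root_angle N l)))"
  define S where "S = 4 * N * (1 - \<rho>)"
  have nz: "norm (of_real \<rho> * cis (root_angle N l)) < 1" for l using \<rho> by (simp add: norm_mult)
  have v: "0 < v l \<theta>" "v l \<theta> \<le> 1" "(v l \<theta>)\<^sup>2 \<le> (1 - \<rho>) * P l \<theta>" for l \<theta>
    unfolding v_def P_def using \<rho> by (auto intro: bump_pos bump_le_1 bump_square_le_poisson)
  have P: "0 \<le> P l \<theta>" for l \<theta> unfolding P_def by (rule poisson_nonneg[OF nz])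
  have Pm: "(\<lambda>\<theta>. P l \<theta>) \<in> borel_measurable borel" for l unfolding P_def by (rule borel_measurable_poisson[OF nz])
  have PN: "(\<Sum>l<N. P l \<theta>) \<le> 4 * N" for \<theta>
    unfolding P_def by (rule sum_poisson_roots_le[OF \<rho> N])
  have pw: "(\<Sum>l<N. b l * v l \<theta> ^ (m + 2)) powr p \<le> S powr p * (1 - \<rho>) * (\<Sum>l<N. b l powr p * P l \<theta>)" for \<theta>
  proof -
    have "(\<Sum>l<N. b l * v l \<theta> ^ (m + 2)) powr p
      \<le> S powr p * (\<Sum>l<N. (1 / (v l \<theta>)\<^sup>2) powr p * (b l * v l \<theta> ^ (m + 2)) powr p)"
    proof (rule powr_sum_le_weighted)
      have "(\<Sum>l<N. 1 / (1 / (v l \<theta>)\<^sup>2)) \<le> (\<Sum>l<N. (1 - \<rho>) * P l \<theta>)"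
        using v by (intro sum_mono) simp
      also have "\<dots> = (1 - \<rho>) * (\<Sum>l<N. P l \<theta>)" by (simp add: sum_distrib_left)
      also have "\<dots> \<le> (1 - \<rho>) * (4 * N)" using \<rho> PN by (intro mult_left_mono) auto
      finally show "(\<Sum>l<N. 1 / (1 / (v l \<theta>)\<^sup>2)) \<le> S" by (simp add: S_def mult.commute)
      show "0 < 1 / (v l \<theta>)\<^sup>2" for l using v(1)[of l \<theta>] by simp
    qed (use p b v in \<open>auto simp: less_imp_le\<close>)
    also have "\<dots> \<le> S powr p * (\<Sum>l<N. (1 - \<rho>) * (b l powr p * P l \<theta>))"
    proof (intro mult_left_mono sum_mono)
      fix l
      have "(1 / (v l \<theta>)\<^sup>2) powr p * (b l * v l \<theta> ^ (m + 2)) powr p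
         = ((1 / (v l \<theta>)\<^sup>2) * (b l * v l \<theta> ^ (m + 2))) powr p"
        using v b by (intro powr_mult[symmetric])
      also have "(1 / (v l \<theta>)\<^sup>2) * (b l * v l \<theta> ^ (m + 2)) = b l * v l \<theta> ^ m"
        using v(1)[of l \<theta>] by (simp add: power_add field_simps power2_eq_square)
      also have "(b l * v l \<theta> ^ m) powr p = b l powr p * v l \<theta> powr (p * m)"
        using v(1)[of l \<theta>] b by (simp add: powr_mult less_imp_le powr_powr mult.commute flip: powr_realpow)
      also have "\<dots> \<le> b l powr p * v l \<theta> powr 2"
        using v[of l \<theta>] M by (intro mult_left_mono powr_mono') auto
      also have "v l \<theta> powr 2 = (v l \<theta>)\<^sup>2" using v(1)[of l \<theta>] by (simp add: powr_numeral)
      also have "b l powr p * (v l \<theta>)\<^sup>2 \<le> b l powr p * ((1 - \<rho>) * P l \<theta>)"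
        using v by (intro mult_left_mono) auto
      finally show "(1 / (v l \<theta>)\<^sup>2) powr p * (b l * v l \<theta> ^ (m + 2)) powr p \<le> (1 - \<rho>) * (b l powr p * P l \<theta>)"
        by (simp add: mult_ac)
    qed auto
    finally show ?thesis by (simp add: sum_distrib_left mult_ac)
  qed
  have "(\<integral>\<^sup>+\<theta>\<in>{0..2*pi}. ennreal ((\<Sum>l<N. b l * v l \<theta> ^ (m + 2)) powr p / (2*pi)) \<partial>lborel)
     \<le> (\<integral>\<^sup>+\<theta>. (\<Sum>l<N. ennreal (S powr p * (1 - \<rho>) / (2*pi) * b l powr p) * (ennreal (P l \<theta>) * indicator {0..2*pi} \<theta>)) \<partial>lborel)"
  proof (intro nn_integral_mono)
    fix \<theta>
    have "(\<Sum>l<N. b l * v l \<theta> ^ (m + 2)) powr p / (2*pi) \<le> (\<Sum>l<N. S powr p * (1 - \<rho>) / (2*pi) * b l powr p * P l \<theta>)"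
      using divide_right_mono[OF pw[of \<theta>], of "2*pi"] by (simp add: sum_distrib_left sum_divide_distrib mult_ac)
    then have "ennreal ((\<Sum>l<N. b l * v l \<theta> ^ (m + 2)) powr p / (2*pi)) \<le> ennreal (\<Sum>l<N. S powr p * (1 - \<rho>) / (2*pi) * b l powr p * P l \<theta>)"
      by (rule ennreal_leI)
    also have "\<dots> = (\<Sum>l<N. ennreal (S powr p * (1 - \<rho>) / (2*pi) * b l powr p) * ennreal (P l \<theta>))"
    proof (subst sum_ennreal[symmetric])
      show "(\<Sum>l<N. ennreal (S powr p * (1 - \<rho>) / (2*pi) * b l powr p * P l \<theta>))
        = (\<Sum>l<N. ennreal (S powr p * (1 - \<rho>) / (2*pi) * b l powr p) * ennreal (P l \<theta>))"
        by (intro sum.cong refl ennreal_mult) (use P \<rho> in auto)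
    qed (use P \<rho> in auto)
    finally show "ennreal ((\<Sum>l<N. b l * v l \<theta> ^ (m + 2)) powr p / (2*pi)) * indicator {0..2*pi} \<theta> \<le>
      (\<Sum>l<N. ennreal (S powr p * (1 - \<rho>) / (2*pi) * b l powr p) * (ennreal (P l \<theta>) * indicator {0..2*pi} \<theta>))"
      by (auto simp: indicator_def)
  qed
  also have "\<dots> = (\<Sum>l<N. ennreal (S powr p * (1 - \<rho>) / (2*pi) * b l powr p) * ennreal (2 * pi))"
    using Pm nn_integral_poisson[OF nz] by (simp add: nn_integral_sum nn_integral_cmult P_def)
  also have "\<dots> = (\<Sum>l<N. ennreal (S powr p * (1 - \<rho>) * b l powr p))"
    using \<rho> by (intro sum.cong refl) (simp flip: ennreal_mult)
  also have "\<dots> = ennreal (S powr p * (1 - \<rho>) * (\<Sum>l<N. b l powr p))"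
    using \<rho> by (simp add: sum_ennreal sum_distrib_left)
  finally show ?thesis by (simp add: v_def S_def)
qed

section \<open>Maxima over polar boxes\<close>

lemma cauchy_powr_estimate:
  assumes holf: "f holomorphic_on ball z (2 * \<delta>)" and \<delta>: "0 < \<delta>" and p: "0 < p" and X: "0 \<le> X"
    and le: "\<And>\<zeta>. norm (z - \<zeta>) = \<delta> \<Longrightarrow> norm (f \<zeta>) powr p \<le> X"
  shows "norm ((deriv ^^ n) f z) powr p \<le> (fact n / \<delta> ^ n) powr p * X"
proof -
  have "norm ((deriv ^^ n) f z) \<le> fact n * X powr (1 / p) / \<delta> ^ n"
  proof (rule Cauchy_inequality)
    show "f holomorphic_on ball z \<delta>" using holf \<delta> by (auto intro: holomorphic_on_subset)
    show "continuous_on (cball z \<delta>) f"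
      by (rule continuous_on_subset[OF holomorphic_on_imp_continuous_on[OF holf]]) (use \<delta> in auto)
    fix \<zeta> assume "norm (z - \<zeta>) = \<delta>"
    from le[OF this] have "(norm (f \<zeta>) powr p) powr (1 / p) \<le> X powr (1 / p)"
      using p by (intro powr_mono2) auto
    then show "norm (f \<zeta>) \<le> X powr (1 / p)" using p by (simp add: powr_powr)
  qed (rule \<delta>)
  then have "norm ((deriv ^^ n) f z) powr p \<le> (fact n / \<delta> ^ n * X powr (1 / p)) powr p"
    using p by (intro powr_mono2) auto
  also have "\<dots> = (fact n / \<delta> ^ n) powr p * X"
    using p X \<delta> by (subst powr_mult) (auto simp: powr_powr)
  finally show ?thesis .
qed

definition box_const :: "nat \<Rightarrow> real"
  where "box_const K = 2 * (real K + 1) * (4 * real K + 13)\<^sup>2"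

lemma box_const_pos: "0 < box_const K"
  by (simp add: box_const_def add_pos_nonneg)

text \<open>
Here \<open>\<kappa>\<close> is the distance from the unit circle of the outer edge of the box. A point \<open>\<zeta>\<close> near
the box and the grid point \<open>(1 - \<kappa>) e\<^sup>i\<^sup>\<alpha>\<close> are \<open>O(\<kappa>)\<close> apart, and so are the circles of
radius \<open>R\<close> and \<open>1\<close>, while \<open>\<zeta>\<close> has distance at least \<open>\<kappa> / 4\<close> from the circle of radius \<open>R\<close>. Hence the distances to a boundary
point are comparable, and so are the Poisson kernels.
\<close>

lemma poisson_box_le:
  fixes K :: nat and \<kappa> :: real
  assumes K: "2 \<le> K" and \<kappa>: "0 < \<kappa>" "\<kappa> \<le> 1 / K"
    and r: "1 - K * \<kappa> \<le> r" "r \<le> 1 - \<kappa>" "0 \<le> r" and \<theta>: "\<bar>\<theta> - \<alpha>\<bar> \<le> 2 * pi * \<kappa> / K\<^sup>2"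
    and R: "1 - \<kappa> / K \<le> R" "R \<le> 1"
    and \<zeta>: "norm (of_real r * cis \<theta> - \<zeta>) \<le> \<kappa> / K\<^sup>2"
  shows "norm \<zeta> < R" "poisson R \<zeta> \<phi> \<le> box_const K * poisson 1 (of_real (1 - \<kappa>) * cis \<alpha>) \<phi>"
proof -
  have K1: "\<kappa> / K \<le> \<kappa> / 2" using K \<kappa> by (intro divide_left_mono) auto
  have "4 \<le> (real K)\<^sup>2" using power_mono[of 2 "real K" 2] K by simp
  then have K2: "\<kappa> / K\<^sup>2 \<le> \<kappa> / 4" using \<kappa> K by (intro divide_left_mono) auto
  have nr: "norm (of_real r * cis \<theta>) = r" using r by (simp add: norm_mult)
  have z1: "norm \<zeta> \<le> r + \<kappa> / K\<^sup>2" using norm_triangle_sub[of \<zeta> "of_real r * cis \<theta>"] \<zeta> nr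
    by (simp add: norm_minus_commute)
  have z2: "r - \<kappa> / K\<^sup>2 \<le> norm \<zeta>" using norm_triangle_sub[of "of_real r * cis \<theta>" \<zeta>] \<zeta> nr by simp
  have gap: "\<kappa> / 4 \<le> R - norm \<zeta>" using z1 r R K1 K2 by linarith
  then show lt: "norm \<zeta> < R" using \<kappa> by simp
  have R0: "0 \<le> R" using lt norm_ge_zero[of \<zeta>] by linarith
  define d where "d = norm (of_real R * cis \<phi> - \<zeta>)"
  define D where "D = norm (cis \<phi> - of_real (1 - \<kappa>) * cis \<alpha>)"
  have dk: "\<kappa> / 4 \<le> d"
    unfolding d_def using gap norm_triangle_ineq2[of "of_real R * cis \<phi>" \<zeta>] R0 by (simp add: norm_mult)
  have "1 / real K \<le> 1" using K by simp
  then have k1: "\<kappa> \<le> 1" using \<kappa> by linarith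
  have "D \<le> d + (1 - R) + (K + 2 + 1/4) * \<kappa>"
  proof -
    have "cis \<phi> - of_real (1 - \<kappa>) * cis \<alpha> = (of_real R * cis \<phi> - \<zeta>) + of_real (1 - R) * cis \<phi> - (of_real r * cis \<theta> - \<zeta>)
        + of_real r * (cis \<theta> - cis \<alpha>) + of_real (r - (1 - \<kappa>)) * cis \<alpha>"
      by (simp add: algebra_simps)
    then have "D \<le> d + norm (of_real (1 - R) * cis \<phi>) + norm (of_real r * cis \<theta> - \<zeta>)
        + norm (of_real r * (cis \<theta> - cis \<alpha>)) + norm (of_real (r - (1 - \<kappa>)) * cis \<alpha>)"
      unfolding D_def d_def by (simp only:) (intro order_trans[OF norm_triangle_ineq] order_trans[OF norm_triangle_ineq4] add_mono order_refl)
    moreover have "norm (of_real (1 - R) * cis \<phi>) = 1 - R" using R by (simp add: norm_mult del: of_real_diff)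
    moreover have "norm (of_real (r - (1 - \<kappa>)) * cis \<alpha>) = (1 - \<kappa>) - r" using r by (simp add: norm_mult del: of_real_diff)
    moreover have "norm (of_real r * (cis \<theta> - cis \<alpha>)) \<le> 2 * \<kappa>"
    proof -
      have "norm (of_real r * (cis \<theta> - cis \<alpha>)) \<le> 1 * \<bar>\<theta> - \<alpha>\<bar>"
        unfolding norm_mult using r \<kappa> by (intro mult_mono norm_cis_diff_le) auto
      also have "\<dots> \<le> 2 * pi * (\<kappa> / K\<^sup>2)" using \<theta> by simp
      also have "\<dots> \<le> 2 * 4 * (\<kappa> / 4)" using K2 \<kappa> pi_less_4 by (intro mult_mono) auto
      finally show ?thesis by simp
    qed
    ultimately have "D \<le> d + (1 - R) + \<kappa> / 4 + 2 * \<kappa> + (K * \<kappa> - \<kappa>)"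
      using \<zeta> K2 r by linarith
    then show ?thesis using \<kappa> by (simp add: algebra_simps)
  qed
  also have "\<dots> \<le> d + (real K + 3) * (4 * d)"
  proof -
    have "(1 - R) + (K + 2 + 1/4) * \<kappa> \<le> (real K + 3) * \<kappa>" using R K1 by (simp add: algebra_simps)
    also have "\<dots> \<le> (real K + 3) * (4 * d)" using dk by (intro mult_left_mono) auto
    finally show ?thesis by simp
  qed
  finally have Dd: "D \<le> (4 * real K + 13) * d" by (simp add: algebra_simps)
  have D0: "0 < D" unfolding D_def using norm_circle_diff_pos[of "of_real (1 - \<kappa>) * cis \<alpha>" 1 \<phi>] \<kappa> k1
    by (simp add: norm_mult del: of_real_diff)
  have d0: "0 < d" using dk \<kappa> by linarith
  have num: "R\<^sup>2 - (norm \<zeta>)\<^sup>2 \<le> 2 * (real K + 1) * \<kappa>"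
  proof -
    have "R\<^sup>2 - (norm \<zeta>)\<^sup>2 = (R - norm \<zeta>) * (R + norm \<zeta>)" by (simp add: power2_eq_square algebra_simps)
    also have "\<dots> \<le> ((real K + 1) * \<kappa>) * 2"
    proof (rule mult_mono)
      have "R - norm \<zeta> \<le> K * \<kappa> + \<kappa>" using R z2 r K2 \<kappa> by linarith
      then show "R - norm \<zeta> \<le> (real K + 1) * \<kappa>" by (simp add: algebra_simps)
      show "R + norm \<zeta> \<le> 2" "0 \<le> R + norm \<zeta>" "0 \<le> (real K + 1) * \<kappa>"
        using R R0 lt \<kappa> norm_ge_zero[of \<zeta>] by (linarith, linarith, simp)
    qed
    finally show ?thesis by (simp add: mult_ac)
  qed
  have "\<kappa> \<le> 1 - (1 - \<kappa>)\<^sup>2" using \<kappa> k1 by (simp add: power2_eq_square algebra_simps mult_left_le)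
  then have "\<kappa> / D\<^sup>2 \<le> poisson 1 (of_real (1 - \<kappa>) * cis \<alpha>) \<phi>"
    unfolding poisson_def using k1 \<kappa> by (simp add: D_def norm_mult divide_right_mono del: of_real_diff)
  moreover have "poisson R \<zeta> \<phi> \<le> box_const K * (\<kappa> / D\<^sup>2)"
  proof -
    have "D\<^sup>2 \<le> ((4 * real K + 13) * d)\<^sup>2" using Dd D0 by (intro power_mono) auto
    then have "D\<^sup>2 \<le> (4 * real K + 13)\<^sup>2 * d\<^sup>2" by (simp only: power_mult_distrib)
    then have i: "1 / d\<^sup>2 \<le> (4 * real K + 13)\<^sup>2 / D\<^sup>2"
      using d0 D0 by (simp add: pos_le_divide_eq pos_divide_le_eq)
    have "poisson R \<zeta> \<phi> = (R\<^sup>2 - (norm \<zeta>)\<^sup>2) * (1 / d\<^sup>2)" by (simp add: poisson_def d_def)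
    also have "\<dots> \<le> (2 * (real K + 1) * \<kappa>) * ((4 * real K + 13)\<^sup>2 / D\<^sup>2)"
      using num i \<kappa> by (intro mult_mono) auto
    finally show ?thesis by (simp add: box_const_def mult_ac)
  qed
  ultimately show "poisson R \<zeta> \<phi> \<le> box_const K * poisson 1 (of_real (1 - \<kappa>) * cis \<alpha>) \<phi>"
    using box_const_pos[of K] by (meson mult_left_mono order_less_imp_le order_trans)
qed

lemma radius_facts:
  assumes "2 \<le> K"
  shows "0 \<le> radius K j" "radius K j < 1" "radius K j < radius K (Suc j)" "1 - radius K j = 1 / real K ^ j"
    "j \<le> k \<Longrightarrow> radius K j \<le> radius K k"
proof -
  show "0 \<le> radius K j" "radius K j < 1" "1 - radius K j = 1 / real K ^ j"
    using assms by (auto simp: radius_def field_simps)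
  show "radius K j < radius K (Suc j)" using assms by (simp add: radius_def field_simps)
  show "j \<le> k \<Longrightarrow> radius K j \<le> radius K k"
    using assms by (simp add: radius_def field_simps power_increasing)
qed

lemma continuous_on_circle_powr:
  assumes holf: "f holomorphic_on ball 0 1" and p: "0 < p" and R: "0 \<le> R" "R < 1"
  shows "continuous_on A (\<lambda>\<phi>. norm (f (of_real R * cis \<phi>)) powr p)"
proof -
  have "continuous_on (ball 0 1) f" using holf by (rule holomorphic_on_imp_continuous_on)
  then have "continuous_on A (\<lambda>\<phi>. f (of_real R * cis \<phi>))"
    by (rule continuous_on_compose2) (use R in \<open>auto intro!: continuous_intros simp: norm_mult\<close>)
  then show ?thesis using p by (intro continuous_on_powr' continuous_on_norm continuous_on_const) auto
qed

text \<open>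
Cauchy's estimate and \<open>powr_submean\<close> bound each term by a Poisson average over the circle of radius \<open>R\<close>, and by
\<open>sum_poisson_roots_le\<close> the kernels of one level add up. The bound holds on every circle with \<open>R \<ge> r\<^sub>j\<^sub>+\<^sub>1\<close>, so that it
can be integrated against a weight that may vanish on large sets.
\<close>

lemma sum_box_powr_le:
  assumes holf: "f holomorphic_on ball 0 1" and p: "0 < p" and K: "2 \<le> K" and j: "1 \<le> j"
    and R: "radius K (j + 1) \<le> R" "R < 1"
    and r: "\<And>l. l < K ^ (j + 2) \<Longrightarrow> radius K (j - 1) \<le> r l \<and> r l \<le> radius K j"
    and \<theta>: "\<And>l. l < K ^ (j + 2) \<Longrightarrow> \<theta> l \<in> arc_interval (K ^ (j + 2)) l"
  shows "(\<Sum>l<K ^ (j + 2). norm ((deriv ^^ n) f (of_real (r l) * cis (\<theta> l))) powr p)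
    \<le> (fact n * real K ^ (2 * n)) powr p * box_const K * 4 * (real K)\<^sup>2 * real K powr (real j * (n * p + 1))
      * (integral {0..2*pi} (\<lambda>\<phi>. norm (f (of_real R * cis \<phi>)) powr p) / (2 * pi))"
proof -
  define N where "N = K ^ (j + 2)"
  define \<kappa> where "\<kappa> = 1 / real K ^ j"
  define F where "F = (\<lambda>\<phi>. norm (f (of_real R * cis \<phi>)) powr p)"
  define P where "P = (\<lambda>l. poisson 1 (of_real (1 - \<kappa>) * cis (root_angle N l)))"
  define B where "B = (fact n * real K ^ ((j + 2) * n)) powr p"
  have K0: "0 < real K" using K by simp
  have \<kappa>: "0 < \<kappa>" "\<kappa> \<le> 1 / K"
  proof -
    show "0 < \<kappa>" using K0 by (simp add: \<kappa>_def)
    have "real K ^ 1 \<le> real K ^ j" using j K by (intro power_increasing) auto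
    then show "\<kappa> \<le> 1 / K" using K0 by (simp add: \<kappa>_def field_simps)
  qed
  have "1 / real K \<le> 1 / 2" using K by (intro divide_left_mono) auto
  then have \<kappa>1: "\<kappa> < 1" using \<kappa> by linarith
  have N\<kappa>: "1 / real N = \<kappa> / K\<^sup>2" by (simp add: N_def \<kappa>_def power_add power2_eq_square)
  have rad: "radius K (j - 1) = 1 - K * \<kappa>" "radius K j = 1 - \<kappa>" "radius K (j + 1) = 1 - \<kappa> / K"
    using j K0 by (auto simp: radius_def \<kappa>_def power_diff field_simps)
  have R0: "0 \<le> R" using radius_facts(1)[OF K, of "j+1"] R by linarith
  have nz: "norm (of_real (1 - \<kappa>) * cis (root_angle N l)) < 1" for l
    using \<kappa> \<kappa>1 by (simp add: norm_mult del: of_real_diff)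
  have cF: "continuous_on A F" for A
    unfolding F_def by (rule continuous_on_circle_powr[OF holf p R0 R(2)])
  have F0: "0 \<le> F \<phi>" for \<phi> by (simp add: F_def)
  have P0: "0 \<le> P l \<phi>" for l \<phi> unfolding P_def by (rule poisson_nonneg[OF nz])
  have cP: "continuous_on A (P l)" for A l unfolding P_def by (rule continuous_on_poisson_angle[OF nz])
  have int: "(\<lambda>\<phi>. F \<phi> * P l \<phi>) integrable_on {0..2*pi}" for l
    by (intro integrable_continuous_interval continuous_on_mult cF cP)
  have single: "norm ((deriv ^^ n) f (of_real (r l) * cis (\<theta> l))) powr p
    \<le> B * (box_const K / (2 * pi) * integral {0..2*pi} (\<lambda>\<phi>. F \<phi> * P l \<phi>))" if l: "l < N" for l
  proof -
    define z where "z = of_real (r l) * cis (\<theta> l)"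
    define \<delta> where "\<delta> = \<kappa> / K\<^sup>2"
    have \<delta>: "0 < \<delta>" using \<kappa> K0 by (simp add: \<delta>_def)
    have rl: "1 - K * \<kappa> \<le> r l" "r l \<le> 1 - \<kappa>" "0 \<le> r l"
      using r[of l] l radius_facts(1)[OF K, of "j - 1"] rad by (auto simp: N_def)
    have tl: "\<bar>\<theta> l - root_angle N l\<bar> \<le> 2 * pi * \<kappa> / K\<^sup>2"
    proof -
      have "root_angle N l \<le> \<theta> l" "\<theta> l \<le> root_angle N l + 2 * pi * (1 / N)"
        using \<theta>[of l] l unfolding arc_interval_def root_angle_def N_def[symmetric]
        by (auto simp: ring_distribs add_divide_distrib)
      then show ?thesis unfolding N\<kappa> by simp
    qed
    have nzr: "norm z = r l" using rl by (simp add: z_def norm_mult)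
    have d4: "\<delta> \<le> \<kappa> / 4"
    proof -
      have "4 \<le> (real K)\<^sup>2" using power_mono[of 2 "real K" 2] K by simp
      then show ?thesis unfolding \<delta>_def using \<kappa> K by (intro divide_left_mono) auto
    qed
    have "norm ((deriv ^^ n) f z) powr p \<le> (fact n / \<delta> ^ n) powr p * (box_const K / (2 * pi) * integral {0..2*pi} (\<lambda>\<phi>. F \<phi> * P l \<phi>))"
    proof (rule cauchy_powr_estimate)
      have "ball z (2 * \<delta>) \<subseteq> ball 0 1"
      proof
        fix w assume "w \<in> ball z (2 * \<delta>)"
        then have "norm (w - z) < 2 * \<delta>" by (simp add: dist_norm norm_minus_commute)
        then have "norm w < norm z + 2 * \<delta>" using norm_triangle_sub[of w z] by linarith
        then show "w \<in> ball 0 1" using d4 nzr rl \<kappa> by simp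
      qed
      then show "f holomorphic_on ball z (2 * \<delta>)" using holf by (rule holomorphic_on_subset[rotated])
      show "0 \<le> box_const K / (2 * pi) * integral {0..2*pi} (\<lambda>\<phi>. F \<phi> * P l \<phi>)"
        using box_const_pos[of K] F0 P0 int[of l]
        by (intro mult_nonneg_nonneg integral_nonneg) auto
      fix \<zeta> assume "norm (z - \<zeta>) = \<delta>"
      then have z: "norm (of_real (r l) * cis (\<theta> l) - \<zeta>) \<le> \<kappa> / K\<^sup>2" by (simp add: z_def \<delta>_def)
      have R': "1 - \<kappa> / K \<le> R" "R \<le> 1" using R rad by auto
      note box = poisson_box_le[OF K \<kappa> rl tl R' z]
      have "2 * pi * norm (f \<zeta>) powr p \<le> integral {0..2*pi} (\<lambda>\<phi>. F \<phi> * poisson R \<zeta> \<phi>)"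
        unfolding F_def by (rule powr_submean[OF holf p R(2) box(1)])
      also have "\<dots> \<le> integral {0..2*pi} (\<lambda>\<phi>. box_const K * (F \<phi> * P l \<phi>))"
      proof (rule integral_le)
        show "(\<lambda>\<phi>. F \<phi> * poisson R \<zeta> \<phi>) integrable_on {0..2*pi}"
          by (intro integrable_continuous_interval continuous_on_mult cF continuous_on_poisson_angle box)
        show "(\<lambda>\<phi>. box_const K * (F \<phi> * P l \<phi>)) integrable_on {0..2*pi}"
          by (rule integrable_on_mult_right[OF int])
        fix \<phi>
        show "F \<phi> * poisson R \<zeta> \<phi> \<le> box_const K * (F \<phi> * P l \<phi>)"
          using mult_left_mono[OF box(2)[of \<phi>] F0[of \<phi>]] by (simp add: P_def mult_ac)
      qed
      also have "\<dots> = box_const K * integral {0..2*pi} (\<lambda>\<phi>. F \<phi> * P l \<phi>)" by simp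
      finally show "norm (f \<zeta>) powr p \<le> box_const K / (2 * pi) * integral {0..2*pi} (\<lambda>\<phi>. F \<phi> * P l \<phi>)"
        by (simp add: field_simps)
    qed (use \<delta> p in auto)
    also have "fact n / \<delta> ^ n = fact n * real K ^ ((j + 2) * n)"
    proof -
      have "1 / \<delta> = real K ^ (j + 2)" using K0 by (simp add: \<delta>_def \<kappa>_def power_add power2_eq_square)
      then have "1 / \<delta> ^ n = real K ^ ((j + 2) * n)" by (metis power_mult power_one_over)
      then show ?thesis by (metis mult.right_neutral times_divide_eq_right)
    qed
    finally show ?thesis by (simp add: z_def B_def)
  qed
  have "(\<Sum>l<N. norm ((deriv ^^ n) f (of_real (r l) * cis (\<theta> l))) powr p)
     \<le> (\<Sum>l<N. B * (box_const K / (2 * pi) * integral {0..2*pi} (\<lambda>\<phi>. F \<phi> * P l \<phi>)))"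
    using single by (intro sum_mono) auto
  also have "\<dots> = B * (box_const K / (2 * pi)) * integral {0..2*pi} (\<lambda>\<phi>. \<Sum>l<N. F \<phi> * P l \<phi>)"
  proof -
    have "integral {0..2*pi} (\<lambda>\<phi>. \<Sum>l<N. F \<phi> * P l \<phi>) = (\<Sum>l<N. integral {0..2*pi} (\<lambda>\<phi>. F \<phi> * P l \<phi>))"
      by (rule integral_sum) (auto intro: int)
    then show ?thesis by (simp add: sum_distrib_left mult.assoc)
  qed
  also have "\<dots> \<le> B * (box_const K / (2 * pi)) * integral {0..2*pi} (\<lambda>\<phi>. (4 * N) * F \<phi>)"
  proof (intro mult_left_mono integral_le)
    show "(\<lambda>\<phi>. \<Sum>l<N. F \<phi> * P l \<phi>) integrable_on {0..2*pi}" by (intro integrable_sum int) auto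
    show "(\<lambda>\<phi>. (4 * N) * F \<phi>) integrable_on {0..2*pi}"
      by (intro integrable_continuous_interval continuous_on_mult cF continuous_on_const)
    fix \<phi>
    have "(1::real) \<le> real K * real K" using mult_mono[of 1 "real K" 1 "real K"] K by simp
    then have "1 \<le> real N * (1 - (1 - \<kappa>))" using K0 by (simp add: N_def \<kappa>_def power_add)
    then have "(\<Sum>l<N. P l \<phi>) \<le> 4 * N"
      unfolding P_def using \<kappa> \<kappa>1 by (intro sum_poisson_roots_le) auto
    from mult_left_mono[OF this F0[of \<phi>]]
    show "(\<Sum>l<N. F \<phi> * P l \<phi>) \<le> (4 * N) * F \<phi>" by (simp add: sum_distrib_left mult.commute)
  next
    show "0 \<le> B * (box_const K / (2 * pi))" using box_const_pos[of K] by (simp add: B_def)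
  qed
  also have "\<dots> = B * box_const K * 4 * N * (integral {0..2*pi} F / (2 * pi))" by simp
  also have "B * box_const K * 4 * N = (fact n * real K ^ (2 * n)) powr p * box_const K * 4 * (real K)\<^sup>2 * real K powr (real j * (n * p + 1))"
  proof -
    have "B = (fact n * real K ^ (2 * n)) powr p * (real K ^ (j * n)) powr p"
    proof -
      have "fact n * real K ^ ((j + 2) * n) = (fact n * real K ^ (2 * n)) * real K ^ (j * n)"
      proof -
        have "(j + 2) * n = 2 * n + j * n" by simp
        then show ?thesis by (simp only: power_add mult_ac)
      qed
      then show ?thesis unfolding B_def using K0 by (simp add: powr_mult)
    qed
    also have "(real K ^ (j * n)) powr p = real K powr (real j * n * p)"
      using K0 by (simp add: powr_powr flip: powr_realpow)
    finally have "B * N = (fact n * real K ^ (2 * n)) powr p * (K\<^sup>2 * (real K powr (real j * n * p) * real K powr j))"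
      using K0 by (simp add: N_def power_add powr_realpow power2_eq_square mult_ac)
    also have "real K powr (real j * n * p) * real K powr j = real K powr (real j * (n * p + 1))"
      by (simp add: algebra_simps flip: powr_add)
    finally show ?thesis by (simp add: mult_ac)
  qed
  finally show ?thesis by (simp add: N_def F_def)
qed

section \<open>Weights along lacunary radii\<close>

text \<open>
What the comparison of norms uses of the two doubling conditions: the integrals from the radii \<open>1 - K\<^sup>-\<^sup>j\<close> to \<open>1\<close> decrease
at least and at most geometrically.
\<close>

locale lacunary_weight =
  fixes \<omega> :: "real \<Rightarrow> real" and K :: nat and C\<^sub>0 D :: real
  assumes weight: "radial_weight \<omega>" and K: "2 \<le> K" and C0: "1 < C\<^sub>0"
    and lower: "\<And>j. C\<^sub>0 * weight_hat \<omega> (radius K (Suc j)) \<le> weight_hat \<omega> (radius K j)"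
    and upper: "\<And>j. weight_hat \<omega> (radius K j) \<le> D * weight_hat \<omega> (radius K (Suc j))"
begin

definition W :: "nat \<Rightarrow> real"
  where "W j = weight_hat \<omega> (radius K j)"

definition layer :: "nat \<Rightarrow> real set"
  where "layer j = {radius K j..<radius K (Suc j)}"

lemma W_pos: "0 < W j"
  using weight radius_facts(1,2)[OF K, of j] unfolding radial_weight_def W_def by auto

lemma W_lower: "C\<^sub>0 * W (Suc j) \<le> W j" and W_upper: "W j \<le> D * W (Suc j)"
  using lower upper by (simp_all add: W_def)

lemma D_gt_1: "1 < D"
proof -
  have "1 * W 1 < C\<^sub>0 * W 1" using C0 W_pos[of 1] by (intro mult_strict_right_mono) auto
  also have "\<dots> \<le> W 0" using W_lower[of 0] by simp
  also have "\<dots> \<le> D * W 1" using W_upper[of 0] by simp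
  finally show ?thesis using W_pos[of 1] by simp
qed

lemma layer_unit: "layer j \<subseteq> {0..<1}"
  using radius_facts(1)[OF K, of j] radius_facts(2)[OF K, of "Suc j"] unfolding layer_def by auto

lemma layer_disjoint: "r \<in> layer i \<Longrightarrow> r \<in> layer j \<Longrightarrow> i = j"
proof (induction i j rule: linorder_wlog)
  case (le i j)
  show ?case
  proof (rule ccontr)
    assume "i \<noteq> j"
    then have "radius K (Suc i) \<le> radius K j" using le by (intro radius_facts(5)[OF K]) auto
    then show False using le by (auto simp: layer_def)
  qed
next
  case (sym i j)
  then show ?case by auto
qed

lemma layer_cover:
  assumes "r \<in> {0..<1}" obtains j where "r \<in> layer j"
proof -
  have "\<exists>n. inverse (1 - r) < real K ^ n"
    using K by (intro real_arch_pow) auto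
  then obtain n where "inverse (1 - r) < real K ^ n" by auto
  then have "1 / real K ^ n < 1 - r" using assms K by (simp add: field_simps)
  then have ex: "r < radius K n" by (simp add: radius_def)
  define m where "m = (LEAST n. r < radius K n)"
  have m: "r < radius K m" unfolding m_def using ex by (rule LeastI)
  have "m \<noteq> 0" using m assms by (intro notI) (simp add: radius_def)
  then obtain j where j: "m = Suc j" by (cases m) auto
  have "\<not> r < radius K j" using not_less_Least[of j "\<lambda>n. r < radius K n"] j unfolding m_def[symmetric] by simp
  then show ?thesis using that[of j] m j by (simp add: layer_def)
qed

lemma sum_indicator_layer_le:
  assumes "finite F"
  shows "(\<Sum>j\<in>F. indicator (layer j) r) \<le> (indicator {0..<1} r :: ennreal)"
proof (cases "\<exists>j\<in>F. r \<in> layer j")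
  case True
  then obtain j where j: "j \<in> F" "r \<in> layer j" by auto
  have "(\<Sum>i\<in>F. indicator (layer i) r) = (\<Sum>i\<in>{j}. indicator (layer i) r :: ennreal)"
    using j layer_disjoint by (intro sum.mono_neutral_right) (auto simp: assms indicator_def)
  then show ?thesis using j layer_unit[of j] by (auto simp: indicator_def)
next
  case False
  then have "(\<Sum>i\<in>F. indicator (layer i) r :: ennreal) = 0" by (intro sum.neutral) auto
  then show ?thesis by simp
qed

lemma weight_nonneg: "r \<in> {0..<1} \<Longrightarrow> 0 \<le> \<omega> r"
  using weight by (simp add: radial_weight_def)

lemma weight_measurable [measurable]:
  "A \<in> sets lebesgue \<Longrightarrow> A \<subseteq> {0..<1} \<Longrightarrow> (\<lambda>r. ennreal (\<omega> r) * indicator A r) \<in> borel_measurable lebesgue"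
proof -
  assume A: "A \<in> sets lebesgue" "A \<subseteq> {0..<1}"
  have "set_integrable lebesgue {0..<1} \<omega>" using weight by (simp add: radial_weight_def)
  then have [measurable]: "(\<lambda>r. indicator {0..<1} r *\<^sub>R \<omega> r) \<in> borel_measurable lebesgue"
    unfolding set_integrable_def by (rule borel_measurable_integrable)
  have [measurable]: "A \<in> sets lebesgue" by (rule A)
  have "(\<lambda>r. ennreal (indicator {0..<1} r *\<^sub>R \<omega> r) * indicator A r) \<in> borel_measurable lebesgue" by measurable
  also have "(\<lambda>r. ennreal (indicator {0..<1} r *\<^sub>R \<omega> r) * indicator A r) = (\<lambda>r. ennreal (\<omega> r) * indicator A r)"
    using A by (intro ext) (auto simp: indicator_def)
  finally show ?thesis .
qed

lemma layer_sets [measurable]: "layer j \<in> sets lebesgue"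
  by (simp add: layer_def)

lemma layer_integral: "(\<integral>\<^sup>+r\<in>layer j. ennreal (\<omega> r) \<partial>lebesgue) = ennreal (W j - W (Suc j))"
proof -
  have int: "set_integrable lebesgue A \<omega>" if "A \<in> sets lebesgue" "A \<subseteq> {0..<1}" for A
    using weight that by (auto simp: radial_weight_def intro: set_integrable_subset)
  have sub: "layer j \<subseteq> {0..<1}" "{radius K (Suc j)..<1} \<subseteq> {0..<1}"
    using layer_unit radius_facts(1)[OF K, of "Suc j"] by auto
  have un: "{radius K j..<1} = layer j \<union> {radius K (Suc j)..<1}"
    using radius_facts(2,3)[OF K, of j] radius_facts(2)[OF K, of "Suc j"] by (auto simp: layer_def)
  have "W j = set_lebesgue_integral lebesgue (layer j) \<omega> + W (Suc j)"
    unfolding W_def weight_hat_def un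
    by (rule set_integral_Un) (use int sub in \<open>auto simp: layer_def\<close>)
  moreover have "(\<integral>\<^sup>+r\<in>layer j. ennreal (\<omega> r) \<partial>lebesgue) = ennreal (set_lebesgue_integral lebesgue (layer j) \<omega>)"
  proof -
    have "(\<integral>\<^sup>+r\<in>layer j. ennreal (\<omega> r) \<partial>lebesgue) = (\<integral>\<^sup>+r. ennreal (indicator (layer j) r *\<^sub>R \<omega> r) \<partial>lebesgue)"
      by (intro nn_integral_cong) (auto simp: indicator_def)
    also have "\<dots> = ennreal (set_lebesgue_integral lebesgue (layer j) \<omega>)"
      unfolding set_lebesgue_integral_def
    proof (rule nn_integral_eq_integral)
      show "integrable lebesgue (\<lambda>r. indicator (layer j) r *\<^sub>R \<omega> r)"
        using int[of "layer j"] sub by (simp add: set_integrable_def)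
      show "AE r in lebesgue. 0 \<le> indicator (layer j) r *\<^sub>R \<omega> r"
        using sub weight_nonneg by (intro AE_I2) (auto simp: indicator_def)
    qed
    finally show ?thesis .
  qed
  ultimately show ?thesis by simp
qed

text \<open>
The geometric decrease makes each tail comparable to the mass of the weight in a single layer.
\<close>

lemma W_le_layer: "W j \<le> D / (1 - 1 / C\<^sub>0) * (W (Suc j) - W (Suc (Suc j)))"
proof -
  have "W (Suc (Suc j)) \<le> W (Suc j) / C\<^sub>0" using W_lower[of "Suc j"] C0 by (simp add: field_simps)
  then have "(1 - 1 / C\<^sub>0) * W (Suc j) \<le> W (Suc j) - W (Suc (Suc j))" by (simp add: algebra_simps)
  moreover have "0 < 1 - 1 / C\<^sub>0" using C0 by simp
  ultimately have "W (Suc j) \<le> (W (Suc j) - W (Suc (Suc j))) / (1 - 1 / C\<^sub>0)"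
    by (simp add: pos_le_divide_eq mult.commute)
  then have "D * W (Suc j) \<le> D * ((W (Suc j) - W (Suc (Suc j))) / (1 - 1 / C\<^sub>0))"
    using D_gt_1 by (intro mult_left_mono) auto
  then show ?thesis using W_upper[of j] by simp
qed

end

section \<open>Integral means\<close>

lemma circle_integral_finite:
  assumes holf: "f holomorphic_on ball 0 1" and p: "0 < p" and R: "0 \<le> R" "R < 1"
  shows "(\<integral>\<^sup>+\<theta>\<in>{0..2*pi}. ennreal (norm (f (of_real R * cis \<theta>)) powr p / (2*pi)) \<partial>lborel)
    = ennreal (integral {0..2*pi} (\<lambda>\<phi>. norm (f (of_real R * cis \<phi>)) powr p) / (2 * pi))"
proof (rule nn_integral_has_integral_lebesgue')
  have "continuous_on {0..2*pi} (\<lambda>\<phi>. norm (f (of_real R * cis \<phi>)) powr p)"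
    by (rule continuous_on_circle_powr[OF holf p R])
  then have "((\<lambda>\<phi>. norm (f (of_real R * cis \<phi>)) powr p) has_integral
      integral {0..2*pi} (\<lambda>\<phi>. norm (f (of_real R * cis \<phi>)) powr p)) {0..2*pi}"
    by (intro integrable_integral integrable_continuous_interval)
  then show "((\<lambda>\<phi>. norm (f (of_real R * cis \<phi>)) powr p / (2 * pi)) has_integral
      integral {0..2*pi} (\<lambda>\<phi>. norm (f (of_real R * cis \<phi>)) powr p) / (2 * pi)) {0..2*pi}"
    by (rule has_integral_divide)
qed simp

text \<open>
Extending \<open>f\<close> by \<open>0\<close> outside the disc makes the integrand jointly measurable on the whole plane.
\<close>

lemma integral_mean_measurable:
  assumes holf: "f holomorphic_on ball 0 1"
  shows "(\<lambda>r. integral_mean p r f * indicator {0..<1} r) \<in> borel_measurable borel"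
proof -
  have cf: "continuous_on (ball 0 1) f" using holf by (rule holomorphic_on_imp_continuous_on)
  define g where "g = (\<lambda>z. indicator (ball 0 1) z *\<^sub>R f z)"
  have [measurable]: "g \<in> borel_measurable borel"
    unfolding g_def by (rule borel_measurable_continuous_on_indicator[OF _ cf]) simp
  have [measurable]: "(\<lambda>x. of_real (fst x) * cis (snd x)) \<in> borel_measurable (lborel \<Otimes>\<^sub>M lborel)"
  proof -
    have "(\<lambda>x::real \<times> real. complex_of_real (fst x) * cis (snd x)) \<in> borel_measurable borel"
      by (intro borel_measurable_continuous_onI continuous_intros)
    then show ?thesis by (simp add: lborel_prod)
  qed
  have "(\<lambda>x. ennreal (norm (g (of_real (fst x) * cis (snd x))) powr p / (2*pi)) * indicator {0..2*pi} (snd x))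
     \<in> borel_measurable (lborel \<Otimes>\<^sub>M lborel)" by measurable
  then have [measurable]: "(\<lambda>r. \<integral>\<^sup>+\<theta>\<in>{0..2*pi}. ennreal (norm (g (of_real r * cis \<theta>)) powr p / (2*pi)) \<partial>lborel) \<in> borel_measurable borel"
    using lborel.borel_measurable_nn_integral[of "\<lambda>r \<theta>. ennreal (norm (g (of_real r * cis \<theta>)) powr p / (2*pi)) * indicator {0..2*pi} \<theta>" lborel]
    by (simp add: split_beta)
  have "(\<lambda>r. integral_mean p r g * indicator {0..<1} r) \<in> borel_measurable borel"
    unfolding integral_mean_def by measurable
  also have "(\<lambda>r. integral_mean p r g * indicator {0..<1} r) = (\<lambda>r. integral_mean p r f * indicator {0..<1} r)"
  proof
    fix r
    have "g (of_real r * cis \<theta>) = f (of_real r * cis \<theta>)" if "r \<in> {0..<1}" for \<theta>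
      using that by (auto simp: g_def norm_mult)
    then show "integral_mean p r g * indicator {0..<1} r = integral_mean p r f * indicator {0..<1} r"
      by (auto simp: integral_mean_def indicator_def)
  qed
  finally show ?thesis .
qed

section \<open>From the sequence inequality to the function inequality\<close>

lemma infsum_atLeast_1_ennreal:
  fixes f :: "nat \<Rightarrow> ennreal"
  shows "infsum f {1..} = (\<Sum>i. f (Suc i))"
proof -
  have "infsum f {1..} = infsum f (range Suc)"
    by (rule arg_cong[of _ _ "infsum f"]) (auto simp: image_iff, metis Suc_le_D)
  also have "\<dots> = infsum (\<lambda>i. f (Suc i)) UNIV" by (subst infsum_reindex) (auto simp: o_def)
  also have "\<dots> = (\<Sum>i. f (Suc i))"
    by (metis has_sum_imp_sums has_sum_infsum nonneg_summable_on_complete sums_unique zero_le)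
  finally show ?thesis .
qed

lemma emeasure_data_measurable:
  assumes "measure_data \<mu> \<nu>" "E \<in> sets (restrict_space borel {0..2*pi})"
  shows "(\<lambda>r. emeasure (\<mu> r) E) \<in> borel_measurable \<nu>"
proof -
  have "sets \<nu> = sets (restrict_space borel {0..<1})" using assms(1) by (simp add: measure_data_def)
  then show ?thesis using assms by (subst measurable_cong_sets) (auto simp: measure_data_def)
qed

lemma measure_data_space:
  assumes "measure_data \<mu> \<nu>"
  shows "space \<nu> = {0..<1}" "r \<in> {0..<1} \<Longrightarrow> space (\<mu> r) = {0..2*pi}"
    "r \<in> {0..<1} \<Longrightarrow> sets (\<mu> r) = sets (restrict_space borel {0..2*pi})"
proof -
  have "sets \<nu> = sets (restrict_space borel {0..<1})" using assms by (simp add: measure_data_def)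
  from sets_eq_imp_space_eq[OF this] show "space \<nu> = {0..<1}" by (simp add: space_restrict_space)
  assume r: "r \<in> {0..<1}"
  then show s: "sets (\<mu> r) = sets (restrict_space borel {0..2*pi})" using assms by (simp add: measure_data_def)
  from sets_eq_imp_space_eq[OF this] show "space (\<mu> r) = {0..2*pi}" by (simp add: space_restrict_space)
qed

lemma arc_interval_subset:
  assumes "l < N" shows "arc_interval N l \<subseteq> {0..2*pi}"
proof -
  have "real (l + 1) / real N \<le> 1" using assms by (simp add: divide_le_eq)
  then have "2 * pi * (real (l + 1) / real N) \<le> 2 * pi * 1" by (intro mult_left_mono) auto
  then show ?thesis unfolding arc_interval_def by auto
qed

lemma arc_interval_sets:
  assumes "l < N" shows "arc_interval N l \<in> sets (restrict_space borel {0..2*pi})"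
  using arc_interval_subset[OF assms]
  by (subst sets_restrict_space_iff) (auto simp: arc_interval_def)

text \<open>
The index is the integer part of \<open>N \<theta> / 2\<pi>\<close>, except at the end point \<open>2\<pi>\<close>, which only the last arc contains.
\<close>

lemma arc_interval_cover:
  assumes "0 < N" "\<theta> \<in> {0..2*pi}"
  obtains l where "l < N" "\<theta> \<in> arc_interval N l"
proof (cases "\<theta> = 2 * pi")
  case True
  have "\<theta> \<in> arc_interval N (N - 1)"
    using assms True unfolding arc_interval_def by (auto simp: of_nat_diff field_simps)
  then show ?thesis using that[of "N - 1"] assms by simp
next
  case False
  define x where "x = real N * \<theta> / (2 * pi)"
  have x: "0 \<le> x" "x < N" using assms False by (auto simp: x_def field_simps)
  define l where "l = nat \<lfloor>x\<rfloor>"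
  have l: "real l \<le> x" "x < real l + 1" using x by (auto simp: l_def)
  have "l < N" using l x by linarith
  moreover have "\<theta> = 2 * pi * (x / N)" using assms by (simp add: x_def)
  then have "\<theta> \<in> arc_interval N l"
    using l assms unfolding arc_interval_def by (auto intro!: mult_left_mono divide_right_mono)
  ultimately show ?thesis by (rule that)
qed

context lacunary_weight
begin

text \<open>
For every \<open>R\<close> in the layer \<open>j + 1\<close> the contribution of level \<open>j\<close> to the sequence norm is at most a constant
times \<open>W j\<close> times the \<open>q\<close>-th power of the integral mean at \<open>R\<close>. Integrating over that layer
against \<open>\<omega>\<close> replaces \<open>W j\<close> by a constant, and the layers are disjoint.
\<close>

lemma sampled_seq_norm_le:
  fixes p q :: real and n :: nat
  assumes p: "0 < p" and q: "0 < q"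
  obtains B where "0 < B" "\<And>f r \<theta>. f holomorphic_on ball 0 1 \<Longrightarrow>
    (\<And>j l. 1 \<le> j \<Longrightarrow> l < K ^ (j + 2) \<Longrightarrow> radius K (j - 1) \<le> r j l \<and> r j l \<le> radius K j \<and> \<theta> j l \<in> arc_interval (K ^ (j + 2)) l) \<Longrightarrow>
    seq_norm p q (\<lambda>j. K ^ (j + 2)) (\<lambda>j l. of_real (norm ((deriv ^^ n) f (of_real (r j l) * cis (\<theta> j l)))
       * (real K powr (- (real j * (n + 1 / p))) * W j powr (1 / q))))
    \<le> ennreal B * mixed_norm p q \<omega> f"
proof -
  define A where "A = (fact n * real K ^ (2 * n)) powr p * box_const K * 4 * (real K)\<^sup>2"
  define E where "E = A powr (q / p) * (D / (1 - 1 / C\<^sub>0))"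
  have K0: "0 < real K" using K by simp
  have A: "0 < A" using K0 box_const_pos[of K] by (simp add: A_def)
  have E: "0 < E" using A C0 D_gt_1 by (simp add: E_def)
  show ?thesis
  proof (rule that[of "E powr (1 / q)"])
    show "0 < E powr (1 / q)" using E by simp
    fix f r \<theta>
    assume holf: "f holomorphic_on ball 0 1"
    assume box: "\<And>j l. 1 \<le> j \<Longrightarrow> l < K ^ (j + 2) \<Longrightarrow> radius K (j - 1) \<le> r j l \<and> r j l \<le> radius K j \<and> \<theta> j l \<in> arc_interval (K ^ (j + 2)) l"
    define b where "b = (\<lambda>j l. norm ((deriv ^^ n) f (of_real (r j l) * cis (\<theta> j l))))"
    define c where "c = (\<lambda>j. real K powr (- (real j * (n + 1 / p))) * W j powr (1 / q))"
    define S where "S = (\<lambda>j. \<Sum>l<K ^ (j + 2). (b j l * c j) powr p)"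
    define m where "m = (\<lambda>R. ennpow (integral_mean p R f) q)"
    define I where "I = (\<lambda>R. integral {0..2*pi} (\<lambda>\<phi>. norm (f (of_real R * cis \<phi>)) powr p) / (2 * pi))"
    have c: "0 < c j" for j using K0 W_pos[of j] by (simp add: c_def)
    have cp: "c j powr p = real K powr (- (real j * (n * p + 1))) * W j powr (p / q)" for j
    proof -
      have "(real n + 1 / p) * p = n * p + 1" using p by (simp add: distrib_right)
      then have e: "- (real j * (real n + 1 / p)) * p = - (real j * (n * p + 1))"
        by (simp only: mult.assoc mult_minus_left)
      have "c j powr p = real K powr (- (real j * (real n + 1 / p)) * p) * W j powr (1 / q * p)"
        unfolding c_def using W_pos[of j] K0 by (simp add: powr_mult powr_powr)
      then show ?thesis unfolding e by simp
    qed
    have b: "0 \<le> b j l" for j l by (simp add: b_def)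
    have S0: "0 \<le> S j" for j by (simp add: S_def sum_nonneg)
    have I0: "0 \<le> I R" for R unfolding I_def
      by (cases "(\<lambda>\<phi>. norm (f (of_real R * cis \<phi>)) powr p) integrable_on {0..2*pi}")
         (auto intro!: divide_nonneg_nonneg integral_nonneg simp: not_integrable_integral)
    have mI: "m R = ennreal (I R powr (q / p))" if "0 \<le> R" "R < 1" for R
      using circle_integral_finite[OF holf p that] p q I0[of R]
      by (simp add: m_def integral_mean_def I_def ennpow_ennreal powr_powr)
    have meas: "(\<lambda>R. m R * ennreal (\<omega> R) * indicator X R) \<in> borel_measurable lebesgue"
      if X: "X \<in> sets lebesgue" "X \<subseteq> {0..<1}" for X
    proof -
      note [measurable] = weight_measurable[OF X]
      have "(\<lambda>r. integral_mean p r f * indicator {0..<1} r) \<in> borel_measurable lborel"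
        using integral_mean_measurable[OF holf] by simp
      then have [measurable]: "(\<lambda>r. integral_mean p r f * indicator {0..<1} r) \<in> borel_measurable lebesgue"
        by (rule measurable_completion)
      have "(\<lambda>R. ennpow (integral_mean p R f * indicator {0..<1} R) q * (ennreal (\<omega> R) * indicator X R)) \<in> borel_measurable lebesgue"
        by measurable
      also have "(\<lambda>R. ennpow (integral_mean p R f * indicator {0..<1} R) q * (ennreal (\<omega> R) * indicator X R)) = (\<lambda>R. m R * ennreal (\<omega> R) * indicator X R)"
        using X by (intro ext) (auto simp: m_def indicator_def)
      finally show ?thesis .
    qed
    have layer_bound: "ennreal (S j powr (q / p)) \<le> ennreal E * (\<integral>\<^sup>+R\<in>layer (Suc j). m R * ennreal (\<omega> R) \<partial>lebesgue)"
      if j: "1 \<le> j" for j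
    proof -
      define w where "w = W (Suc j) - W (Suc (Suc j))"
      have w: "0 < w"
      proof -
        have "1 * W (Suc (Suc j)) < C\<^sub>0 * W (Suc (Suc j))" using C0 W_pos by (intro mult_strict_right_mono)
        then show ?thesis using W_lower[of "Suc j"] by (simp add: w_def)
      qed
      have pt: "S j powr (q / p) \<le> A powr (q / p) * W j * I R powr (q / p)" if R: "R \<in> layer (Suc j)" for R
      proof -
        have R': "radius K (j + 1) \<le> R" "R < 1" "0 \<le> R" using R layer_unit[of "Suc j"] by (auto simp: layer_def)
        have "(\<Sum>l<K ^ (j + 2). b j l powr p) \<le> A * real K powr (real j * (n * p + 1)) * I R"
          unfolding b_def A_def I_def by (rule sum_box_powr_le[OF holf p K j R'(1,2)]) (use box j in auto)
        then have "c j powr p * (\<Sum>l<K ^ (j + 2). b j l powr p) \<le> c j powr p * (A * real K powr (real j * (n * p + 1)) * I R)"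
          by (intro mult_left_mono) auto
        also have "\<dots> = A * W j powr (p / q) * I R" using K0 by (simp add: cp powr_minus)
        also have "c j powr p * (\<Sum>l<K ^ (j + 2). b j l powr p) = S j"
          using b c by (simp add: S_def powr_mult less_imp_le sum_distrib_left mult.commute)
        finally have "S j powr (q / p) \<le> (A * W j powr (p / q) * I R) powr (q / p)"
          using S0 p q by (intro powr_mono2) auto
        also have "\<dots> = A powr (q / p) * W j * I R powr (q / p)"
          using A W_pos[of j] I0[of R] p q by (simp add: powr_mult powr_powr)
        finally show ?thesis .
      qed
      have "ennreal (S j powr (q / p)) * ennreal w = (\<integral>\<^sup>+R. ennreal (S j powr (q / p)) * (ennreal (\<omega> R) * indicator (layer (Suc j)) R) \<partial>lebesgue)"
        unfolding w_def layer_integral[symmetric]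
        by (rule nn_integral_cmult[symmetric]) (intro weight_measurable layer_sets layer_unit)
      also have "\<dots> \<le> (\<integral>\<^sup>+R. ennreal (A powr (q / p) * W j) * (m R * ennreal (\<omega> R) * indicator (layer (Suc j)) R) \<partial>lebesgue)"
      proof (intro nn_integral_mono)
        fix R
        show "ennreal (S j powr (q / p)) * (ennreal (\<omega> R) * indicator (layer (Suc j)) R)
          \<le> ennreal (A powr (q / p) * W j) * (m R * ennreal (\<omega> R) * indicator (layer (Suc j)) R)"
        proof (cases "R \<in> layer (Suc j)")
          case True
          then have R': "0 \<le> R" "R < 1" using layer_unit[of "Suc j"] by auto
          have "ennreal (S j powr (q / p)) \<le> ennreal (A powr (q / p) * W j * I R powr (q / p))"
            using pt[OF True] by (rule ennreal_leI)
          also have "\<dots> = ennreal (A powr (q / p) * W j) * m R"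
            unfolding mI[OF R'] using W_pos[of j] by (intro ennreal_mult) auto
          finally have "ennreal (S j powr (q / p)) * ennreal (\<omega> R) \<le> ennreal (A powr (q / p) * W j) * m R * ennreal (\<omega> R)"
            by (rule mult_right_mono) simp
          then show ?thesis using True by (simp add: mult.assoc)
        qed simp
      qed
      also have "\<dots> = ennreal (A powr (q / p) * W j) * (\<integral>\<^sup>+R\<in>layer (Suc j). m R * ennreal (\<omega> R) \<partial>lebesgue)"
        by (rule nn_integral_cmult) (intro meas layer_sets layer_unit)
      also have "\<dots> \<le> ennreal (E * w) * (\<integral>\<^sup>+R\<in>layer (Suc j). m R * ennreal (\<omega> R) \<partial>lebesgue)"
      proof (intro mult_right_mono ennreal_leI)
        show "A powr (q / p) * W j \<le> E * w" unfolding E_def w_def mult.assoc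
          by (intro mult_left_mono W_le_layer) auto
      qed simp
      also have "\<dots> = (ennreal E * (\<integral>\<^sup>+R\<in>layer (Suc j). m R * ennreal (\<omega> R) \<partial>lebesgue)) * ennreal w"
        using E w by (simp add: ennreal_mult mult_ac)
      finally show ?thesis using w by (simp add: ennreal_mult_le_mult_iff mult.commute)
    qed
    have term_eq: "ennpow (ennpow (\<Sum>l<K ^ (j + 2). ennreal (norm (of_real (b j l * c j) :: complex) powr p)) (1 / p)) q = ennreal (S j powr (q / p))" for j
    proof -
      have "(\<Sum>l<K ^ (j + 2). ennreal (norm (of_real (b j l * c j) :: complex) powr p)) = ennreal (S j)"
        using b[of j] c[of j] by (subst sum_ennreal) (auto simp: S_def norm_mult less_imp_le intro!: sum.cong)
      then show ?thesis using p q S0 by (simp add: ennpow_ennreal powr_powr)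
    qed
    have "(\<Sum>\<^sub>\<infinity>j\<in>{1..}. ennreal (S j powr (q / p))) \<le> ennreal E * (\<integral>\<^sup>+R\<in>{0..<1}. m R * ennreal (\<omega> R) \<partial>lebesgue)"
      unfolding infsum_ennreal_le_iff
    proof (intro allI impI)
      fix F :: "nat set" assume F: "finite F \<and> F \<subseteq> {1..}"
      have "(\<Sum>j\<in>F. ennreal (S j powr (q / p))) \<le> (\<Sum>j\<in>F. ennreal E * (\<integral>\<^sup>+R\<in>layer (Suc j). m R * ennreal (\<omega> R) \<partial>lebesgue))"
        using F by (intro sum_mono layer_bound) auto
      also have "\<dots> = ennreal E * (\<integral>\<^sup>+R. (\<Sum>j\<in>F. m R * ennreal (\<omega> R) * indicator (layer (Suc j)) R) \<partial>lebesgue)"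
        by (subst nn_integral_sum) (auto simp: sum_distrib_left intro!: meas layer_sets layer_unit)
      also have "\<dots> \<le> ennreal E * (\<integral>\<^sup>+R\<in>{0..<1}. m R * ennreal (\<omega> R) \<partial>lebesgue)"
      proof (intro mult_left_mono nn_integral_mono)
        fix R
        have "(\<Sum>j\<in>F. indicator (layer (Suc j)) R) = (\<Sum>j\<in>Suc ` F. indicator (layer j) R :: ennreal)"
          by (simp add: sum.reindex)
        also have "\<dots> \<le> indicator {0..<1} R" using F by (intro sum_indicator_layer_le) auto
        finally have "m R * ennreal (\<omega> R) * (\<Sum>j\<in>F. indicator (layer (Suc j)) R) \<le> m R * ennreal (\<omega> R) * indicator {0..<1} R"
          by (rule mult_left_mono) simp
        then show "(\<Sum>j\<in>F. m R * ennreal (\<omega> R) * indicator (layer (Suc j)) R) \<le> m R * ennreal (\<omega> R) * indicator {0..<1} R"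
          by (simp add: sum_distrib_left)
      qed simp
      finally show "(\<Sum>j\<in>F. ennreal (S j powr (q / p))) \<le> ennreal E * (\<integral>\<^sup>+R\<in>{0..<1}. m R * ennreal (\<omega> R) \<partial>lebesgue)" .
    qed
    then have "ennpow (\<Sum>\<^sub>\<infinity>j\<in>{1..}. ennreal (S j powr (q / p))) (1 / q) \<le> ennpow (ennreal E * (\<integral>\<^sup>+R\<in>{0..<1}. m R * ennreal (\<omega> R) \<partial>lebesgue)) (1 / q)"
      using q by (intro ennpow_mono) auto
    also have "\<dots> = ennreal (E powr (1 / q)) * mixed_norm p q \<omega> f"
      using E q by (simp add: ennpow_mult ennpow_ennreal mixed_norm_def m_def)
    finally have bound: "ennpow (\<Sum>\<^sub>\<infinity>j\<in>{1..}. ennreal (S j powr (q / p))) (1 / q) \<le> ennreal (E powr (1 / q)) * mixed_norm p q \<omega> f" .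
    show "seq_norm p q (\<lambda>j. K ^ (j + 2)) (\<lambda>j l. of_real (norm ((deriv ^^ n) f (of_real (r j l) * cis (\<theta> j l)))
       * (real K powr (- (real j * (n + 1 / p))) * W j powr (1 / q)))) \<le> ennreal (E powr (1 / q)) * mixed_norm p q \<omega> f"
    proof -
      have "(\<lambda>j l. of_real (norm ((deriv ^^ n) f (of_real (r j l) * cis (\<theta> j l)))
        * (real K powr (- (real j * (n + 1 / p))) * W j powr (1 / q)))) = (\<lambda>j l. of_real (b j l * c j) :: complex)"
        by (simp add: b_def c_def)
      then show ?thesis using bound by (simp only: seq_norm_def term_eq)
    qed
  qed
qed

text \<open>
The integrand on the sequence side involves the measures only through finitely many arcs.
\<close>

lemma arc_sum_measurable:
  assumes data: "measure_data \<mu> \<nu>"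
  shows "(\<lambda>r. ennreal x * ennpow (\<Sum>l<K ^ (j + 2). y l * emeasure (\<mu> r) (arc_interval (K ^ (j + 2)) l)) e
    * indicator (layer i) r) \<in> borel_measurable \<nu>"
proof -
  have [measurable]: "(\<lambda>r. emeasure (\<mu> r) (arc_interval (K ^ (j + 2)) l)) \<in> borel_measurable \<nu>" if "l < K ^ (j + 2)" for l
    by (rule emeasure_data_measurable[OF data arc_interval_sets[OF that]])
  have [measurable]: "layer i \<in> sets \<nu>"
    using data layer_unit[of i] by (auto simp: measure_data_def layer_def sets_restrict_space_iff)
  show ?thesis by measurable
qed

text \<open>
The sequence is formed from the maxima over the boxes. The integrand on the function side is then dominated, layer by layer, by
the integrand on the sequence side.
\<close>

lemma function_inequality_from_sequence:
  fixes p q s t :: real and n :: nat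
  assumes p: "0 < p" and q: "0 < q" and s: "0 < s" and t: "0 < t"
  obtains B where "0 < B" "\<And>\<mu> \<nu> C. measure_data \<mu> \<nu> \<Longrightarrow> 0 < C \<Longrightarrow>
    sequence_inequality p q s t \<omega> n K \<mu> \<nu> C \<Longrightarrow> function_inequality p q s t \<omega> n \<mu> \<nu> (B * C)"
proof -
  obtain B where B: "0 < B" "\<And>f r \<theta>. f holomorphic_on ball 0 1 \<Longrightarrow>
    (\<And>j l. 1 \<le> j \<Longrightarrow> l < K ^ (j + 2) \<Longrightarrow> radius K (j - 1) \<le> r j l \<and> r j l \<le> radius K j \<and> \<theta> j l \<in> arc_interval (K ^ (j + 2)) l) \<Longrightarrow>
    seq_norm p q (\<lambda>j. K ^ (j + 2)) (\<lambda>j l. of_real (norm ((deriv ^^ n) f (of_real (r j l) * cis (\<theta> j l)))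
       * (real K powr (- (real j * (n + 1 / p))) * W j powr (1 / q))))
    \<le> ennreal B * mixed_norm p q \<omega> f"
    using sampled_seq_norm_le[OF p q, of n] by blast
  have K0: "0 < real K" using K by simp
  show ?thesis
  proof (rule that[OF B(1)])
    fix \<mu> \<nu> C
    assume data: "measure_data \<mu> \<nu>" and C: "0 < C" and seq: "sequence_inequality p q s t \<omega> n K \<mu> \<nu> C"
    show "function_inequality p q s t \<omega> n \<mu> \<nu> (B * C)"
      unfolding function_inequality_def
    proof
      fix f assume f: "f \<in> mixed_norm_space p q \<omega>"
      then have holf: "f holomorphic_on ball 0 1" and fin: "mixed_norm p q \<omega> f < \<infinity>"
        by (auto simp: mixed_norm_space_def)
      define g where "g = (\<lambda>r \<theta>. norm ((deriv ^^ n) f (of_real r * cis \<theta>)))"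
      have cf: "continuous_on (ball 0 1) ((deriv ^^ n) f)"
        by (intro holomorphic_on_imp_continuous_on holomorphic_higher_deriv holf) auto
      have "\<exists>x. fst x \<in> {radius K (j - 1)..radius K j} \<and> snd x \<in> arc_interval N l \<and>
          (\<forall>r\<in>{radius K (j - 1)..radius K j}. \<forall>\<theta>\<in>arc_interval N l. g r \<theta> \<le> g (fst x) (snd x))" for j l N
      proof -
        have "\<exists>x\<in>{radius K (j - 1)..radius K j} \<times> arc_interval N l. \<forall>y\<in>{radius K (j - 1)..radius K j} \<times> arc_interval N l.
           g (fst y) (snd y) \<le> g (fst x) (snd x)"
        proof (rule continuous_attains_sup)
          show "compact ({radius K (j - 1)..radius K j} \<times> arc_interval N l)"
            by (intro compact_Times) (auto simp: arc_interval_def)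
          have "2 * pi * (real l / real N) \<le> 2 * pi * (real (l + 1) / real N)"
            by (intro mult_left_mono divide_right_mono) auto
          then have "2 * pi * (real l / real N) \<in> arc_interval N l" by (simp add: arc_interval_def)
          moreover have "radius K j \<in> {radius K (j - 1)..radius K j}" using radius_facts(5)[OF K] by simp
          ultimately show "{radius K (j - 1)..radius K j} \<times> arc_interval N l \<noteq> {}" by blast
          have "radius K (j - 1) \<ge> 0" "radius K j < 1" using radius_facts[OF K] by auto
          then show "continuous_on ({radius K (j - 1)..radius K j} \<times> arc_interval N l) (\<lambda>y. g (fst y) (snd y))"
            unfolding g_def
            by (intro continuous_on_norm continuous_on_compose2[OF cf] continuous_intros) (auto simp: norm_mult)
        qed
        then show ?thesis by fastforce
      qed
      note ex = this
      \<comment> \<open>a point of the box at which the modulus of the derivative is largest\<close>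
      define x where "x = (\<lambda>j l. SOME x. fst x \<in> {radius K (j - 1)..radius K j} \<and> snd x \<in> arc_interval (K ^ (j + 2)) l \<and>
          (\<forall>r\<in>{radius K (j - 1)..radius K j}. \<forall>\<theta>\<in>arc_interval (K ^ (j + 2)) l. g r \<theta> \<le> g (fst x) (snd x)))"
      have x: " fst (x j l) \<in> {radius K (j - 1)..radius K j} \<and> snd (x j l) \<in> arc_interval (K ^ (j + 2)) l \<and>
          (\<forall>r\<in>{radius K (j - 1)..radius K j}. \<forall>\<theta>\<in>arc_interval (K ^ (j + 2)) l. g r \<theta> \<le> g (fst (x j l)) (snd (x j l)))" for j l
        unfolding x_def by (rule someI_ex[OF ex])
      define b where "b = (\<lambda>j l. g (fst (x j l)) (snd (x j l)))"
      define c where "c = (\<lambda>j. real K powr (- (real j * (n + 1 / p))) * W j powr (1 / q))"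
      define a where "a = (\<lambda>j l. of_real (b j l * c j) :: complex)"
      have c: "0 < c j" for j using K0 W_pos[of j] by (simp add: c_def)
      have b: "0 \<le> b j l" for j l by (simp add: b_def g_def)
      have an: "seq_norm p q (\<lambda>j. K ^ (j + 2)) a \<le> ennreal B * mixed_norm p q \<omega> f"
        using B(2)[OF holf, of "\<lambda>j l. fst (x j l)" "\<lambda>j l. snd (x j l)"] x
        unfolding a_def b_def g_def c_def by auto
      also have "\<dots> < \<infinity>" using fin by (simp add: ennreal_mult_less_top)
      finally have a: "a \<in> seq_space p q (\<lambda>j. K ^ (j + 2))" by (simp add: seq_space_def)
      define d where "d = (\<lambda>j. real K powr (real j * t * (real n + 1 / p)) * W j powr (- t / q))"
      define T where "T = (\<lambda>j r. \<Sum>l<K ^ (j + 2). ennreal (norm (a j l) powr s) * emeasure (\<mu> r) (arc_interval (K ^ (j + 2)) l))"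
      define G where "G = (\<lambda>j r. ennreal (d j) * ennpow (T j r) (t / s))"
      define F where "F = (\<lambda>r. ennpow (\<integral>\<^sup>+\<theta>. ennreal (g r \<theta> powr s) \<partial>\<mu> r) (t / s))"
      \<comment> \<open>the normalisation of \<open>a\<close> cancels the weight in the sequence inequality\<close>
      have dc: "d j * c j powr t = 1" for j
      proof -
        have "c j powr t = real K powr (- (real j * t * (real n + 1 / p))) * W j powr (t / q)"
          using K0 W_pos[of j] by (simp add: c_def powr_mult powr_powr mult_ac)
        then have "d j * c j powr t = (real K powr (real j * t * (real n + 1 / p)) * real K powr (- (real j * t * (real n + 1 / p))))
            * (W j powr (- (t / q)) * W j powr (t / q))"
          by (simp add: d_def mult_ac)
        then show ?thesis using K0 W_pos[of j] by (simp flip: powr_add)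
      qed
      have FG: "F r \<le> G (Suc k) r" if r: "r \<in> layer k" for r k
      proof -
        have r1: "r \<in> {0..<1}" using r layer_unit[of k] by auto
        define N where "N = K ^ (Suc k + 2)"
        have N: "0 < N" using K by (simp add: N_def)
        have "(\<integral>\<^sup>+\<theta>. ennreal (g r \<theta> powr s) \<partial>\<mu> r)
          \<le> (\<integral>\<^sup>+\<theta>. (\<Sum>l<N. ennreal (b (Suc k) l powr s) * indicator (arc_interval N l) \<theta>) \<partial>\<mu> r)"
        proof (rule nn_integral_mono)
          fix \<theta> assume "\<theta> \<in> space (\<mu> r)"
          then have "\<theta> \<in> {0..2*pi}" using measure_data_space[OF data] r1 by simp
          then obtain l where l: "l < N" "\<theta> \<in> arc_interval N l" using arc_interval_cover[OF N] by blast
          have "g r \<theta> \<le> b (Suc k) l"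
            using x[of "Suc k" l] l(2) r unfolding N_def b_def by (auto simp: layer_def)
          then have "ennreal (g r \<theta> powr s) \<le> ennreal (b (Suc k) l powr s)"
            using s by (intro ennreal_leI powr_mono2) (auto simp: g_def)
          also have "\<dots> = ennreal (b (Suc k) l powr s) * indicator (arc_interval N l) \<theta>" using l by simp
          also have "\<dots> \<le> (\<Sum>l<N. ennreal (b (Suc k) l powr s) * indicator (arc_interval N l) \<theta>)"
            using l by (intro member_le_sum) auto
          finally show "ennreal (g r \<theta> powr s) \<le> (\<Sum>l<N. ennreal (b (Suc k) l powr s) * indicator (arc_interval N l) \<theta>)" .
        qed
        also have "\<dots> = (\<Sum>l<N. ennreal (b (Suc k) l powr s) * emeasure (\<mu> r) (arc_interval N l))"
        proof -
          have "arc_interval N l \<in> sets (\<mu> r)" if "l < N" for l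
            using arc_interval_sets[OF that] measure_data_space(3)[OF data r1] by simp
          then show ?thesis by (subst nn_integral_sum) (auto simp: nn_integral_cmult_indicator)
        qed
        finally have "F r \<le> ennpow (\<Sum>l<N. ennreal (b (Suc k) l powr s) * emeasure (\<mu> r) (arc_interval N l)) (t / s)"
          unfolding F_def using s t by (intro ennpow_mono) auto
        also have "\<dots> = G (Suc k) r"
        proof -
          have "T (Suc k) r = ennreal (c (Suc k) powr s) * (\<Sum>l<N. ennreal (b (Suc k) l powr s) * emeasure (\<mu> r) (arc_interval N l))"
            unfolding T_def N_def a_def sum_distrib_left using b[of "Suc k"] c[of "Suc k"]
            by (intro sum.cong refl) (simp add: norm_mult powr_mult less_imp_le ennreal_mult mult_ac)
          then have "G (Suc k) r = ennreal (d (Suc k)) * (ennreal (c (Suc k) powr t) * ennpow (\<Sum>l<N. ennreal (b (Suc k) l powr s) * emeasure (\<mu> r) (arc_interval N l)) (t / s))"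
            using s t c[of "Suc k"] by (simp add: G_def ennpow_mult ennpow_ennreal powr_powr)
          also have "\<dots> = ennreal (d (Suc k) * c (Suc k) powr t) * ennpow (\<Sum>l<N. ennreal (b (Suc k) l powr s) * emeasure (\<mu> r) (arc_interval N l)) (t / s)"
            by (subst ennreal_mult) (auto simp: d_def mult.assoc)
          finally show ?thesis by (simp add: dc)
        qed
        finally show ?thesis .
      qed
      have Gm: "(\<lambda>r. G j r * indicator (layer i) r) \<in> borel_measurable \<nu>" for i j
        unfolding G_def T_def by (rule arc_sum_measurable[OF data])
      have "(\<integral>\<^sup>+r. F r \<partial>\<nu>) \<le> (\<integral>\<^sup>+r. (\<Sum>k. G (Suc k) r * indicator (layer k) r) \<partial>\<nu>)"
      proof (rule nn_integral_mono)
        fix r assume "r \<in> space \<nu>"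
        then have "r \<in> {0..<1}" using measure_data_space(1)[OF data] by simp
        then obtain k where k: "r \<in> layer k" by (rule layer_cover)
        define h where "h = (\<lambda>k. G (Suc k) r * indicator (layer k) r)"
        have "F r \<le> h k" using FG[OF k] k by (simp add: h_def)
        also have "\<dots> \<le> suminf h" using sum_le_suminf[of h "{k}"] by simp
        finally show "F r \<le> (\<Sum>k. G (Suc k) r * indicator (layer k) r)" unfolding h_def .
      qed
      also have "\<dots> = (\<Sum>k. \<integral>\<^sup>+r. G (Suc k) r * indicator (layer k) r \<partial>\<nu>)"
        by (rule nn_integral_suminf) (rule Gm)
      also have "\<dots> = (\<Sum>\<^sub>\<infinity>j\<in>{1..}. \<integral>\<^sup>+r\<in>layer (j - 1). G j r \<partial>\<nu>)"
        by (subst infsum_atLeast_1_ennreal) simp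
      finally have "ennpow (\<integral>\<^sup>+r. F r \<partial>\<nu>) (1 / t) \<le> ennpow (\<Sum>\<^sub>\<infinity>j\<in>{1..}. \<integral>\<^sup>+r\<in>layer (j - 1). G j r \<partial>\<nu>) (1 / t)"
        using t by (intro ennpow_mono) auto
      also have "(\<Sum>\<^sub>\<infinity>j\<in>{1..}. \<integral>\<^sup>+r\<in>layer (j - 1). G j r \<partial>\<nu>)
         = (\<Sum>\<^sub>\<infinity>j\<in>{1..}. \<integral>\<^sup>+r\<in>{radius K (j - 1)..<radius K j}. G j r \<partial>\<nu>)"
        by (rule infsum_cong) (auto simp: layer_def)
      also have "ennpow \<dots> (1 / t) \<le> ennreal C * seq_norm p q (\<lambda>j. K ^ (j + 2)) a"
        using seq a unfolding sequence_inequality_def G_def T_def d_def W_def by blast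
      also have "\<dots> \<le> ennreal C * (ennreal B * mixed_norm p q \<omega> f)"
        using an by (intro mult_left_mono) auto
      also have "\<dots> = ennreal (B * C) * mixed_norm p q \<omega> f"
        using B(1) C by (simp add: ennreal_mult mult_ac)
      finally show "ennpow (\<integral>\<^sup>+r. ennpow (\<integral>\<^sup>+\<theta>. ennreal (norm ((deriv ^^ n) f (of_real r * cis \<theta>)) powr s) \<partial>\<mu> r) (t / s) \<partial>\<nu>) (1 / t)
         \<le> ennreal (B * C) * mixed_norm p q \<omega> f"
        unfolding F_def g_def .
    qed
  qed
qed

end

section \<open>Measurability of integrals against a family of measures\<close>

lemma less_ennreal_shrink:
  fixes a :: ennreal and x :: real
  assumes a: "a < ennreal x" shows "\<exists>e>0. a < ennreal (x - e)"
proof -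
  obtain u where u: "a = ennreal u" "0 \<le> u" using a by (cases a) auto
  then have "u < x" using a by (simp add: ennreal_less_iff)
  then have "0 < (x - u) / 2" "u < x - (x - u) / 2" by (auto simp: field_simps)
  then show ?thesis using u by (intro exI[of _ "(x - u) / 2"]) (auto simp: ennreal_less_iff)
qed
lemma less_ennreal_grow:
  fixes a :: ennreal and x :: real
  assumes a: "ennreal x < a" shows "\<exists>e>0. ennreal (x + e) < a"
proof -
  from dense[OF a] obtain b where b: "ennreal x < b" "b < a" by blast
  then obtain u where u: "b = ennreal u" "0 \<le> u" by (cases b) auto
  have xu: "x < u"
  proof (rule ccontr)
    assume "\<not> x < u"
    then have "ennreal u \<le> ennreal x" by (intro ennreal_leI) simp
    with b(1) u show False by simp
  qed
  show ?thesis using xu u b by (intro exI[of _ "u - x"]) auto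
qed

text \<open>
The measures need not be \<open>\<sigma>\<close>-finite, so measurability does not follow from Fubini's theorem. Instead
\<open>g r\<close> is the increasing limit of step functions on dyadic intervals, each taking the infimum of \<open>g r\<close> over the
rational positions in the interval; the integral of a step function is a sum of measurable functions of \<open>r\<close>.
\<close>

lemma nn_integral_kernel_measurable:
  fixes g :: "real \<Rightarrow> real \<Rightarrow> real"
  assumes data: "measure_data \<mu> \<nu>"
    and cont: "continuous_on ({0..<1} \<times> UNIV) (\<lambda>x. g (fst x) (snd x))"
  shows "(\<lambda>r. \<integral>\<^sup>+\<theta>. ennreal (g r \<theta>) \<partial>\<mu> r) \<in> borel_measurable \<nu>"
proof -
  \<comment> \<open>relative positions within a dyadic interval; countable, so that infima over them are measurable\<close>
  define U where "U = {u\<in>\<rat>. 0 \<le> u \<and> u \<le> (1::real)}"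
  have U: "countable U" "0 \<in> U" by (auto simp: U_def intro: countable_subset[OF _ countable_rat])
  define h :: "nat \<Rightarrow> nat \<Rightarrow> real \<Rightarrow> ennreal" where "h = (\<lambda>k i r. INF u\<in>U. ennreal (g r ((real i + u) / 2 ^ k)))"
  define cell :: "nat \<Rightarrow> nat \<Rightarrow> real set" where "cell = (\<lambda>k i. {real i / 2 ^ k..<(real i + 1) / 2 ^ k} \<inter> {0..2*pi})"
  \<comment> \<open>the dyadic interval of length \<open>2\<^sup>-\<^sup>k\<close> that contains \<open>\<theta>\<close>\<close>
  define idx :: "nat \<Rightarrow> real \<Rightarrow> nat" where "idx = (\<lambda>k \<theta>. nat \<lfloor>\<theta> * 2 ^ k\<rfloor>)"
  define G where "G = (\<lambda>k r \<theta>. \<Sum>i. h k i r * indicator (cell k i) \<theta>)"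
  have cell_iff: "\<theta> \<in> cell k i \<longleftrightarrow> i = idx k \<theta>" if "\<theta> \<in> {0..2*pi}" for k i \<theta>
  proof -
    have "0 \<le> \<theta> * 2 ^ k" using that by simp
    then have "i = idx k \<theta> \<longleftrightarrow> int i = \<lfloor>\<theta> * 2 ^ k\<rfloor>" unfolding idx_def by linarith
    also have "\<dots> \<longleftrightarrow> real i \<le> \<theta> * 2 ^ k \<and> \<theta> * 2 ^ k < real i + 1" by linarith
    finally show ?thesis using that by (auto simp: cell_def field_simps)
  qed
  have G_eq: "G k r \<theta> = h k (idx k \<theta>) r" if "\<theta> \<in> {0..2*pi}" for k r \<theta>
  proof -
    have "G k r \<theta> = (\<Sum>i. if i = idx k \<theta> then h k i r else 0)"
      unfolding G_def using cell_iff[OF that] by (intro suminf_cong) (simp add: indicator_def)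
    also have "\<dots> = h k (idx k \<theta>) r" by (rule sums_unique[OF sums_single, symmetric])
    finally show ?thesis .
  qed
  have cell_sets: "cell k i \<in> sets (restrict_space borel {0..2*pi})" for k i
    by (subst sets_restrict_space_iff) (auto simp: cell_def)
  have gm: "(\<lambda>r. g r \<theta>) \<in> borel_measurable \<nu>" for \<theta>
  proof -
    have "continuous_on {0..<1} (\<lambda>r. g (fst (r, \<theta>)) (snd (r, \<theta>)))"
      by (rule continuous_on_compose2[OF cont]) (auto intro!: continuous_intros)
    then have "(\<lambda>r. g r \<theta>) \<in> borel_measurable (restrict_space borel {0..<1})"
      by (simp add: borel_measurable_continuous_on_restrict)
    then show ?thesis using data by (subst measurable_cong_sets) (auto simp: measure_data_def)
  qed
  have hm [measurable]: "h k i \<in> borel_measurable \<nu>" for k i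
    unfolding h_def using gm by (intro borel_measurable_INF U) measurable
  have em [measurable]: "(\<lambda>r. emeasure (\<mu> r) (cell k i)) \<in> borel_measurable \<nu>" for k i
    by (rule emeasure_data_measurable[OF data cell_sets])
  have Im: "(\<lambda>r. \<Sum>i. h k i r * emeasure (\<mu> r) (cell k i)) \<in> borel_measurable \<nu>" for k
    by measurable
  have "(\<integral>\<^sup>+\<theta>. ennreal (g r \<theta>) \<partial>\<mu> r) = (SUP k. \<Sum>i. h k i r * emeasure (\<mu> r) (cell k i))" if "r \<in> space \<nu>" for r
  proof -
    have r: "r \<in> {0..<1}" using that measure_data_space(1)[OF data] by simp
    have sp: "space (\<mu> r) = {0..2*pi}" and st: "cell k i \<in> sets (\<mu> r)" for k i
      using measure_data_space[OF data] r cell_sets by auto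
    have Gm: "G k r \<in> borel_measurable (\<mu> r)" for k
      unfolding G_def using st by measurable
    have mono: "G k r \<theta> \<le> G (Suc k) r \<theta>" if \<theta>: "\<theta> \<in> {0..2*pi}" for k \<theta>
    proof -
      have "h k (idx k \<theta>) r \<le> h (Suc k) (idx (Suc k) \<theta>) r"
        unfolding h_def
      proof (rule INF_greatest)
        fix u assume u: "u \<in> U"
        define b where "b = real (idx (Suc k) \<theta>) - 2 * real (idx k \<theta>)"
        have "0 \<le> \<theta> * 2 ^ k" using \<theta> by simp
        then have i: "real (idx k \<theta>) \<le> \<theta> * 2 ^ k" "\<theta> * 2 ^ k < real (idx k \<theta>) + 1"
          unfolding idx_def by linarith+
        have "0 \<le> \<theta> * 2 ^ Suc k" using \<theta> by simp
        then have i': "real (idx (Suc k) \<theta>) \<le> \<theta> * 2 ^ Suc k" "\<theta> * 2 ^ Suc k < real (idx (Suc k) \<theta>) + 1"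
          unfolding idx_def by linarith+
        \<comment> \<open>the finer interval is the left or the right half of the coarser one\<close>
        have "b = 0 \<or> b = 1"
        proof -
          have "real (idx (Suc k) \<theta>) < 2 * real (idx k \<theta>) + 2" "2 * real (idx k \<theta>) < real (idx (Suc k) \<theta>) + 1"
            using i i' by auto
          then have "idx (Suc k) \<theta> = 2 * idx k \<theta> \<or> idx (Suc k) \<theta> = 2 * idx k \<theta> + 1" by linarith
          then show ?thesis by (auto simp: b_def)
        qed
        then have bu: "(b + u) / 2 \<in> U" using u by (auto simp: U_def)
        have "(real (idx (Suc k) \<theta>) + u) / 2 ^ Suc k = (real (idx k \<theta>) + (b + u) / 2) / 2 ^ k"
          by (simp add: b_def field_simps)
        then show "(INF u\<in>U. ennreal (g r ((real (idx k \<theta>) + u) / 2 ^ k))) \<le> ennreal (g r ((real (idx (Suc k) \<theta>) + u) / 2 ^ Suc k))"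
          using INF_lower[OF bu] by simp
      qed
      then show ?thesis using G_eq[OF \<theta>] by simp
    qed
    have lim: "(\<lambda>k. G k r \<theta>) \<longlonglongrightarrow> ennreal (g r \<theta>)" if \<theta>: "\<theta> \<in> {0..2*pi}" for \<theta>
    proof -
      have cr: "continuous_on UNIV (g r)"
      proof -
        have "continuous_on UNIV (\<lambda>\<theta>. g (fst (r, \<theta>)) (snd (r, \<theta>)))"
          by (rule continuous_on_compose2[OF cont]) (use r in \<open>auto intro!: continuous_intros\<close>)
        then show ?thesis by simp
      qed
      have near: "\<exists>k0. \<forall>k\<ge>k0. ennreal (g r \<theta> - e) \<le> G k r \<theta> \<and> G k r \<theta> \<le> ennreal (g r \<theta> + e)" if e: "0 < e" for e
      proof -
        obtain d where d: "0 < d" "\<And>x. dist x \<theta> < d \<Longrightarrow> dist (g r x) (g r \<theta>) < e"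
          using cr e unfolding continuous_on_iff by blast
        obtain k0 where k0: "(1 / 2) ^ k0 < d" using real_arch_pow_inv[OF d(1), of "1/2"] by auto
        have "ennreal (g r \<theta> - e) \<le> G k r \<theta> \<and> G k r \<theta> \<le> ennreal (g r \<theta> + e)" if k: "k \<ge> k0" for k
        proof -
          have "(1 / 2) ^ k \<le> (1 / 2 :: real) ^ k0" using k by (intro power_decreasing) auto
          then have kd: "1 / 2 ^ k < d" using k0 by (simp add: power_one_over)
          have "0 \<le> \<theta> * 2 ^ k" using \<theta> by simp
          then have i: "real (idx k \<theta>) \<le> \<theta> * 2 ^ k" "\<theta> * 2 ^ k < real (idx k \<theta>) + 1"
            unfolding idx_def by linarith+
          have c: "\<bar>g r ((real (idx k \<theta>) + u) / 2 ^ k) - g r \<theta>\<bar> < e" if "u \<in> U" for u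
          proof -
            have "\<bar>(real (idx k \<theta>) + u) - \<theta> * 2 ^ k\<bar> \<le> 1" using that i by (auto simp: U_def)
            then have "\<bar>((real (idx k \<theta>) + u) - \<theta> * 2 ^ k) / 2 ^ k\<bar> \<le> 1 / 2 ^ k"
              by (simp add: abs_divide divide_right_mono)
            also have "((real (idx k \<theta>) + u) - \<theta> * 2 ^ k) / 2 ^ k = (real (idx k \<theta>) + u) / 2 ^ k - \<theta>"
              by (simp add: field_simps)
            finally show ?thesis using d(2)[of "(real (idx k \<theta>) + u) / 2 ^ k"] kd by (simp add: dist_real_def)
          qed
          have "ennreal (g r \<theta> - e) \<le> h k (idx k \<theta>) r"
            unfolding h_def by (intro INF_greatest ennreal_leI) (use c in fastforce)
          moreover have "h k (idx k \<theta>) r \<le> ennreal (g r ((real (idx k \<theta>) + 0) / 2 ^ k))"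
            unfolding h_def by (rule INF_lower[OF U(2)])
          then have "h k (idx k \<theta>) r \<le> ennreal (g r \<theta> + e)"
            by (rule order_trans) (use c[OF U(2)] in \<open>intro ennreal_leI, linarith\<close>)
          ultimately show ?thesis using G_eq[OF \<theta>] by simp
        qed
        then show ?thesis by blast
      qed
      show ?thesis
      proof (rule order_tendstoI)
        fix a assume a: "a < ennreal (g r \<theta>)"
        obtain e where e: "0 < e" "a < ennreal (g r \<theta> - e)" using less_ennreal_shrink[OF a] by blast
        then show "\<forall>\<^sub>F k in sequentially. a < G k r \<theta>"
          using near[OF e(1)] by (auto simp: eventually_sequentially intro: less_le_trans)
      next
        fix a assume a: "ennreal (g r \<theta>) < a"
        obtain e where e: "0 < e" "ennreal (g r \<theta> + e) < a" using less_ennreal_grow[OF a] by blast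
        then show "\<forall>\<^sub>F k in sequentially. G k r \<theta> < a"
          using near[OF e(1)] by (auto simp: eventually_sequentially intro: le_less_trans)
      qed
    qed
    have "ennreal (g r \<theta>) = (SUP k. G k r \<theta>)" if "\<theta> \<in> {0..2*pi}" for \<theta>
    proof -
      have "incseq (\<lambda>k. G k r \<theta>)" by (rule incseq_SucI) (rule mono[OF that])
      from LIMSEQ_unique[OF lim[OF that] LIMSEQ_SUP[OF this]] show ?thesis .
    qed
    note SUP_eq = this
    have Gi: "(\<integral>\<^sup>+\<theta>. G k r \<theta> \<partial>\<mu> r) = (\<Sum>i. h k i r * emeasure (\<mu> r) (cell k i))" for k
      unfolding G_def using st by (subst nn_integral_suminf) (auto simp: nn_integral_cmult_indicator)
    have e1: "(\<integral>\<^sup>+\<theta>. ennreal (g r \<theta>) \<partial>\<mu> r) = (\<integral>\<^sup>+\<theta>. (SUP k. G k r \<theta>) \<partial>\<mu> r)"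
      using SUP_eq by (intro nn_integral_cong) (simp add: sp)
    have e2: "(\<integral>\<^sup>+\<theta>. (SUP k. G k r \<theta>) \<partial>\<mu> r) = (SUP k. \<integral>\<^sup>+\<theta>. G k r \<theta> \<partial>\<mu> r)"
      by (rule nn_integral_monotone_convergence_SUP_AE) (use mono Gm sp in auto)
    show ?thesis unfolding e1 e2 Gi by (rule refl)
  qed
  note eq = this
  have m1: "(\<lambda>r. SUP k. \<Sum>i. h k i r * emeasure (\<mu> r) (cell k i)) \<in> borel_measurable \<nu>"
    by (rule borel_measurable_SUP[OF _ Im]) simp
  have m2: "(\<lambda>r. \<integral>\<^sup>+\<theta>. ennreal (g r \<theta>) \<partial>\<mu> r) \<in> borel_measurable \<nu> \<longleftrightarrow>
    (\<lambda>r. SUP k. \<Sum>i. h k i r * emeasure (\<mu> r) (cell k i)) \<in> borel_measurable \<nu>"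
    by (rule measurable_cong) (rule eq)
  show ?thesis by (rule iffD2[OF m2 m1])
qed

section \<open>Lower bounds from random signs\<close>

text \<open>
Closed arcs overlap only at their end points.
\<close>

lemma card_arcs_le_2:
  assumes "0 < N"
  shows "card {l\<in>{..<N}. \<theta> \<in> arc_interval N l} \<le> 2"
proof -
  define x where "x = real N * \<theta> / (2 * pi)"
  define m where "m = nat \<lfloor>x\<rfloor>"
  have "l \<in> {m - 1, m}" if "\<theta> \<in> arc_interval N l" for l
  proof -
    have "real l \<le> x" "x \<le> real l + 1" using that assms
      by (auto simp: arc_interval_def x_def field_simps)
    then show ?thesis unfolding m_def by simp linarith
  qed
  then have "{l\<in>{..<N}. \<theta> \<in> arc_interval N l} \<subseteq> {m - 1, m}" by blast
  then have "card {l\<in>{..<N}. \<theta> \<in> arc_interval N l} \<le> card {m - 1, m}" by (intro card_mono) auto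
  also have "\<dots> \<le> 2" by (cases "m - 1 = m") auto
  finally show ?thesis .
qed

text \<open>
For a choice of signs, restrict the measure to those \<open>\<theta>\<close> in the \<open>l\<close>-th arc at which the signed sum is at
least \<open>B l\<close>. The resulting quantity \<open>Y\<close> never exceeds the full sum \<open>T\<close>; by \<open>half_of_signs\<close> its mean is at least \<open>T / 2\<close>;
and it is at most twice the integral on the right, because at most two arcs meet at a point.
So \<open>average_powr_ge\<close> applies to \<open>Y\<close>.
\<close>

lemma random_sign_lower_bound:
  fixes \<phi> :: "'a \<Rightarrow> real \<Rightarrow> complex"
  assumes M: "sets M = sets (restrict_space borel {0..2*pi})"
    and fin: "finite L" and x: "\<And>l. l < N \<Longrightarrow> x l \<in> L" and N: "0 < N"
    and cont: "\<And>i. i \<in> L \<Longrightarrow> continuous_on UNIV (\<phi> i)"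
    and low: "\<And>l \<theta>. l < N \<Longrightarrow> \<theta> \<in> arc_interval N l \<Longrightarrow> B l \<le> norm (\<phi> (x l) \<theta>)"
    and B: "\<And>l. l < N \<Longrightarrow> 0 \<le> B l"
    and s: "0 < s" and e: "0 < e"
  shows "ennreal (2 ^ card L * ((1 / 4) powr e / 4)) *
       ennpow (\<Sum>l<N. ennreal (B l powr s) * emeasure M (arc_interval N l)) e
    \<le> (\<Sum>S\<in>Pow L. ennpow (2 * (\<integral>\<^sup>+\<theta>. ennreal (norm (\<Sum>i\<in>L. signed S i * \<phi> i \<theta>) powr s) \<partial>M)) e)"
proof -
  have sp: "space M = {0..2*pi}" using sets_eq_imp_space_eq[OF M] by (simp add: space_restrict_space)
  define F where "F = (\<lambda>S \<theta>. \<Sum>i\<in>L. signed S i * \<phi> i \<theta>)"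
  define A where "A = (\<lambda>S l. {\<theta>\<in>arc_interval N l. B l \<le> norm (F S \<theta>)})"
  define Y where "Y = (\<lambda>S. \<integral>\<^sup>+\<theta>. (\<Sum>l<N. ennreal (B l powr s) * indicator (A S l) \<theta>) \<partial>M)"
  define T where "T = (\<Sum>l<N. ennreal (B l powr s) * emeasure M (arc_interval N l))"
  have cF: "continuous_on UNIV (F S)" for S unfolding F_def by (intro continuous_intros cont)
  have arc: "arc_interval N l \<in> sets M" if "l < N" for l using arc_interval_sets[OF that] M by simp
  have A: "A S l \<in> sets M" if "l < N" for S l
  proof -
    have "closed {\<theta>. B l \<le> norm (F S \<theta>)}" by (intro closed_Collect_le continuous_intros cF)
    then have "closed (arc_interval N l \<inter> {\<theta>. B l \<le> norm (F S \<theta>)})" by (intro closed_Int) (auto simp: arc_interval_def)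
    moreover have "A S l = arc_interval N l \<inter> {\<theta>. B l \<le> norm (F S \<theta>)}" by (auto simp: A_def)
    moreover have "A S l \<subseteq> {0..2*pi}" using arc_interval_subset[OF that] by (auto simp: A_def)
    ultimately show ?thesis unfolding M by (subst sets_restrict_space_iff) (auto intro: borel_closed)
  qed
  have Y: "Y S = (\<Sum>l<N. ennreal (B l powr s) * emeasure M (A S l))" for S
    unfolding Y_def using A by (subst nn_integral_sum) (auto simp: nn_integral_cmult_indicator)
  have YT: "Y S \<le> T" for S
    unfolding Y T_def using arc by (intro sum_mono mult_left_mono emeasure_mono) (auto simp: A_def)
  have YF: "Y S \<le> 2 * (\<integral>\<^sup>+\<theta>. ennreal (norm (F S \<theta>) powr s) \<partial>M)" for S
  proof -
    have "Y S \<le> (\<integral>\<^sup>+\<theta>. 2 * ennreal (norm (F S \<theta>) powr s) \<partial>M)"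
      unfolding Y_def
    proof (rule nn_integral_mono)
      fix \<theta>
      have "(\<Sum>l<N. ennreal (B l powr s) * indicator (A S l) \<theta>) \<le> (\<Sum>l<N. if \<theta> \<in> arc_interval N l then ennreal (norm (F S \<theta>) powr s) else 0)"
        using s B by (intro sum_mono) (auto simp: A_def indicator_def intro!: ennreal_leI powr_mono2)
      also have "\<dots> = (\<Sum>l\<in>{l\<in>{..<N}. \<theta> \<in> arc_interval N l}. ennreal (norm (F S \<theta>) powr s))"
        by (rule sum.inter_filter[symmetric]) simp
      also have "\<dots> = of_nat (card {l\<in>{..<N}. \<theta> \<in> arc_interval N l}) * ennreal (norm (F S \<theta>) powr s)" by simp
      also have "\<dots> \<le> of_nat 2 * ennreal (norm (F S \<theta>) powr s)"
        using card_arcs_le_2[OF N] by (intro mult_right_mono of_nat_mono) auto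
      finally show "(\<Sum>l<N. ennreal (B l powr s) * indicator (A S l) \<theta>) \<le> 2 * ennreal (norm (F S \<theta>) powr s)" by simp
    qed
    also have "\<dots> = 2 * (\<integral>\<^sup>+\<theta>. ennreal (norm (F S \<theta>) powr s) \<partial>M)"
    proof (rule nn_integral_cmult)
      have "(\<lambda>\<theta>. norm (F S \<theta>) powr s) \<in> borel_measurable borel"
        using cF s by (intro borel_measurable_continuous_onI continuous_on_powr' continuous_intros) auto
      then have "(\<lambda>\<theta>. ennreal (norm (F S \<theta>) powr s)) \<in> borel_measurable borel"
        by (rule measurable_compose) simp
      then have "(\<lambda>\<theta>. ennreal (norm (F S \<theta>) powr s)) \<in> borel_measurable (restrict_space borel {0..2*pi})"
        by (rule measurable_restrict_space1)
      then show "(\<lambda>\<theta>. ennreal (norm (F S \<theta>) powr s)) \<in> borel_measurable M"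
        using M by (simp cong: measurable_cong_sets)
    qed
    finally show ?thesis .
  qed
  have avg: "ennreal (card (Pow L) / 2) * T \<le> (\<Sum>S\<in>Pow L. Y S)"
  proof -
    have "ennreal (card (Pow L) / 2) * (ennreal (B l powr s) * emeasure M (arc_interval N l))
       \<le> (\<Sum>S\<in>Pow L. ennreal (B l powr s) * emeasure M (A S l))" if l: "l < N" for l
    proof -
      have "ennreal (card (Pow L) / 2) * emeasure M (arc_interval N l) = (\<integral>\<^sup>+\<theta>. ennreal (card (Pow L) / 2) * indicator (arc_interval N l) \<theta> \<partial>M)"
        using arc[OF l] by (simp add: nn_integral_cmult_indicator)
      also have "\<dots> \<le> (\<integral>\<^sup>+\<theta>. (\<Sum>S\<in>Pow L. indicator (A S l) \<theta>) \<partial>M)"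
      proof (rule nn_integral_mono)
        fix \<theta>
        show "ennreal (card (Pow L) / 2) * indicator (arc_interval N l) \<theta> \<le> (\<Sum>S\<in>Pow L. indicator (A S l) \<theta>)"
        proof (cases "\<theta> \<in> arc_interval N l")
          case True
          have "2 ^ card L \<le> 2 * card {S \<in> Pow L. norm (\<phi> (x l) \<theta>) \<le> norm (F S \<theta>)}"
            unfolding F_def by (rule half_of_signs[OF fin x[OF l]])
          also have "\<dots> \<le> 2 * card {S \<in> Pow L. \<theta> \<in> A S l}"
            using low[OF l True] True fin by (intro mult_left_mono card_mono) (auto simp: A_def)
          finally have "real (2 ^ card L) \<le> real (2 * card {S \<in> Pow L. \<theta> \<in> A S l})" by (rule of_nat_mono)
          then have "card (Pow L) / 2 \<le> card {S \<in> Pow L. \<theta> \<in> A S l}" using fin by (simp add: card_Pow)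
          then have "ennreal (card (Pow L) / 2) \<le> ennreal (card {S \<in> Pow L. \<theta> \<in> A S l})" by (rule ennreal_leI)
          also have "\<dots> = of_nat (card {S \<in> Pow L. \<theta> \<in> A S l})" by (simp add: ennreal_of_nat_eq_real_of_nat)
          also have "\<dots> = (\<Sum>S\<in>Pow L. indicator (A S l) \<theta>)"
          proof -
            have "of_nat (card {S \<in> Pow L. \<theta> \<in> A S l}) = (\<Sum>S\<in>{S \<in> Pow L. \<theta> \<in> A S l}. 1 :: ennreal)"
              by simp
            also have "\<dots> = (\<Sum>S\<in>Pow L. if \<theta> \<in> A S l then 1 else 0)"
              using fin by (intro sum.inter_filter) simp
            finally show ?thesis by (simp only: indicator_def of_bool_def)
          qed
          finally show ?thesis using True by simp
        qed simp
      qed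
      also have "\<dots> = (\<Sum>S\<in>Pow L. emeasure M (A S l))" using A[OF l] by (subst nn_integral_sum) auto
      finally have "ennreal (B l powr s) * (ennreal (card (Pow L) / 2) * emeasure M (arc_interval N l)) \<le> ennreal (B l powr s) * (\<Sum>S\<in>Pow L. emeasure M (A S l))"
        by (rule mult_left_mono) simp
      then show ?thesis by (simp add: sum_distrib_left mult_ac)
    qed
    then have "(\<Sum>l<N. ennreal (card (Pow L) / 2) * (ennreal (B l powr s) * emeasure M (arc_interval N l)))
      \<le> (\<Sum>l<N. \<Sum>S\<in>Pow L. ennreal (B l powr s) * emeasure M (A S l))"
      by (intro sum_mono) auto
    also have "\<dots> = (\<Sum>S\<in>Pow L. Y S)" unfolding Y by (rule sum.swap)
    finally show ?thesis unfolding T_def by (simp only: sum_distrib_left)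
  qed
  have "ennreal (card (Pow L) * ((1 / 4) powr e / 4)) * ennpow T e \<le> (\<Sum>S\<in>Pow L. ennpow (Y S) e)"
    by (rule average_powr_ge[OF _ e YT avg]) (simp add: fin)
  also have "\<dots> \<le> (\<Sum>S\<in>Pow L. ennpow (2 * (\<integral>\<^sup>+\<theta>. ennreal (norm (F S \<theta>) powr s) \<partial>M)) e)"
    using YF e by (intro sum_mono ennpow_mono)
  finally show ?thesis using fin by (simp add: T_def F_def card_Pow)
qed

section \<open>Synthesis from concentrated kernels\<close>

lemma gap_cases:
  shows "j \<le> k \<Longrightarrow> gap j k = k - j" "k < j \<Longrightarrow> gap j k = Suc (j - Suc k)"
  by (auto simp: gap_def)

context lacunary_weight
begin

text \<open>
The test function of the box \<open>(j, l)\<close>: of modulus at most \<open>1\<close> in the disc and of the order of \<open>1\<close> on the box. The exponent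
\<open>M\<close> governs its decay away from the box.
\<close>

definition grid_kernel :: "nat \<Rightarrow> nat \<Rightarrow> nat \<Rightarrow> complex \<Rightarrow> complex"
  where "grid_kernel M j l z =
    (of_real (1 - radius K j) / (1 - of_real (radius K j) * cis (- root_angle (K ^ (j + 2)) l) * z)) ^ M"

lemma grid_kernel_denominator:
  assumes "norm z < 1"
  shows "1 - of_real (radius K j) * cis \<alpha> * z \<noteq> 0"
proof
  assume "1 - of_real (radius K j) * cis \<alpha> * z = 0"
  then have "norm (of_real (radius K j) * cis \<alpha> * z) = 1" by simp
  moreover have "radius K j * norm z \<le> 1 * norm z"
    using radius_facts(2)[OF K, of j] by (intro mult_right_mono) auto
  then have "norm (of_real (radius K j) * cis \<alpha> * z) < 1"
    using radius_facts(1)[OF K, of j] assms by (simp add: norm_mult)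
  ultimately show False by simp
qed

text \<open>
The base of the power is at most \<open>min 1 (K\<^sup>k\<^sup>+\<^sup>1\<^sup>-\<^sup>j)\<close> in the layer \<open>k\<close> and at most twice a bump in the angular
variable. Splitting the exponent gives decay in both directions at once.
\<close>

lemma grid_kernel_bound:
  assumes r: "r \<in> layer k"
  shows "norm (grid_kernel (M + m) j l (of_real r * cis \<theta>))
    \<le> ((1 / real K) ^ (j - Suc k)) ^ M * (2 * bump (radius K j) (root_angle (K ^ (j + 2)) l) \<theta>) ^ m"
proof -
  define \<rho> where "\<rho> = radius K j"
  define \<alpha> where "\<alpha> = root_angle (K ^ (j + 2)) l"
  define x where "x = norm (1 - of_real \<rho> * cis (- \<alpha>) * (of_real r * cis \<theta>))"
  have K0: "0 < real K" using K by simp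
  have \<rho>: "0 \<le> \<rho>" "\<rho> < 1" "1 - \<rho> = 1 / real K ^ j" unfolding \<rho>_def using radius_facts[OF K] by auto
  have r01: "0 \<le> r" "r < 1" and rk: "1 / real K ^ Suc k < 1 - r"
    using r layer_unit[of k] radius_facts(4)[OF K, of "Suc k"] by (auto simp: layer_def)
  have x1: "1 - \<rho> * r \<le> x"
    using norm_triangle_ineq2[of 1 "of_real \<rho> * cis (- \<alpha>) * (of_real r * cis \<theta>)"] \<rho> r01
    by (simp add: x_def norm_mult)
  have "\<rho> * r \<le> \<rho>" "\<rho> * r \<le> r" using \<rho> r01 by (simp_all add: mult_left_le mult_left_le_one_le)
  then have x2: "1 - \<rho> \<le> x" "1 - r \<le> x" using x1 by auto
  then have x0: "0 < x" using \<rho> by linarith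
  have a: "(1 - \<rho>) / x \<le> (1 / real K) ^ (j - Suc k)"
  proof (cases "j \<le> Suc k")
    case True
    then show ?thesis using x2(1) x0 by simp
  next
    case False
    have "(1 - \<rho>) / x \<le> (1 / real K ^ j) / (1 / real K ^ Suc k)"
      unfolding \<rho>(3) using x2(2) rk K0 x0 by (intro divide_left_mono) auto
    also have "\<dots> = (1 / real K) ^ (j - Suc k)"
      using False K0 by (simp add: power_diff power_one_over field_simps)
    finally show ?thesis .
  qed
  have b: "(1 - \<rho>) / x \<le> 2 * bump \<rho> \<alpha> \<theta>"
  proof -
    define y where "y = norm (cis \<theta> - of_real \<rho> * cis \<alpha>)"
    have y0: "0 < y" unfolding y_def
      using norm_circle_diff_pos[of "of_real \<rho> * cis \<alpha>" 1 \<theta>] \<rho> by (simp add: norm_mult)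
    have "y = norm (1 - of_real \<rho> * cis (\<theta> - \<alpha>))"
    proof -
      have "cis \<theta> - of_real \<rho> * cis \<alpha> = cis \<theta> * cnj (1 - of_real \<rho> * cis (\<theta> - \<alpha>))"
        by (simp add: algebra_simps cis_cnj cis_mult)
      then show ?thesis unfolding y_def by (simp only: norm_mult complex_mod_cnj norm_cis mult_1)
    qed
    also have "1 - of_real \<rho> * cis (\<theta> - \<alpha>) = (1 - of_real \<rho> * cis (- \<alpha>) * (of_real r * cis \<theta>)) - of_real (\<rho> * (1 - r)) * cis (\<theta> - \<alpha>)"
      by (simp add: algebra_simps cis_mult)
    also have "norm \<dots> \<le> x + norm (of_real (\<rho> * (1 - r)) * cis (\<theta> - \<alpha>))"
      unfolding x_def by (rule norm_triangle_ineq4)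
    also have "norm (of_real (\<rho> * (1 - r)) * cis (\<theta> - \<alpha>)) = \<rho> * (1 - r)"
      using \<rho> r01 by (simp add: norm_mult del: of_real_mult of_real_diff)
    also have "x + \<rho> * (1 - r) \<le> 2 * x" using x1 \<rho> by (simp add: algebra_simps)
    finally have "y \<le> 2 * x" .
    then have "(1 - \<rho>) / x \<le> (1 - \<rho>) / (y / 2)"
      using y0 x0 \<rho> by (intro divide_left_mono) auto
    then show ?thesis by (simp add: bump_def y_def mult.commute)
  qed
  have p: "0 \<le> (1 - \<rho>) / x" using x0 \<rho> by simp
  have "norm (grid_kernel (M + m) j l (of_real r * cis \<theta>)) = ((1 - \<rho>) / x) ^ M * ((1 - \<rho>) / x) ^ m"
  proof -
    have "norm (of_real (1 - \<rho>) :: complex) = 1 - \<rho>" using \<rho>(2) by (simp del: of_real_diff)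
    then have "norm (of_real (1 - \<rho>) / (1 - of_real \<rho> * cis (- \<alpha>) * (of_real r * cis \<theta>))) = (1 - \<rho>) / x"
      by (simp only: norm_divide x_def)
    then show ?thesis unfolding grid_kernel_def \<rho>_def[symmetric] \<alpha>_def[symmetric] norm_power
      by (simp only: power_add)
  qed
  also have "\<dots> \<le> ((1 / real K) ^ (j - Suc k)) ^ M * (2 * bump \<rho> \<alpha> \<theta>) ^ m"
    using a b p K0 by (intro mult_mono power_mono) auto
  finally show ?thesis by (simp add: \<rho>_def \<alpha>_def)
qed

text \<open>
For \<open>k \<ge> j\<close> the decrease of \<open>W\<close> by the ratio \<open>C\<^sub>0 = \<gamma>\<^sup>2\<close> beats the loss \<open>\<gamma>\<close> of the weighted sums. For \<open>k < j\<close>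
the growth of \<open>W\<close> by at most \<open>D\<close> per step is beaten by the decay \<open>\<delta>\<close> of the kernels; that decay starts one step
late, which costs the factor \<open>1 / \<delta>\<close>.
\<close>

lemma W_gap_le:
  assumes \<gamma>: "\<gamma> = sqrt C\<^sub>0" and \<delta>: "0 < \<delta>" "\<delta> \<le> 1 / (2 * \<gamma> * D)"
  shows "W k * (\<gamma> ^ gap j k * \<delta> ^ (j - Suc k)) \<le> (1 / \<delta>) * max (1 / \<gamma>) (1 / 2) ^ gap j k * W j"
proof -
  have \<gamma>1: "1 < \<gamma>" and \<gamma>2: "\<gamma> * \<gamma> = C\<^sub>0" using C0 by (auto simp: \<gamma>)
  have D1: "1 < D" by (rule D_gt_1)
  have "1 < 2 * \<gamma> * D" using \<gamma>1 D1 by (smt (verit) mult_less_cancel_left2)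
  then have \<delta>1: "\<delta> \<le> 1" using \<delta> by (smt (verit) divide_le_eq_1)
  have \<eta>: "0 < max (1 / \<gamma>) (1 / 2)" by simp
  show ?thesis
  proof (cases "j \<le> k")
    case True
    have "C\<^sub>0 ^ i * W (j + i) \<le> W j" for i
    proof (induction i)
      case (Suc i)
      have "C\<^sub>0 ^ Suc i * W (j + Suc i) = C\<^sub>0 ^ i * (C\<^sub>0 * W (Suc (j + i)))" by simp
      also have "\<dots> \<le> C\<^sub>0 ^ i * W (j + i)" using W_lower C0 by (intro mult_left_mono) auto
      finally show ?case using Suc by simp
    qed simp
    from this[of "k - j"] have Wk: "C\<^sub>0 ^ (k - j) * W k \<le> W j" using True by simp
    have "W k * (\<gamma> ^ gap j k * \<delta> ^ (j - Suc k)) = (1 / \<gamma>) ^ (k - j) * (C\<^sub>0 ^ (k - j) * W k)"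
      using True \<gamma>1 unfolding \<gamma>2[symmetric] by (simp add: gap_cases power_mult_distrib power_one_over)
    also have "\<dots> \<le> (1 / \<gamma>) ^ (k - j) * W j" using Wk \<gamma>1 by (intro mult_left_mono) auto
    also have "\<dots> \<le> max (1 / \<gamma>) (1 / 2) ^ (k - j) * W j"
      using W_pos[of j] \<gamma>1 by (intro mult_right_mono power_mono) auto
    also have "\<dots> \<le> (1 / \<delta>) * (max (1 / \<gamma>) (1 / 2) ^ (k - j) * W j)"
    proof -
      have "1 * (max (1 / \<gamma>) (1 / 2) ^ (k - j) * W j) \<le> (1 / \<delta>) * (max (1 / \<gamma>) (1 / 2) ^ (k - j) * W j)"
        using \<delta> \<delta>1 W_pos[of j] \<eta> by (intro mult_right_mono mult_nonneg_nonneg) auto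
      then show ?thesis by simp
    qed
    finally show ?thesis using True by (simp add: gap_cases)
  next
    case False
    define i where "i = j - Suc k"
    have j: "j = k + Suc i" using False by (simp add: i_def)
    have "W k \<le> D ^ i * W (k + i)" for i
    proof (induction i)
      case (Suc i)
      have "W k \<le> D ^ i * W (k + i)" by (rule Suc)
      also have "\<dots> \<le> D ^ i * (D * W (Suc (k + i)))" using W_upper D1 by (intro mult_left_mono) auto
      finally show ?case by (simp add: mult_ac)
    qed simp
    from this[of "Suc i"] have Wk: "W k \<le> D ^ Suc i * W j" by (simp add: j)
    have "W k * (\<gamma> ^ gap j k * \<delta> ^ (j - Suc k)) \<le> D ^ Suc i * W j * (\<gamma> ^ Suc i * \<delta> ^ i)"
      using Wk \<gamma>1 \<delta> False D1 W_pos[of j] by (intro mult_mono) (auto simp: gap_cases i_def)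
    also have "\<dots> = (1 / \<delta>) * (\<gamma> * D * \<delta>) ^ Suc i * W j" using \<delta> by (simp add: power_mult_distrib)
    also have "\<dots> \<le> (1 / \<delta>) * max (1 / \<gamma>) (1 / 2) ^ Suc i * W j"
    proof -
      have "\<gamma> * D * \<delta> \<le> \<gamma> * D * (1 / (2 * \<gamma> * D))" using \<delta> \<gamma>1 D1 by (intro mult_left_mono) auto
      also have "\<dots> = 1 / 2" using \<gamma>1 D1 by simp
      finally have "\<gamma> * D * \<delta> \<le> max (1 / \<gamma>) (1 / 2)" by simp
      then show ?thesis using \<delta> \<gamma>1 D1 W_pos[of j] by (intro mult_right_mono mult_left_mono power_mono) auto
    qed
    finally show ?thesis using False by (simp add: gap_cases i_def)
  qed
qed

text \<open>
Bounding the mass of the layer \<open>k\<close> by the tail \<open>W k\<close> turns bounds for the integral means on the layers into a bound for the mixed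
norm.
\<close>

lemma mixed_norm_layer_bound:
  fixes f :: "complex \<Rightarrow> complex" and V :: "nat \<Rightarrow> real"
  assumes q: "0 < q" and le: "\<And>k r. r \<in> layer k \<Longrightarrow> ennpow (integral_mean p r f) q \<le> ennreal (V k)"
    and V: "\<And>k. 0 \<le> V k" and sum: "\<And>F. finite F \<Longrightarrow> (\<Sum>k\<in>F. W k * V k) \<le> X"
  shows "mixed_norm p q \<omega> f \<le> ennpow (ennreal X) (1 / q)"
  unfolding mixed_norm_def
proof (rule ennpow_mono)
  have "(\<integral>\<^sup>+r\<in>{0..<1}. ennpow (integral_mean p r f) q * ennreal (\<omega> r) \<partial>lebesgue)
    \<le> (\<integral>\<^sup>+r. (\<Sum>k. ennreal (V k) * (ennreal (\<omega> r) * indicator (layer k) r)) \<partial>lebesgue)"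
  proof (rule nn_integral_mono)
    fix r
    show "ennpow (integral_mean p r f) q * ennreal (\<omega> r) * indicator {0..<1} r
      \<le> (\<Sum>k. ennreal (V k) * (ennreal (\<omega> r) * indicator (layer k) r))"
    proof (cases "r \<in> {0..<1}")
      case True
      then obtain k where k: "r \<in> layer k" by (rule layer_cover)
      define h where "h = (\<lambda>k. ennreal (V k) * (ennreal (\<omega> r) * indicator (layer k) r))"
      have "ennpow (integral_mean p r f) q * ennreal (\<omega> r) * indicator {0..<1} r \<le> h k"
        using le[OF k] k True by (simp add: h_def mult_right_mono)
      also have "h k \<le> suminf h" using sum_le_suminf[of h "{k}"] by simp
      finally show ?thesis by (simp add: h_def)
    qed simp
  qed
  also have "\<dots> = (\<Sum>k. ennreal (V k) * ennreal (W k - W (Suc k)))"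
    unfolding layer_integral[symmetric]
    by (subst nn_integral_suminf) (auto intro!: suminf_cong nn_integral_cmult borel_measurable_times_ennreal weight_measurable layer_sets layer_unit)
  also have "\<dots> \<le> ennreal X"
  proof (rule suminf_le_const)
    fix n
    have "(\<Sum>k<n. ennreal (V k) * ennreal (W k - W (Suc k))) \<le> (\<Sum>k<n. ennreal (W k * V k))"
    proof (rule sum_mono)
      fix k
      have "ennreal (V k) * ennreal (W k - W (Suc k)) \<le> ennreal (V k) * ennreal (W k)"
        using W_pos[of "Suc k"] by (intro mult_left_mono ennreal_leI) auto
      also have "\<dots> = ennreal (W k * V k)" using V[of k] W_pos[of k] by (simp add: ennreal_mult mult.commute)
      finally show "ennreal (V k) * ennreal (W k - W (Suc k)) \<le> ennreal (W k * V k)" .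
    qed
    also have "\<dots> = ennreal (\<Sum>k<n. W k * V k)"
      using V W_pos by (intro sum_ennreal) (simp add: less_imp_le)
    also have "\<dots> \<le> ennreal X" using sum[of "{..<n}"] by (intro ennreal_leI) auto
    finally show "(\<Sum>k<n. ennreal (V k) * ennreal (W k - W (Suc k))) \<le> ennreal X" .
  qed auto
  finally show "(\<integral>\<^sup>+r\<in>{0..<1}. ennpow (integral_mean p r f) q * ennreal (\<omega> r) \<partial>lebesgue) \<le> ennreal X" .
qed (use q in simp)

text \<open>
On the layer \<open>k\<close> the function is at most a sum over the levels \<open>j\<close> of a coefficient, decaying in \<open>j - k\<close>, times a sum of
bumps of level \<open>j\<close>. Raising this sum first to \<open>p\<close> and, after integration in \<open>\<theta>\<close>, to \<open>q / p\<close> loses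
\<open>\<gamma>\<close> to the power of the gap between \<open>j\<close> and \<open>k\<close>; \<open>W_gap_le\<close> and a geometric series then allow summation over the layers.
\<close>

lemma synthesis_norm_le:
  fixes p q :: real
  assumes p: "0 < p" and q: "0 < q"
  obtains M B where "1 \<le> M" "0 < B" "\<And>J \<alpha> a.
    (\<And>j l. j \<in> {1..J} \<Longrightarrow> l < K ^ (j + 2) \<Longrightarrow> norm (\<alpha> j l) \<le> norm (a j l) * (real K powr (j / p) * W j powr (- 1 / q))) \<Longrightarrow>
    mixed_norm p q \<omega> (\<lambda>z. \<Sum>j\<in>{1..J}. \<Sum>l<K ^ (j + 2). \<alpha> j l * grid_kernel M j l z)
      \<le> ennreal B * seq_norm p q (\<lambda>j. K ^ (j + 2)) a"
proof -
  define \<gamma> where "\<gamma> = sqrt C\<^sub>0"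
  \<comment> \<open>chosen so that the two losses from raising sums to the powers \<open>p\<close> and \<open>q / p\<close> combine to \<open>\<gamma> < C\<^sub>0\<close>\<close>
  define \<beta>1 where "\<beta>1 = C\<^sub>0 powr (p / (4 * q))"
  define \<beta>2 where "\<beta>2 = C\<^sub>0 powr (1 / 4)"
  have K0: "0 < real K" using K by simp
  have \<beta>: "1 < \<beta>1" "1 < \<beta>2" unfolding \<beta>1_def \<beta>2_def using C0 p q by (auto intro!: gr_one_powr)
  have \<beta>\<gamma>: "\<beta>1 powr (q / p) * \<beta>2 = \<gamma>"
    using C0 p q by (simp add: \<beta>1_def \<beta>2_def \<gamma>_def powr_powr powr_half_sqrt[symmetric] flip: powr_add)
  obtain C1 where C1: "0 < C1" "\<And>F x k. finite F \<Longrightarrow> (\<And>j. j \<in> F \<Longrightarrow> 0 \<le> x j) \<Longrightarrow>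
    (\<Sum>j\<in>F. x j) powr p \<le> C1 * (\<Sum>j\<in>F. \<beta>1 ^ gap j k * x j powr p)"
    using powr_sum_le_gap[OF p \<beta>(1)] by blast
  have qp: "0 < q / p" using p q by simp
  obtain C2 where C2: "0 < C2" "\<And>F x k. finite F \<Longrightarrow> (\<And>j. j \<in> F \<Longrightarrow> 0 \<le> x j) \<Longrightarrow>
    (\<Sum>j\<in>F. x j) powr (q / p) \<le> C2 * (\<Sum>j\<in>F. \<beta>2 ^ gap j k * x j powr (q / p))"
    using powr_sum_le_gap[OF qp \<beta>(2)] by blast
  \<comment> \<open>\<open>m + 2\<close> factors of the kernel provide angular decay, the other \<open>M1\<close> decay across the layers\<close>
  obtain m :: nat where m: "2 / p < m" using reals_Archimedean2 by blast
  have pm: "2 \<le> p * m" using m p by (simp add: field_simps)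
  have \<gamma>1: "1 < \<gamma>" using C0 by (simp add: \<gamma>_def)
  have D1: "1 < D" by (rule D_gt_1)
  have "0 < (1 / (2 * \<gamma> * D)) powr (1 / q)" using \<gamma>1 D1 by simp
  \<comment> \<open>so much decay that it beats the growth of \<open>W\<close> and the loss \<open>\<gamma>\<close>, as \<open>W_gap_le\<close> requires\<close>
  then obtain M1 :: nat where M1: "(1 / real K) ^ M1 < (1 / (2 * \<gamma> * D)) powr (1 / q)"
    using real_arch_pow_inv[of "(1 / (2 * \<gamma> * D)) powr (1 / q)" "1 / real K"] K by auto
  define \<delta> where "\<delta> = ((1 / real K) ^ M1) powr q"
  have \<delta>: "0 < \<delta>" "\<delta> \<le> 1 / (2 * \<gamma> * D)"
  proof -
    show "0 < \<delta>" using K0 by (simp add: \<delta>_def)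
    have "\<delta> \<le> ((1 / (2 * \<gamma> * D)) powr (1 / q)) powr q" unfolding \<delta>_def using M1 q by (intro powr_mono2) auto
    also have "\<dots> = 1 / (2 * \<gamma> * D)" using q \<gamma>1 D1 by (simp add: powr_powr)
    finally show "\<delta> \<le> 1 / (2 * \<gamma> * D)" .
  qed
  define \<eta> where "\<eta> = max (1 / \<gamma>) (1 / 2)"
  have \<eta>: "0 < \<eta>" "\<eta> < 1" using \<gamma>1 by (auto simp: \<eta>_def)
  define A where "A = C1 * (2 ^ (m + 2) * (4 * (real K)\<^sup>2)) powr p"
  define E where "E = A powr (q / p) * C2 * (1 / \<delta>) * (2 / (1 - \<eta>))"
  have A: "0 < A" using C1 K0 by (simp add: A_def)
  have E: "0 < E" using A C2 \<delta> \<eta> by (simp add: E_def)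
  show ?thesis
  proof (rule that[of "M1 + (m + 2)" "E powr (1 / q)"])
    show "1 \<le> M1 + (m + 2)" by simp
    show "0 < E powr (1 / q)" using E by simp
    fix J :: nat and \<alpha> a :: "nat \<Rightarrow> nat \<Rightarrow> complex"
    assume \<alpha>: "\<And>j l. j \<in> {1..J} \<Longrightarrow> l < K ^ (j + 2) \<Longrightarrow> norm (\<alpha> j l) \<le> norm (a j l) * (real K powr (j / p) * W j powr (- 1 / q))"
    define f where "f = (\<lambda>z. \<Sum>j\<in>{1..J}. \<Sum>l<K ^ (j + 2). \<alpha> j l * grid_kernel (M1 + (m + 2)) j l z)"
    define c where "c = (\<lambda>j. real K powr (real j / p) * W j powr (- 1 / q))"
    define \<Lambda> where "\<Lambda> = (\<lambda>j k. ((1 / real K) ^ (j - Suc k)) ^ M1)"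
    define u where "u = (\<lambda>j \<theta>. \<Sum>l<K ^ (j + 2). norm (a j l) * bump (radius K j) (root_angle (K ^ (j + 2)) l) \<theta> ^ (m + 2))"
    define S where "S = (\<lambda>j. \<Sum>l<K ^ (j + 2). norm (a j l) powr p)"
    define y where "y = (\<lambda>j k. \<Lambda> j k * 2 ^ (m + 2) * c j)"
    define Z where "Z = (\<lambda>k. A * (\<Sum>j\<in>{1..J}. \<beta>1 ^ gap j k * (\<Lambda> j k powr p * W j powr (- p / q) * S j)))"
    define V where "V = (\<lambda>k. A powr (q / p) * C2 * (\<Sum>j\<in>{1..J}. \<gamma> ^ gap j k * \<delta> ^ (j - Suc k) * (S j powr (q / p) / W j)))"
    have c: "0 < c j" for j using K0 W_pos[of j] by (simp add: c_def)
    have \<Lambda>0: "0 < \<Lambda> j k" for j k using K0 by (simp add: \<Lambda>_def)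
    have y0: "0 < y j k" for j k using \<Lambda>0 c by (simp add: y_def)
    have S0: "0 \<le> S j" for j by (simp add: S_def sum_nonneg)
    have rad: "0 \<le> radius K j" "radius K j < 1" "1 - radius K j = 1 / real K ^ j" for j using radius_facts[OF K] by auto
    have b0: "0 < bump (radius K j) x \<theta>" for j x \<theta> using rad by (intro bump_pos)
    have u0: "0 \<le> u j \<theta>" for j \<theta> unfolding u_def using b0 by (intro sum_nonneg mult_nonneg_nonneg zero_le_power) (auto simp: less_imp_le)
    have V0: "0 \<le> V k" for k
      unfolding V_def using C2(1) \<gamma>1 \<delta> W_pos by (intro mult_nonneg_nonneg sum_nonneg divide_nonneg_pos) (auto simp: less_imp_le)
    have point: "norm (f (of_real r * cis \<theta>)) \<le> (\<Sum>j\<in>{1..J}. y j k * u j \<theta>)" if r: "r \<in> layer k" for r k \<theta>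
    proof -
      have "norm (f (of_real r * cis \<theta>)) \<le> (\<Sum>j\<in>{1..J}. \<Sum>l<K ^ (j + 2). norm (\<alpha> j l * grid_kernel (M1 + (m + 2)) j l (of_real r * cis \<theta>)))"
        unfolding f_def by (intro order_trans[OF norm_sum] sum_mono norm_sum)
      also have "\<dots> \<le> (\<Sum>j\<in>{1..J}. y j k * u j \<theta>)"
      proof (rule sum_mono)
        fix j assume j: "j \<in> {1..J}"
        have "(\<Sum>l<K ^ (j + 2). norm (\<alpha> j l * grid_kernel (M1 + (m + 2)) j l (of_real r * cis \<theta>)))
          \<le> (\<Sum>l<K ^ (j + 2). (norm (a j l) * c j) * (\<Lambda> j k * (2 * bump (radius K j) (root_angle (K ^ (j + 2)) l) \<theta>) ^ (m + 2)))"
          unfolding norm_mult \<Lambda>_def using \<alpha>[OF j] c[of j]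
          by (intro sum_mono mult_mono grid_kernel_bound[OF r]) (auto simp: c_def)
        also have "\<dots> = y j k * u j \<theta>" by (simp add: y_def u_def sum_distrib_left power_mult_distrib mult_ac)
        finally show "(\<Sum>l<K ^ (j + 2). norm (\<alpha> j l * grid_kernel (M1 + (m + 2)) j l (of_real r * cis \<theta>))) \<le> y j k * u j \<theta>" .
      qed
      finally show ?thesis .
    qed
    have mean_u: "(\<integral>\<^sup>+\<theta>\<in>{0..2*pi}. ennreal (u j \<theta> powr p / (2*pi)) \<partial>lborel)
      \<le> ennreal ((4 * (real K)\<^sup>2) powr p * (1 / real K ^ j) * S j)" for j
    proof -
      have NK: "real (K ^ (j + 2)) * (1 - radius K j) = (real K)\<^sup>2"
        using K0 by (simp add: rad(3) power_add power2_eq_square)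
      have "1 \<le> (real K)\<^sup>2" using K by (simp add: one_le_power)
      then have ge1: "1 \<le> real (K ^ (j + 2)) * (1 - radius K j)" unfolding NK .
      have e: "4 * real (K ^ (j + 2)) * (1 - radius K j) = 4 * (real K)\<^sup>2" using NK by (simp only: mult.assoc)
      show ?thesis
        using powr_mean_sum_bump_le[OF rad(1,2) ge1 p pm, of "\<lambda>l. norm (a j l)", unfolded e, unfolded rad(3)]
        unfolding u_def S_def by simp
    qed
    have meas_u: "(\<lambda>\<theta>. u j \<theta>) \<in> borel_measurable borel" for j
    proof -
      have "continuous_on UNIV (u j)" unfolding u_def bump_def
      proof (intro continuous_intros ballI)
        fix l \<theta>
        show "norm (cis \<theta> - of_real (radius K j) * cis (root_angle (K ^ (j + 2)) l)) \<noteq> 0"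
          using norm_circle_diff_pos[of "of_real (radius K j) * cis (root_angle (K ^ (j + 2)) l)" 1 \<theta>] rad
          by (simp add: norm_mult)
      qed
      then show ?thesis by (rule borel_measurable_continuous_onI)
    qed
    have mean_p: "(\<integral>\<^sup>+\<theta>\<in>{0..2*pi}. ennreal (norm (f (of_real r * cis \<theta>)) powr p / (2*pi)) \<partial>lborel) \<le> ennreal (Z k)"
      if r: "r \<in> layer k" for r k
    proof -
      have "(\<integral>\<^sup>+\<theta>\<in>{0..2*pi}. ennreal (norm (f (of_real r * cis \<theta>)) powr p / (2*pi)) \<partial>lborel)
        \<le> (\<integral>\<^sup>+\<theta>. (\<Sum>j\<in>{1..J}. ennreal (C1 * \<beta>1 ^ gap j k * y j k powr p) * (ennreal (u j \<theta> powr p / (2*pi)) * indicator {0..2*pi} \<theta>)) \<partial>lborel)"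
      proof (rule nn_integral_mono)
        fix \<theta>
        have "norm (f (of_real r * cis \<theta>)) powr p \<le> (\<Sum>j\<in>{1..J}. y j k * u j \<theta>) powr p"
          using point[OF r] p by (intro powr_mono2) auto
        also have "\<dots> \<le> C1 * (\<Sum>j\<in>{1..J}. \<beta>1 ^ gap j k * (y j k * u j \<theta>) powr p)"
          by (rule C1(2)) (use y0 u0 in \<open>auto simp: less_imp_le\<close>)
        also have "\<dots> = (\<Sum>j\<in>{1..J}. C1 * \<beta>1 ^ gap j k * y j k powr p * u j \<theta> powr p)"
          using y0 u0 by (simp add: powr_mult less_imp_le sum_distrib_left mult_ac)
        finally have "norm (f (of_real r * cis \<theta>)) powr p / (2*pi) \<le> (\<Sum>j\<in>{1..J}. C1 * \<beta>1 ^ gap j k * y j k powr p * u j \<theta> powr p) / (2*pi)"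
          by (rule divide_right_mono) simp
        also have "\<dots> = (\<Sum>j\<in>{1..J}. C1 * \<beta>1 ^ gap j k * y j k powr p * (u j \<theta> powr p / (2*pi)))"
          by (simp add: sum_divide_distrib)
        finally have "ennreal (norm (f (of_real r * cis \<theta>)) powr p / (2*pi)) \<le> ennreal (\<Sum>j\<in>{1..J}. C1 * \<beta>1 ^ gap j k * y j k powr p * (u j \<theta> powr p / (2*pi)))"
          by (rule ennreal_leI)
        also have "\<dots> = (\<Sum>j\<in>{1..J}. ennreal (C1 * \<beta>1 ^ gap j k * y j k powr p * (u j \<theta> powr p / (2*pi))))"
          using C1(1) \<beta>(1) by (intro sum_ennreal[symmetric]) simp
        also have "\<dots> = (\<Sum>j\<in>{1..J}. ennreal (C1 * \<beta>1 ^ gap j k * y j k powr p) * ennreal (u j \<theta> powr p / (2*pi)))"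
          using C1(1) \<beta>(1) by (intro sum.cong refl ennreal_mult) auto
        finally show "ennreal (norm (f (of_real r * cis \<theta>)) powr p / (2*pi)) * indicator {0..2*pi} \<theta>
          \<le> (\<Sum>j\<in>{1..J}. ennreal (C1 * \<beta>1 ^ gap j k * y j k powr p) * (ennreal (u j \<theta> powr p / (2*pi)) * indicator {0..2*pi} \<theta>))"
          by (auto simp: indicator_def)
      qed
      also have "\<dots> = (\<Sum>j\<in>{1..J}. ennreal (C1 * \<beta>1 ^ gap j k * y j k powr p) * (\<integral>\<^sup>+\<theta>\<in>{0..2*pi}. ennreal (u j \<theta> powr p / (2*pi)) \<partial>lborel))"
        using meas_u by (subst nn_integral_sum) (auto intro!: sum.cong nn_integral_cmult)
      also have "\<dots> \<le> (\<Sum>j\<in>{1..J}. ennreal (C1 * \<beta>1 ^ gap j k * y j k powr p) * ennreal ((4 * (real K)\<^sup>2) powr p * (1 / real K ^ j) * S j))"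
        by (intro sum_mono mult_left_mono mean_u) auto
      also have "\<dots> = (\<Sum>j\<in>{1..J}. ennreal (C1 * \<beta>1 ^ gap j k * y j k powr p * ((4 * (real K)\<^sup>2) powr p * (1 / real K ^ j) * S j)))"
        using C1(1) \<beta>(1) S0 by (intro sum.cong refl ennreal_mult[symmetric]) auto
      also have "\<dots> = ennreal (\<Sum>j\<in>{1..J}. C1 * \<beta>1 ^ gap j k * y j k powr p * ((4 * (real K)\<^sup>2) powr p * (1 / real K ^ j) * S j))"
        using C1(1) \<beta>(1) S0 by (intro sum_ennreal) simp
      also have "(\<Sum>j\<in>{1..J}. C1 * \<beta>1 ^ gap j k * y j k powr p * ((4 * (real K)\<^sup>2) powr p * (1 / real K ^ j) * S j)) = Z k"
        unfolding Z_def sum_distrib_left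
      proof (rule sum.cong[OF refl])
        fix j
        have "c j powr p = real K ^ j * W j powr (- p / q)"
          using p K0 W_pos[of j] by (simp add: c_def powr_mult powr_powr powr_realpow)
        then have e1: "y j k powr p * (1 / real K ^ j) = \<Lambda> j k powr p * (2 ^ (m + 2)) powr p * W j powr (- p / q)"
          using \<Lambda>0[of j k] c[of j] K0 by (simp add: y_def powr_mult less_imp_le)
        have e2: "A = C1 * (2 ^ (m + 2)) powr p * (4 * (real K)\<^sup>2) powr p"
          unfolding A_def by (subst powr_mult) auto
        have "C1 * \<beta>1 ^ gap j k * y j k powr p * ((4 * (real K)\<^sup>2) powr p * (1 / real K ^ j) * S j)
          = C1 * \<beta>1 ^ gap j k * (y j k powr p * (1 / real K ^ j)) * ((4 * (real K)\<^sup>2) powr p * S j)"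
          by (simp only: mult_ac)
        then show "C1 * \<beta>1 ^ gap j k * y j k powr p * ((4 * (real K)\<^sup>2) powr p * (1 / real K ^ j) * S j)
           = A * (\<beta>1 ^ gap j k * (\<Lambda> j k powr p * W j powr (- p / q) * S j))"
          unfolding e1 e2 by (simp only: mult_ac)
      qed
      finally show ?thesis .
    qed
    have mean_q: "ennpow (integral_mean p r f) q \<le> ennreal (V k)" if r: "r \<in> layer k" for r k
    proof -
      have Z0: "0 \<le> Z k" unfolding Z_def using A \<beta>(1) S0 by (intro mult_nonneg_nonneg sum_nonneg) (auto simp: less_imp_le)
      have "ennpow (integral_mean p r f) q = ennpow (\<integral>\<^sup>+\<theta>\<in>{0..2*pi}. ennreal (norm (f (of_real r * cis \<theta>)) powr p / (2*pi)) \<partial>lborel) (q / p)"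
        unfolding integral_mean_def using p q by (simp add: ennpow_ennpow)
      also have "\<dots> \<le> ennpow (ennreal (Z k)) (q / p)" by (rule ennpow_mono[OF qp mean_p[OF r]])
      also have "\<dots> = ennreal (Z k powr (q / p))" using Z0 by (rule ennpow_ennreal)
      also have "\<dots> \<le> ennreal (V k)"
      proof (rule ennreal_leI)
        have nn: "0 \<le> \<beta>1 ^ gap j k * (\<Lambda> j k powr p * W j powr (- p / q) * S j)" for j
          using \<beta>(1) S0[of j] by simp
        have "Z k powr (q / p) = A powr (q / p) * (\<Sum>j\<in>{1..J}. \<beta>1 ^ gap j k * (\<Lambda> j k powr p * W j powr (- p / q) * S j)) powr (q / p)"
          unfolding Z_def using A nn by (intro powr_mult)
        also have "\<dots> \<le> A powr (q / p) * (C2 * (\<Sum>j\<in>{1..J}. \<beta>2 ^ gap j k * (\<beta>1 ^ gap j k * (\<Lambda> j k powr p * W j powr (- p / q) * S j)) powr (q / p)))"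
          by (intro mult_left_mono C2(2)) (use nn in auto)
        also have "\<dots> = V k"
          unfolding V_def mult.assoc[of "A powr (q / p)" C2]
        proof (intro arg_cong[where f = "\<lambda>x. A powr (q / p) * x"] arg_cong[where f = "\<lambda>x. C2 * x"] sum.cong refl)
          fix j
          have "(\<beta>1 ^ gap j k * (\<Lambda> j k powr p * W j powr (- p / q) * S j)) powr (q / p)
            = (\<beta>1 ^ gap j k) powr (q / p) * ((\<Lambda> j k powr p) powr (q / p) * (W j powr (- p / q)) powr (q / p) * S j powr (q / p))"
            using \<beta>(1) S0[of j] by (simp add: powr_mult)
          also have "(\<beta>1 ^ gap j k) powr (q / p) = (\<beta>1 powr (q / p)) ^ gap j k"
            using \<beta>(1) by (simp add: powr_powr mult.commute flip: powr_realpow)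
          also have "(\<Lambda> j k powr p) powr (q / p) = \<delta> ^ (j - Suc k)"
          proof -
            have "\<Lambda> j k = ((1 / real K) ^ M1) ^ (j - Suc k)" by (simp add: \<Lambda>_def mult.commute flip: power_mult)
            then have "(\<Lambda> j k powr p) powr (q / p) = (((1 / real K) ^ M1) ^ (j - Suc k)) powr q"
              using p by (simp add: powr_powr)
            also have "\<dots> = \<delta> ^ (j - Suc k)" unfolding \<delta>_def using K0
              by (simp add: powr_powr mult_ac flip: powr_realpow)
            finally show ?thesis .
          qed
          also have "(W j powr (- p / q)) powr (q / p) = 1 / W j"
          proof -
            have "- p / q * (q / p) = - 1" using p q by simp
            then show ?thesis using W_pos[of j] by (simp only: powr_powr powr_minus_divide powr_one)
          qed
          finally show "\<beta>2 ^ gap j k * (\<beta>1 ^ gap j k * (\<Lambda> j k powr p * W j powr (- p / q) * S j)) powr (q / p)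
             = \<gamma> ^ gap j k * \<delta> ^ (j - Suc k) * (S j powr (q / p) / W j)"
            unfolding \<beta>\<gamma>[symmetric] by (simp add: power_mult_distrib mult_ac)
        qed
        finally show "Z k powr (q / p) \<le> V k" .
      qed
      finally show ?thesis .
    qed
    have sum_V: "(\<Sum>k\<in>F. W k * V k) \<le> E * (\<Sum>j\<in>{1..J}. S j powr (q / p))" if F: "finite F" for F
    proof -
      have "(\<Sum>k\<in>F. W k * V k) = A powr (q / p) * C2 * (\<Sum>j\<in>{1..J}. S j powr (q / p) / W j * (\<Sum>k\<in>F. W k * (\<gamma> ^ gap j k * \<delta> ^ (j - Suc k))))"
        unfolding V_def sum_distrib_left by (subst sum.swap) (simp add: mult_ac)
      also have "\<dots> \<le> A powr (q / p) * C2 * (\<Sum>j\<in>{1..J}. S j powr (q / p) / W j * ((1 / \<delta>) * (2 / (1 - \<eta>)) * W j))"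
      proof (intro mult_left_mono sum_mono)
        fix j
        have "(\<Sum>k\<in>F. W k * (\<gamma> ^ gap j k * \<delta> ^ (j - Suc k))) \<le> (\<Sum>k\<in>F. (1 / \<delta>) * \<eta> ^ gap j k * W j)"
          unfolding \<eta>_def by (intro sum_mono W_gap_le \<gamma>_def \<delta>)
        also have "\<dots> = (1 / \<delta>) * (\<Sum>k\<in>F. \<eta> ^ gap k j) * W j"
          by (simp add: sum_distrib_left sum_distrib_right gap_def add.commute)
        also have "\<dots> \<le> (1 / \<delta>) * (2 / (1 - \<eta>)) * W j"
          using \<delta> W_pos[of j] sum_power_gap_le[OF F \<eta>] by (intro mult_right_mono mult_left_mono) auto
        finally show "(\<Sum>k\<in>F. W k * (\<gamma> ^ gap j k * \<delta> ^ (j - Suc k))) \<le> (1 / \<delta>) * (2 / (1 - \<eta>)) * W j" .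
      qed (use C2(1) W_pos S0 in \<open>auto simp: less_imp_le\<close>)
      also have "(\<Sum>j\<in>{1..J}. S j powr (q / p) / W j * ((1 / \<delta>) * (2 / (1 - \<eta>)) * W j)) = (\<Sum>j\<in>{1..J}. (1 / \<delta>) * (2 / (1 - \<eta>)) * S j powr (q / p))"
      proof (rule sum.cong[OF refl])
        fix j show "S j powr (q / p) / W j * ((1 / \<delta>) * (2 / (1 - \<eta>)) * W j) = (1 / \<delta>) * (2 / (1 - \<eta>)) * S j powr (q / p)"
          using W_pos[of j] by simp
      qed
      finally show ?thesis by (simp add: E_def sum_distrib_left sum_divide_distrib mult_ac)
    qed
    have "mixed_norm p q \<omega> f \<le> ennpow (ennreal (E * (\<Sum>j\<in>{1..J}. S j powr (q / p)))) (1 / q)"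
      by (rule mixed_norm_layer_bound[OF q mean_q V0 sum_V])
    also have "ennreal (E * (\<Sum>j\<in>{1..J}. S j powr (q / p))) = ennreal E * (\<Sum>j\<in>{1..J}. ennreal (S j powr (q / p)))"
      using E by (simp add: ennreal_mult sum_nonneg flip: sum_ennreal)
    also have "ennpow \<dots> (1 / q) \<le> ennpow (ennreal E * (\<Sum>\<^sub>\<infinity>j\<in>{1..}. ennreal (S j powr (q / p)))) (1 / q)"
      using q by (intro ennpow_mono mult_left_mono sum_le_infsum_ennreal) auto
    also have "\<dots> = ennreal (E powr (1 / q)) * seq_norm p q (\<lambda>j. K ^ (j + 2)) a"
    proof -
      have "ennreal (S j powr (q / p)) = ennpow (ennpow (\<Sum>l<K ^ (j + 2). ennreal (norm (a j l) powr p)) (1 / p)) q" for j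
      proof -
        have "(\<Sum>l<K ^ (j + 2). ennreal (norm (a j l) powr p)) = ennreal (S j)"
          unfolding S_def by (rule sum_ennreal) simp
        then show ?thesis using p q S0[of j] by (simp add: ennpow_ennreal powr_powr)
      qed
      then show ?thesis unfolding seq_norm_def using q E by (simp add: ennpow_mult ennpow_ennreal)
    qed
    finally show "mixed_norm p q \<omega> (\<lambda>z. \<Sum>j\<in>{1..J}. \<Sum>l<K ^ (j + 2). \<alpha> j l * grid_kernel (M1 + (m + 2)) j l z)
      \<le> ennreal (E powr (1 / q)) * seq_norm p q (\<lambda>j. K ^ (j + 2)) a"
      unfolding f_def .
  qed
qed

end

section \<open>From the function inequality to the sequence inequality\<close>

lemma higher_deriv_sum_inverse_powers:
  fixes a c :: "'a \<Rightarrow> complex"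
  assumes fin: "finite L" and c: "\<And>x. x \<in> L \<Longrightarrow> norm (c x) \<le> 1" and z: "norm z < 1"
  shows "(deriv ^^ n) (\<lambda>z. \<Sum>x\<in>L. a x / (1 - c x * z) ^ M) z
    = (\<Sum>x\<in>L. a x * pochhammer (of_nat M) n * c x ^ n / (1 - c x * z) ^ (M + n))"
  using z
proof (induction n arbitrary: z)
  case (Suc n)
  have nz: "1 - c x * w \<noteq> 0" if "x \<in> L" "norm w < 1" for x w
  proof
    assume "1 - c x * w = 0"
    then have "norm (c x * w) = 1" by simp
    moreover have "norm (c x) * norm w \<le> 1 * norm w" using c[OF that(1)] by (intro mult_right_mono) auto
    ultimately show False using that by (simp add: norm_mult)
  qed
  have "((\<lambda>w. \<Sum>x\<in>L. a x * pochhammer (of_nat M) n * c x ^ n / (1 - c x * w) ^ (M + n)) has_field_derivative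
     (\<Sum>x\<in>L. a x * pochhammer (of_nat M) (Suc n) * c x ^ Suc n / (1 - c x * z) ^ (M + Suc n))) (at z)"
  proof (rule DERIV_sum)
    fix x assume x: "x \<in> L"
    have "((\<lambda>w. inverse ((1 - c x * w) ^ (M + n))) has_field_derivative
       (of_nat M + of_nat n) * c x / (1 - c x * z) ^ (M + Suc n)) (at z)"
    proof (cases "M + n")
      case 0
      then show ?thesis by simp
    next
      case (Suc k)
      have Mn: "of_nat M + of_nat n = (of_nat (M + n) :: complex)" "M + Suc n = Suc (M + n)" by simp_all
      have "((\<lambda>w. (1 - c x * w) ^ Suc k) has_field_derivative - (of_nat (Suc k) * c x * (1 - c x * z) ^ k)) (at z)"
      proof -
        have "((\<lambda>w. 1 - c x * w) has_field_derivative - c x) (at z)"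
          by (auto intro!: derivative_eq_intros)
        from DERIV_power_Suc[OF this, of k] show ?thesis by (simp add: algebra_simps)
      qed
      from DERIV_inverse'[OF this] show ?thesis
        unfolding Mn Suc using nz[OF x Suc.prems] by (simp add: divide_inverse mult_ac)
    qed
    from DERIV_cmult[OF this, of "a x * pochhammer (of_nat M) n * c x ^ n"]
    show "((\<lambda>w. a x * pochhammer (of_nat M) n * c x ^ n / (1 - c x * w) ^ (M + n)) has_field_derivative
       a x * pochhammer (of_nat M) (Suc n) * c x ^ Suc n / (1 - c x * z) ^ (M + Suc n)) (at z)"
      by (simp add: pochhammer_Suc divide_inverse mult_ac)
  qed
  then have d: "deriv (\<lambda>w. \<Sum>x\<in>L. a x * pochhammer (of_nat M) n * c x ^ n / (1 - c x * w) ^ (M + n)) z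
     = (\<Sum>x\<in>L. a x * pochhammer (of_nat M) (Suc n) * c x ^ Suc n / (1 - c x * z) ^ (M + Suc n))"
    by (rule DERIV_imp_deriv)
  have "\<forall>\<^sub>F w in nhds z. w \<in> ball 0 1" using Suc.prems by (intro eventually_nhds_in_open) auto
  then have "\<forall>\<^sub>F w in nhds z. (deriv ^^ n) (\<lambda>z. \<Sum>x\<in>L. a x / (1 - c x * z) ^ M) w
     = (\<Sum>x\<in>L. a x * pochhammer (of_nat M) n * c x ^ n / (1 - c x * w) ^ (M + n))"
    by eventually_elim (use Suc.IH in auto)
  then have "deriv ((deriv ^^ n) (\<lambda>z. \<Sum>x\<in>L. a x / (1 - c x * z) ^ M)) z
     = deriv (\<lambda>w. \<Sum>x\<in>L. a x * pochhammer (of_nat M) n * c x ^ n / (1 - c x * w) ^ (M + n)) z"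
    by (rule deriv_cong_ev) simp
  then show ?case using d by simp
qed simp

context lacunary_weight
begin

definition grid :: "nat \<Rightarrow> (nat \<times> nat) set"
  where "grid J = Sigma {1..J} (\<lambda>j. {..<K ^ (j + 2)})"

text \<open>
The \<open>n\<close>-th derivative of \<open>grid_kernel M j l\<close> in the disc.
\<close>

definition grid_kernel_deriv :: "nat \<Rightarrow> nat \<Rightarrow> nat \<Rightarrow> nat \<Rightarrow> complex \<Rightarrow> complex"
  where "grid_kernel_deriv M n j l z = of_real (1 - radius K j) ^ M * pochhammer (of_nat M) n
    * (of_real (radius K j) * cis (- root_angle (K ^ (j + 2)) l)) ^ n
    / (1 - of_real (radius K j) * cis (- root_angle (K ^ (j + 2)) l) * z) ^ (M + n)"

lemma finite_grid: "finite (grid J)"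
  by (simp add: grid_def)

lemma sum_grid: "(\<Sum>x\<in>grid J. h (fst x) (snd x)) = (\<Sum>j\<in>{1..J}. \<Sum>l<K ^ (j + 2). h j l)"
  unfolding grid_def by (subst sum.Sigma) (auto simp: split_beta)

lemma synthesis_holomorphic:
  "(\<lambda>z. \<Sum>j\<in>{1..J}. \<Sum>l<K ^ (j + 2). \<alpha> j l * grid_kernel M j l z) holomorphic_on ball 0 1"
  unfolding grid_kernel_def
  by (intro holomorphic_intros) (use grid_kernel_denominator in auto)

lemma higher_deriv_synthesis:
  assumes "norm z < 1"
  shows "(deriv ^^ n) (\<lambda>z. \<Sum>j\<in>{1..J}. \<Sum>l<K ^ (j + 2). \<alpha> j l * grid_kernel M j l z) z
    = (\<Sum>x\<in>grid J. \<alpha> (fst x) (snd x) * grid_kernel_deriv M n (fst x) (snd x) z)"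
proof -
  define c where "c = (\<lambda>x. of_real (radius K (fst x)) * cis (- root_angle (K ^ (fst x + 2)) (snd x)))"
  define b where "b = (\<lambda>x. \<alpha> (fst x) (snd x) * of_real (1 - radius K (fst x)) ^ M)"
  have c: "norm (c x) \<le> 1" for x
    using radius_facts(1,2)[OF K, of "fst x"] by (simp add: c_def norm_mult)
  have "(\<lambda>z. \<Sum>j\<in>{1..J}. \<Sum>l<K ^ (j + 2). \<alpha> j l * grid_kernel M j l z) = (\<lambda>z. \<Sum>x\<in>grid J. b x / (1 - c x * z) ^ M)"
    unfolding sum_grid[symmetric] by (simp add: b_def c_def grid_kernel_def power_divide)
  then have "(deriv ^^ n) (\<lambda>z. \<Sum>j\<in>{1..J}. \<Sum>l<K ^ (j + 2). \<alpha> j l * grid_kernel M j l z) z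
    = (deriv ^^ n) (\<lambda>z. \<Sum>x\<in>grid J. b x / (1 - c x * z) ^ M) z"
    by (simp only:)
  also have "\<dots> = (\<Sum>x\<in>grid J. b x * pochhammer (of_nat M) n * c x ^ n / (1 - c x * z) ^ (M + n))"
    by (rule higher_deriv_sum_inverse_powers[OF finite_grid c assms])
  also have "\<dots> = (\<Sum>x\<in>grid J. \<alpha> (fst x) (snd x) * grid_kernel_deriv M n (fst x) (snd x) z)"
    by (rule sum.cong) (simp_all add: b_def c_def grid_kernel_deriv_def mult.assoc)
  finally show ?thesis .
qed

text \<open>
On its own box the denominator is of the order of \<open>1 - r\<^sub>j = K\<^sup>-\<^sup>j\<close>, so that \<open>n\<close> differentiations gain a factor of
the order of \<open>K\<^sup>j\<^sup>n\<close>.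
\<close>

lemma grid_kernel_deriv_lower:
  assumes M: "1 \<le> M" and j: "1 \<le> j" and r: "r \<in> layer (j - 1)" and \<theta>: "\<theta> \<in> arc_interval (K ^ (j + 2)) l"
  shows "(1 / 2) ^ n / (real K + 3) ^ (M + n) * real K ^ (j * n) \<le> norm (grid_kernel_deriv M n j l (of_real r * cis \<theta>))"
proof -
  define \<rho> where "\<rho> = radius K j"
  define \<kappa> where "\<kappa> = 1 / real K ^ j"
  define \<alpha> where "\<alpha> = root_angle (K ^ (j + 2)) l"
  define x where "x = norm (1 - of_real \<rho> * cis (- \<alpha>) * (of_real r * cis \<theta>))"
  have K0: "0 < real K" using K by simp
  have \<rho>: "0 \<le> \<rho>" "\<rho> < 1" "1 - \<rho> = \<kappa>" unfolding \<rho>_def \<kappa>_def using radius_facts[OF K] by auto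
  have \<kappa>0: "0 < \<kappa>" using K0 by (simp add: \<kappa>_def)
  have \<rho>2: "1 / 2 \<le> \<rho>"
  proof -
    have "real K ^ 1 \<le> real K ^ j" using j K by (intro power_increasing) auto
    moreover have "2 \<le> real K ^ 1" using K by simp
    ultimately have "2 \<le> real K ^ j" by (rule order_trans[rotated])
    then have "\<kappa> \<le> 1 / 2" unfolding \<kappa>_def using K0 by (intro divide_left_mono) auto
    then show ?thesis using \<rho>(3) by linarith
  qed
  have r01: "0 \<le> r" "r < 1" and rk: "1 - r \<le> K * \<kappa>"
  proof -
    show "0 \<le> r" "r < 1" using r layer_unit[of "j - 1"] by auto
    have "radius K (j - 1) \<le> r" using r by (simp add: layer_def)
    moreover have "radius K (j - 1) = 1 - K * \<kappa>" using j K0 by (simp add: radius_def \<kappa>_def power_diff)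
    ultimately show "1 - r \<le> K * \<kappa>" by simp
  qed
  have \<theta>\<alpha>: "\<bar>\<theta> - \<alpha>\<bar> \<le> 2 * \<kappa>"
  proof -
    have "\<alpha> \<le> \<theta>" "\<theta> \<le> \<alpha> + 2 * pi * (1 / real (K ^ (j + 2)))"
      using \<theta> unfolding arc_interval_def root_angle_def \<alpha>_def by (auto simp: ring_distribs add_divide_distrib)
    moreover have "2 * pi * (1 / real (K ^ (j + 2))) \<le> 2 * \<kappa>"
    proof -
      have "4 \<le> (real K)\<^sup>2" using power_mono[of 2 "real K" 2] K by simp
      then have "\<kappa> / (real K)\<^sup>2 \<le> \<kappa> / 4" using \<kappa>0 K0 by (intro divide_left_mono) auto
      moreover have "1 / real (K ^ (j + 2)) = \<kappa> / (real K)\<^sup>2" by (simp add: \<kappa>_def power_add power2_eq_square)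
      ultimately have "2 * pi * (1 / real (K ^ (j + 2))) \<le> 2 * 4 * (\<kappa> / 4)"
        using \<kappa>0 pi_less_4 by (intro mult_mono) auto
      then show ?thesis by simp
    qed
    ultimately show ?thesis by linarith
  qed
  have x: "x \<le> (real K + 3) * \<kappa>"
  proof -
    have "1 - of_real \<rho> * cis (- \<alpha>) * (of_real r * cis \<theta>)
       = of_real (1 - \<rho> * r) - of_real (\<rho> * r) * (cis (\<theta> - \<alpha>) - cis 0)"
      by (simp add: algebra_simps cis_mult)
    then have "x \<le> norm (of_real (1 - \<rho> * r) :: complex) + norm (of_real (\<rho> * r) * (cis (\<theta> - \<alpha>) - cis 0))"
      unfolding x_def by (simp only: norm_triangle_ineq4)
    moreover have "\<rho> * r \<le> 1" using \<rho> r01 by (simp add: mult_le_one)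
    then have "norm (of_real (1 - \<rho> * r) :: complex) = 1 - \<rho> * r" by (simp only: norm_of_real)
    moreover have "norm (of_real (\<rho> * r) * (cis (\<theta> - \<alpha>) - cis 0)) \<le> \<bar>\<theta> - \<alpha>\<bar>"
    proof -
      have "\<bar>\<rho> * r\<bar> * norm (cis (\<theta> - \<alpha>) - cis 0) \<le> 1 * \<bar>(\<theta> - \<alpha>) - 0\<bar>"
        using \<rho> r01 \<open>\<rho> * r \<le> 1\<close> by (intro mult_mono norm_cis_diff_le) auto
      then show ?thesis by (simp add: norm_mult abs_mult)
    qed
    moreover have "1 - \<rho> * r \<le> (1 - \<rho>) + (1 - r)"
    proof -
      have "0 \<le> (1 - \<rho>) * (1 - r)" using \<rho> r01 by (intro mult_nonneg_nonneg) auto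
      then show ?thesis by (simp add: algebra_simps)
    qed
    ultimately have "x \<le> \<kappa> + K * \<kappa> + 2 * \<kappa>" using \<rho>(3) rk \<theta>\<alpha> by linarith
    then show ?thesis by (simp add: algebra_simps)
  qed
  have x0: "0 < x" unfolding x_def \<rho>_def
    using grid_kernel_denominator[of "of_real r * cis \<theta>" j "- \<alpha>"] r01 by (simp add: norm_mult)
  have poch: "1 \<le> norm (pochhammer (of_nat M) n :: complex)"
  proof -
    have "0 < pochhammer M n" using M by (intro pochhammer_pos) simp
    then have "1 \<le> real (pochhammer M n)" by simp
    then show ?thesis by (simp add: pochhammer_of_nat)
  qed
  have "norm (grid_kernel_deriv M n j l (of_real r * cis \<theta>)) = \<kappa> ^ M * norm (pochhammer (of_nat M) n :: complex) * \<rho> ^ n / x ^ (M + n)"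
  proof -
    have "norm (of_real (1 - \<rho>) :: complex) = \<kappa>" unfolding \<rho>(3) using \<kappa>0 by simp
    moreover have "norm (of_real \<rho> * cis (- \<alpha>)) = \<rho>" using \<rho>(1) by (simp add: norm_mult)
    ultimately show ?thesis
      unfolding grid_kernel_deriv_def \<rho>_def[symmetric] \<alpha>_def[symmetric] norm_mult norm_divide norm_power x_def
      by (simp only: norm_mult[symmetric])
  qed
  also have "\<dots> \<ge> \<kappa> ^ M * 1 * (1 / 2) ^ n / ((real K + 3) * \<kappa>) ^ (M + n)"
    using \<kappa>0 poch \<rho>2 x x0 by (intro frac_le mult_mono power_mono mult_nonneg_nonneg) auto
  also have "\<kappa> ^ M * 1 * (1 / 2) ^ n / ((real K + 3) * \<kappa>) ^ (M + n) = (1 / 2) ^ n / (real K + 3) ^ (M + n) * (1 / \<kappa> ^ n)"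
  proof -
    have "((real K + 3) * \<kappa>) ^ (M + n) = (real K + 3) ^ (M + n) * (\<kappa> ^ M * \<kappa> ^ n)"
      by (simp only: power_mult_distrib power_add mult_ac)
    moreover have "\<kappa> ^ M * 1 * x / (y * (\<kappa> ^ M * \<kappa> ^ n)) = x / y * (1 / \<kappa> ^ n)" for x y
      using \<kappa>0 by simp
    ultimately show ?thesis by (simp only:)
  qed
  also have "1 / \<kappa> ^ n = real K ^ (j * n)" using K0 by (simp add: \<kappa>_def power_divide flip: power_mult)
  finally show ?thesis .
qed

text \<open>
The left side is the supremum of its finite partial sums over the levels, so finite combinations of kernels suffice and the
average over signs is a finite one. The function inequality holds for each choice of signs with the same right side, hence
for the average, and on each layer the average is bounded below by \<open>random_sign_lower_bound\<close>.
\<close>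

lemma sequence_inequality_from_function:
  fixes p q s t :: real and n :: nat
  assumes p: "0 < p" and q: "0 < q" and s: "0 < s" and t: "0 < t"
  obtains B where "0 < B" "\<And>\<mu> \<nu> C. measure_data \<mu> \<nu> \<Longrightarrow> 0 < C \<Longrightarrow>
    function_inequality p q s t \<omega> n \<mu> \<nu> C \<Longrightarrow> sequence_inequality p q s t \<omega> n K \<mu> \<nu> (B * C)"
proof -
  obtain M B1 where M: "1 \<le> M" and B1: "0 < B1" and synth: "\<And>J \<alpha> a.
    (\<And>j l. j \<in> {1..J} \<Longrightarrow> l < K ^ (j + 2) \<Longrightarrow> norm (\<alpha> j l) \<le> norm (a j l) * (real K powr (j / p) * W j powr (- 1 / q))) \<Longrightarrow>
    mixed_norm p q \<omega> (\<lambda>z. \<Sum>j\<in>{1..J}. \<Sum>l<K ^ (j + 2). \<alpha> j l * grid_kernel M j l z)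
      \<le> ennreal B1 * seq_norm p q (\<lambda>j. K ^ (j + 2)) a"
    using synthesis_norm_le[OF p q] by blast
  have K0: "0 < real K" using K by simp
  define c' where "c' = (1 / 2) ^ n / (real K + 3) ^ (M + n)"
  \<comment> \<open>the constants of \<open>random_sign_lower_bound\<close>, of the lower bound for the kernels, and of the overlap of the arcs\<close>
  define e0 where "e0 = (1 / 4) powr (t / s) / 4 * c' powr t / 2 powr (t / s)"
  define B2 where "B2 = (1 / e0) powr (1 / t)"
  have c'0: "0 < c'" using K0 by (simp add: c'_def)
  have e0: "0 < e0" using c'0 by (simp add: e0_def)
  have B2: "0 < B2" using e0 by (simp add: B2_def)
  have ts: "0 < t / s" using s t by simp
  show ?thesis
  proof (rule that[of "B1 * B2"])
    show "0 < B1 * B2" using B1 B2 by simp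
    fix \<mu> \<nu> C
    assume data: "measure_data \<mu> \<nu>" and C: "0 < C" and ineq: "function_inequality p q s t \<omega> n \<mu> \<nu> C"
    show "sequence_inequality p q s t \<omega> n K \<mu> \<nu> (B1 * B2 * C)"
      unfolding sequence_inequality_def
    proof
      fix a assume a: "a \<in> seq_space p q (\<lambda>j. K ^ (j + 2))"
      define X where "X = seq_norm p q (\<lambda>j. K ^ (j + 2)) a"
      have X: "X < \<infinity>" using a by (simp add: X_def seq_space_def)
      define d where "d = (\<lambda>j. real K powr (real j * t * (real n + 1 / p)) * W j powr (- t / q))"
      define T where "T = (\<lambda>j r. \<Sum>l<K ^ (j + 2). ennreal (norm (a j l) powr s) * emeasure (\<mu> r) (arc_interval (K ^ (j + 2)) l))"
      define G where "G = (\<lambda>j r. ennreal (d j) * ennpow (T j r) (t / s))"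
      have Gm: "(\<lambda>r. G j r * indicator (layer i) r) \<in> borel_measurable \<nu>" for i j
        unfolding G_def T_def by (rule arc_sum_measurable[OF data])
      have bound: "(\<Sum>j\<in>F. \<integral>\<^sup>+r\<in>layer (j - 1). G j r \<partial>\<nu>) \<le> ennpow (ennreal (B1 * B2 * C) * X) t"
        if F: "finite F" "F \<subseteq> {1..}" for F
      proof -
        \<comment> \<open>the levels in \<open>F\<close> are among the first \<open>J\<close>\<close>
        define J where "J = Max (insert 1 F)"
        have FJ: "j \<in> {1..J}" if "j \<in> F" for j using F that by (auto simp: J_def)
        define L where "L = grid J"
        have finL: "finite L" by (simp add: L_def finite_grid)
        define c where "c = (\<lambda>j. real K powr (real j / p) * W j powr (- 1 / q))"
        have c: "0 < c j" for j using K0 W_pos[of j] by (simp add: c_def)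
        define f where "f = (\<lambda>S z. \<Sum>j\<in>{1..J}. \<Sum>l<K ^ (j + 2). (signed S (j, l) * (a j l * of_real (c j))) * grid_kernel M j l z)"
        define g where "g = (\<lambda>S r. \<integral>\<^sup>+\<theta>. ennreal (norm ((deriv ^^ n) (f S) (of_real r * cis \<theta>)) powr s) \<partial>\<mu> r)"
        define Y where "Y = ennpow (ennreal C * (ennreal B1 * X)) t"
        have fhol: "f S holomorphic_on ball 0 1" for S unfolding f_def by (rule synthesis_holomorphic)
        have fnorm: "mixed_norm p q \<omega> (f S) \<le> ennreal B1 * X" for S
          unfolding f_def X_def by (rule synth) (use c in \<open>simp add: norm_mult c_def\<close>)
        have fI: "(\<integral>\<^sup>+r. ennpow (g S r) (t / s) \<partial>\<nu>) \<le> Y" for S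
        proof -
          have "mixed_norm p q \<omega> (f S) < \<infinity>"
            using X by (intro le_less_trans[OF fnorm[of S]]) (simp add: ennreal_mult_less_top)
          then have "f S \<in> mixed_norm_space p q \<omega>" using fhol by (simp add: mixed_norm_space_def)
          then have "ennpow (\<integral>\<^sup>+r. ennpow (g S r) (t / s) \<partial>\<nu>) (1 / t) \<le> ennreal C * mixed_norm p q \<omega> (f S)"
            using ineq unfolding function_inequality_def g_def by blast
          also have "\<dots> \<le> ennreal C * (ennreal B1 * X)" using fnorm by (intro mult_left_mono) auto
          finally show ?thesis unfolding Y_def using ennpow_ineq_iff[OF t] by blast
        qed
        have gm: "(\<lambda>r. ennpow (g S r) (t / s)) \<in> borel_measurable \<nu>" for S
        proof -
          have cf: "continuous_on (ball 0 1) ((deriv ^^ n) (f S))"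
            by (intro holomorphic_on_imp_continuous_on holomorphic_higher_deriv fhol) auto
          have "continuous_on ({0..<1} \<times> UNIV) (\<lambda>x. (deriv ^^ n) (f S) (of_real (fst x) * cis (snd x)))"
            by (rule continuous_on_compose2[OF cf]) (auto intro!: continuous_intros simp: norm_mult)
          then have "continuous_on ({0..<1} \<times> UNIV) (\<lambda>x. norm ((deriv ^^ n) (f S) (of_real (fst x) * cis (snd x))) powr s)"
            using s by (intro continuous_on_powr' continuous_on_norm continuous_on_const) auto
          then have "g S \<in> borel_measurable \<nu>" unfolding g_def by (rule nn_integral_kernel_measurable[OF data])
          then show ?thesis by (rule borel_measurable_ennpow)
        qed
        have point: "ennreal (2 ^ card L * e0) * G j r \<le> (\<Sum>S\<in>Pow L. ennpow (g S r) (t / s))"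
          if j: "j \<in> F" and r: "r \<in> layer (j - 1)" for j r
        proof -
          have j1: "1 \<le> j" using FJ[OF j] by simp
          have r1: "r \<in> {0..<1}" using r layer_unit[of "j - 1"] by auto
          define N where "N = K ^ (j + 2)"
          have N: "0 < N" using K by (simp add: N_def)
          define \<phi> where "\<phi> = (\<lambda>i \<theta>. (a (fst i) (snd i) * of_real (c (fst i))) * grid_kernel_deriv M n (fst i) (snd i) (of_real r * cis \<theta>))"
          define b where "b = c' * real K ^ (j * n) * c j"
          have b0: "0 < b" using c'0 K0 c[of j] by (simp add: b_def)
          have gF: "g S r = (\<integral>\<^sup>+\<theta>. ennreal (norm (\<Sum>i\<in>L. signed S i * \<phi> i \<theta>) powr s) \<partial>\<mu> r)" for S
          proof -
            have "(deriv ^^ n) (f S) (of_real r * cis \<theta>) = (\<Sum>i\<in>L. signed S i * \<phi> i \<theta>)" for \<theta>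
              unfolding f_def L_def \<phi>_def using r1 by (subst higher_deriv_synthesis) (auto simp: norm_mult mult.assoc)
            then show ?thesis by (simp add: g_def)
          qed
          have "ennreal (2 ^ card L * ((1 / 4) powr (t / s) / 4)) *
             ennpow (\<Sum>l<N. ennreal ((b * norm (a j l)) powr s) * emeasure (\<mu> r) (arc_interval N l)) (t / s)
            \<le> (\<Sum>S\<in>Pow L. ennpow (2 * (\<integral>\<^sup>+\<theta>. ennreal (norm (\<Sum>i\<in>L. signed S i * \<phi> i \<theta>) powr s) \<partial>\<mu> r)) (t / s))"
          proof (rule random_sign_lower_bound[OF measure_data_space(3)[OF data r1] finL _ N])
            show "(j, l) \<in> L" if "l < N" for l using that FJ[OF j] by (simp add: L_def grid_def N_def)
            show "continuous_on UNIV (\<phi> i)" for i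
              unfolding \<phi>_def grid_kernel_deriv_def
            proof (intro continuous_intros ballI)
              fix \<theta>
              show "(1 - of_real (radius K (fst i)) * cis (- root_angle (K ^ (fst i + 2)) (snd i)) * (of_real r * cis \<theta>)) ^ (M + n) \<noteq> 0"
                using grid_kernel_denominator[of "of_real r * cis \<theta>" "fst i"] r1 by (simp add: norm_mult)
            qed
            show "b * norm (a j l) \<le> norm (\<phi> (j, l) \<theta>)" if "l < N" "\<theta> \<in> arc_interval N l" for l \<theta>
            proof -
              have "norm (a j l) * c j * (c' * real K ^ (j * n)) \<le> norm (a j l) * c j * norm (grid_kernel_deriv M n j l (of_real r * cis \<theta>))"
                unfolding c'_def using that c[of j]
                by (intro mult_left_mono grid_kernel_deriv_lower[OF M j1 r]) (auto simp: N_def)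
              then show ?thesis using c[of j] by (simp add: \<phi>_def b_def norm_mult mult_ac)
            qed
          qed (use b0 s ts in auto)
          also have "(\<Sum>S\<in>Pow L. ennpow (2 * (\<integral>\<^sup>+\<theta>. ennreal (norm (\<Sum>i\<in>L. signed S i * \<phi> i \<theta>) powr s) \<partial>\<mu> r)) (t / s))
             = ennreal (2 powr (t / s)) * (\<Sum>S\<in>Pow L. ennpow (g S r) (t / s))"
          proof -
            have "ennpow 2 (t / s) = ennreal (2 powr (t / s))" using ennpow_ennreal[of 2 "t / s"] by simp
            then show ?thesis unfolding gF[symmetric] ennpow_mult[OF ts] by (simp add: sum_distrib_left)
          qed
          also have "ennpow (\<Sum>l<N. ennreal ((b * norm (a j l)) powr s) * emeasure (\<mu> r) (arc_interval N l)) (t / s)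
             = ennreal (b powr t) * ennpow (T j r) (t / s)"
          proof -
            have "(\<Sum>l<N. ennreal ((b * norm (a j l)) powr s) * emeasure (\<mu> r) (arc_interval N l)) = ennreal (b powr s) * T j r"
              unfolding T_def N_def sum_distrib_left using b0
              by (intro sum.cong refl) (simp add: powr_mult ennreal_mult mult.assoc)
            then show ?thesis using s b0 by (simp add: ennpow_mult[OF ts] ennpow_ennreal powr_powr)
          qed
          also have "b powr t = c' powr t * d j"
          proof -
            have "b powr t = c' powr t * (real K ^ (j * n)) powr t * c j powr t"
              unfolding b_def using c'0 K0 c[of j] by (simp add: powr_mult)
            also have "(real K ^ (j * n)) powr t = real K powr (real j * n * t)"
              using K0 by (simp add: powr_powr flip: powr_realpow)
            also have "c j powr t = real K powr (real j / p * t) * W j powr (- t / q)"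
              unfolding c_def using K0 W_pos[of j] by (simp add: powr_mult powr_powr)
            also have "c' powr t * real K powr (real j * n * t) * (real K powr (real j / p * t) * W j powr (- t / q))
               = c' powr t * (real K powr (real j * n * t + real j / p * t) * W j powr (- t / q))"
              by (simp add: powr_add mult_ac)
            also have "real j * n * t + real j / p * t = real j * t * (real n + 1 / p)" by (simp add: algebra_simps)
            finally show ?thesis by (simp add: d_def)
          qed
          finally have main: "ennreal (2 ^ card L * ((1 / 4) powr (t / s) / 4)) * (ennreal (c' powr t * d j) * ennpow (T j r) (t / s))
             \<le> ennreal (2 powr (t / s)) * (\<Sum>S\<in>Pow L. ennpow (g S r) (t / s))" .
          have d0: "0 \<le> d j" by (simp add: d_def)
          have "ennreal (2 powr (t / s)) * (ennreal (2 ^ card L * e0) * G j r)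
             = ennreal (2 ^ card L * ((1 / 4) powr (t / s) / 4)) * (ennreal (c' powr t * d j) * ennpow (T j r) (t / s))"
          proof -
            have "ennreal (2 powr (t / s)) * ennreal (2 ^ card L * e0) = ennreal (2 ^ card L * ((1 / 4) powr (t / s) / 4)) * ennreal (c' powr t)"
              using e0 by (simp add: e0_def flip: ennreal_mult)
            then show ?thesis unfolding G_def using d0 by (simp add: ennreal_mult mult.assoc[symmetric])
          qed
          then have "ennreal (2 powr (t / s)) * (ennreal (2 ^ card L * e0) * G j r) \<le> ennreal (2 powr (t / s)) * (\<Sum>S\<in>Pow L. ennpow (g S r) (t / s))"
            using main by (simp only:)
          then show ?thesis by (simp add: ennreal_mult_le_mult_iff)
        qed
        have "ennreal (2 ^ card L * e0) * (\<Sum>j\<in>F. \<integral>\<^sup>+r\<in>layer (j - 1). G j r \<partial>\<nu>)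
          = (\<integral>\<^sup>+r. (\<Sum>j\<in>F. ennreal (2 ^ card L * e0) * (G j r * indicator (layer (j - 1)) r)) \<partial>\<nu>)"
        proof -
          have "(\<integral>\<^sup>+r. (\<Sum>j\<in>F. ennreal (2 ^ card L * e0) * (G j r * indicator (layer (j - 1)) r)) \<partial>\<nu>)
             = (\<Sum>j\<in>F. \<integral>\<^sup>+r. ennreal (2 ^ card L * e0) * (G j r * indicator (layer (j - 1)) r) \<partial>\<nu>)"
            by (rule nn_integral_sum) (intro borel_measurable_times_ennreal Gm borel_measurable_const)
          also have "\<dots> = (\<Sum>j\<in>F. ennreal (2 ^ card L * e0) * (\<integral>\<^sup>+r\<in>layer (j - 1). G j r \<partial>\<nu>))"
            by (intro sum.cong refl nn_integral_cmult Gm)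
          finally show ?thesis by (simp only: sum_distrib_left)
        qed
        also have "\<dots> \<le> (\<integral>\<^sup>+r. (\<Sum>S\<in>Pow L. ennpow (g S r) (t / s)) \<partial>\<nu>)"
        proof (rule nn_integral_mono)
          fix r
          define V where "V = (\<Sum>S\<in>Pow L. ennpow (g S r) (t / s))"
          have "(\<Sum>j\<in>F. ennreal (2 ^ card L * e0) * (G j r * indicator (layer (j - 1)) r)) \<le> (\<Sum>j\<in>F. V * indicator (layer (j - 1)) r)"
            using point unfolding V_def by (intro sum_mono) (auto simp: indicator_def)
          also have "\<dots> = V * (\<Sum>i\<in>(\<lambda>j. j - 1) ` F. indicator (layer i) r)"
          proof -
            have "inj_on (\<lambda>j. j - 1) F" using F(2) by (intro inj_on_diff_nat) auto
            then show ?thesis by (simp add: sum.reindex sum_distrib_left)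
          qed
          also have "\<dots> \<le> V * indicator {0..<1} r"
            using F(1) by (intro mult_left_mono sum_indicator_layer_le) auto
          also have "\<dots> \<le> V" by (auto simp: indicator_def)
          finally show "(\<Sum>j\<in>F. ennreal (2 ^ card L * e0) * (G j r * indicator (layer (j - 1)) r)) \<le> V" .
        qed
        also have "\<dots> = (\<Sum>S\<in>Pow L. \<integral>\<^sup>+r. ennpow (g S r) (t / s) \<partial>\<nu>)"
          by (rule nn_integral_sum) (rule gm)
        also have "\<dots> \<le> (\<Sum>S\<in>Pow L. Y)" by (intro sum_mono fI)
        also have "\<dots> = ennreal (2 ^ card L) * Y"
          using finL by (simp add: card_Pow ennreal_power flip: ennreal_numeral)
        finally have "ennreal (2 ^ card L) * (ennreal e0 * (\<Sum>j\<in>F. \<integral>\<^sup>+r\<in>layer (j - 1). G j r \<partial>\<nu>)) \<le> ennreal (2 ^ card L) * Y"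
          using e0 by (simp add: ennreal_mult mult.assoc)
        then have "ennreal e0 * (\<Sum>j\<in>F. \<integral>\<^sup>+r\<in>layer (j - 1). G j r \<partial>\<nu>) \<le> Y"
          by (simp add: ennreal_mult_le_mult_iff)
        then have "ennreal (1 / e0) * (ennreal e0 * (\<Sum>j\<in>F. \<integral>\<^sup>+r\<in>layer (j - 1). G j r \<partial>\<nu>)) \<le> ennreal (1 / e0) * Y"
          by (rule mult_left_mono) simp
        moreover have "ennreal (1 / e0) * (ennreal e0 * x) = x" for x
          using e0 by (simp add: mult.assoc[symmetric] flip: ennreal_mult)
        moreover have "ennreal (1 / e0) * Y = ennpow (ennreal (B1 * B2 * C) * X) t"
        proof -
          have "ennreal (1 / e0) = ennpow (ennreal B2) t"
            using e0 t by (simp add: B2_def ennpow_ennreal powr_powr)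
          then have "ennreal (1 / e0) * Y = ennpow (ennreal B2 * (ennreal C * (ennreal B1 * X))) t"
            unfolding Y_def by (simp only: ennpow_mult[OF t])
          also have "ennreal B2 * (ennreal C * (ennreal B1 * X)) = ennreal (B1 * B2 * C) * X"
            using B1 B2 C by (simp add: ennreal_mult mult_ac)
          finally show ?thesis .
        qed
        ultimately show ?thesis by (simp only:)
      qed
      have "(\<Sum>\<^sub>\<infinity>j\<in>{1..}. \<integral>\<^sup>+r\<in>{radius K (j - 1)..<radius K j}. G j r \<partial>\<nu>)
         = (\<Sum>\<^sub>\<infinity>j\<in>{1..}. \<integral>\<^sup>+r\<in>layer (j - 1). G j r \<partial>\<nu>)"
        by (rule infsum_cong) (auto simp: layer_def)
      also have "\<dots> \<le> ennpow (ennreal (B1 * B2 * C) * X) t"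
        unfolding infsum_ennreal_le_iff using bound by blast
      finally show "ennpow (\<Sum>\<^sub>\<infinity>j\<in>{1..}. \<integral>\<^sup>+r\<in>{radius K (j - 1)..<radius K j}.
          ennreal (real K powr (real j * t * (real n + 1 / p)) * weight_hat \<omega> (radius K j) powr (- t / q)) *
          ennpow (\<Sum>l<K ^ (j + 2). ennreal (norm (a j l) powr s) * emeasure (\<mu> r) (arc_interval (K ^ (j + 2)) l)) (t / s) \<partial>\<nu>) (1 / t)
        \<le> ennreal (B1 * B2 * C) * seq_norm p q (\<lambda>j. K ^ (j + 2)) a"
        unfolding ennpow_ineq_iff[OF t] G_def T_def d_def W_def X_def .
    qed
  qed
qed

end

section \<open>The equivalence\<close>

text \<open>
For the upper bound, the doubling condition halves the distance to the unit circle, and \<open>K\<close> halvings move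
beyond the next radius because \<open>2\<^sup>K \<ge> K\<close>.
\<close>

lemma lacunary_weight_doubling:
  assumes "\<omega> \<in> doubling_weights" "2 \<le> K" "1 < C\<^sub>0" "lower_doubling_with (real K) C\<^sub>0 \<omega>"
  obtains D where "lacunary_weight \<omega> K C\<^sub>0 D"
proof -
  have w: "radial_weight \<omega>" using assms by (simp add: doubling_weights_def upper_doubling_def)
  obtain C where C: "0 < C" "\<And>r. r \<in> {0..<1} \<Longrightarrow> weight_hat \<omega> r \<le> C * weight_hat \<omega> ((1 + r) / 2)"
    using assms by (auto simp: doubling_weights_def upper_doubling_def)
  have K0: "0 < real K" using assms by simp
  have rad: "radius K j \<in> {0..<1}" for j using radius_facts(1,2)[OF assms(2)] by simp
  have anti: "weight_hat \<omega> y \<le> weight_hat \<omega> x" if "0 \<le> x" "x \<le> y" for x y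
    unfolding weight_hat_def set_lebesgue_integral_def
  proof (rule integral_mono)
    have int: "set_integrable lebesgue {z..<1} \<omega>" if "0 \<le> z" for z
      using w that by (auto simp: radial_weight_def intro: set_integrable_subset)
    show "integrable lebesgue (\<lambda>r. indicator {y..<1} r *\<^sub>R \<omega> r)" "integrable lebesgue (\<lambda>r. indicator {x..<1} r *\<^sub>R \<omega> r)"
      using int[of y] int[of x] that by (simp_all add: set_integrable_def)
    show "indicator {y..<1} r *\<^sub>R \<omega> r \<le> indicator {x..<1} r *\<^sub>R \<omega> r" for r
      using that w by (auto simp: indicator_def radial_weight_def)
  qed
  have iter: "weight_hat \<omega> r \<le> C ^ i * weight_hat \<omega> (1 - (1 - r) / 2 ^ i)" if r: "r \<in> {0..<1}" for r i
  proof (induction i)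
    case (Suc i)
    define r' where "r' = 1 - (1 - r) / 2 ^ i"
    have "(1 - r) / 2 ^ i \<le> 1"
    proof -
      have "(1 - r) / 2 ^ i \<le> (1 - r) / 1" using r by (intro divide_left_mono) auto
      also have "\<dots> \<le> 1" using r by simp
      finally show ?thesis .
    qed
    moreover have "0 < (1 - r) / 2 ^ i" using r by simp
    ultimately have "0 \<le> r' \<and> r' < 1" unfolding r'_def by linarith
    then have "r' \<in> {0..<1}" by simp
    from C(2)[OF this] have "C ^ i * weight_hat \<omega> r' \<le> C ^ i * (C * weight_hat \<omega> ((1 + r') / 2))"
      using C(1) by (intro mult_left_mono) auto
    moreover have "(1 + r') / 2 = 1 - (1 - r) / 2 ^ Suc i" by (simp add: r'_def field_simps)
    ultimately have "C ^ i * weight_hat \<omega> r' \<le> C ^ Suc i * weight_hat \<omega> (1 - (1 - r) / 2 ^ Suc i)"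
      by (simp only: power_Suc mult_ac)
    with Suc show ?case unfolding r'_def by (rule order_trans)
  qed simp
  have step: "1 - (1 - radius K j) / real K = radius K (Suc j)" for j
    using K0 by (simp add: radius_def field_simps)
  have "lacunary_weight \<omega> K C\<^sub>0 (C ^ K)"
  proof
    show "radial_weight \<omega>" "2 \<le> K" "1 < C\<^sub>0" using w assms by auto
    fix j
    show "C\<^sub>0 * weight_hat \<omega> (radius K (Suc j)) \<le> weight_hat \<omega> (radius K j)"
      using assms(4) rad[of j] unfolding lower_doubling_with_def step[symmetric] by auto
    have "weight_hat \<omega> (radius K j) \<le> C ^ K * weight_hat \<omega> (1 - (1 - radius K j) / 2 ^ K)" by (rule iter[OF rad])
    also have "\<dots> \<le> C ^ K * weight_hat \<omega> (radius K (Suc j))"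
    proof (intro mult_left_mono anti)
      show "0 \<le> radius K (Suc j)" using rad[of "Suc j"] by simp
      have "real K \<le> 2 ^ K" using of_nat_less_two_power[of K, where 'a = real] by simp
      then have "(1 - radius K j) / 2 ^ K \<le> (1 - radius K j) / real K"
        using rad[of j] K0 by (intro divide_left_mono) auto
      then show "radius K (Suc j) \<le> 1 - (1 - radius K j) / 2 ^ K" unfolding step[symmetric] by simp
    qed (use C in simp)
    finally show "weight_hat \<omega> (radius K j) \<le> C ^ K * weight_hat \<omega> (radius K (Suc j))" .
  qed
  then show ?thesis by (rule that)
qed

lemma best_constant_transfer:
  assumes B: "0 < B" "B \<le> D" and PQ: "\<And>C. 0 < C \<Longrightarrow> P C \<Longrightarrow> Q (B * C)"
  shows "ennreal (1 / D) * best_constant Q \<le> best_constant P"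
    "best_constant Q \<le> ennreal D * best_constant P"
proof -
  have D: "0 < D" using B by linarith
  show le: "ennreal (1 / D) * best_constant Q \<le> best_constant P"
    unfolding best_constant_def[of P]
  proof (rule INF_greatest)
    fix C assume "C \<in> {C. 0 < C \<and> P C}"
    then have C: "0 < C" "P C" by auto
    have "best_constant Q \<le> ennreal (B * C)"
      unfolding best_constant_def using PQ[OF C] B C by (intro INF_lower) auto
    then have "ennreal (1 / D) * best_constant Q \<le> ennreal (1 / D) * ennreal (B * C)"
      by (rule mult_left_mono) simp
    also have "\<dots> = ennreal (1 / D * (B * C))" using D B C by (intro ennreal_mult[symmetric]) auto
    also have "\<dots> \<le> ennreal C" using D B C by (intro ennreal_leI) (simp add: divide_le_eq mult_right_mono)
    finally show "ennreal (1 / D) * best_constant Q \<le> ennreal C" .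
  qed
  have "best_constant Q = ennreal D * (ennreal (1 / D) * best_constant Q)"
    using D by (simp add: mult.assoc[symmetric] flip: ennreal_mult)
  also have "\<dots> \<le> ennreal D * best_constant P" using le by (rule mult_left_mono) simp
  finally show "best_constant Q \<le> ennreal D * best_constant P" .
qed

theorem proposition3p2:
  fixes p q s t :: real and \<omega> :: "real \<Rightarrow> real" and n K :: nat
  assumes "0 < p" "0 < q" "0 < s" "0 < t"
    and "\<omega> \<in> doubling_weights"
    and "2 \<le> K" and "\<exists>C\<^sub>0>1. lower_doubling_with (real K) C\<^sub>0 \<omega>"
  shows "(\<forall>\<mu> \<nu>. measure_data \<mu> \<nu> \<longrightarrow>
            (\<exists>C>0. function_inequality p q s t \<omega> n \<mu> \<nu> C) \<longleftrightarrow>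
            (\<exists>C>0. sequence_inequality p q s t \<omega> n K \<mu> \<nu> C)) \<and>
         (\<exists>D>0. \<forall>\<mu> \<nu>. measure_data \<mu> \<nu> \<longrightarrow>
            ennreal (1 / D) * best_constant (sequence_inequality p q s t \<omega> n K \<mu> \<nu>)
              \<le> best_constant (function_inequality p q s t \<omega> n \<mu> \<nu>) \<and>
            best_constant (function_inequality p q s t \<omega> n \<mu> \<nu>)
              \<le> ennreal D * best_constant (sequence_inequality p q s t \<omega> n K \<mu> \<nu>))"
proof -
  obtain C\<^sub>0 where C0: "1 < C\<^sub>0" "lower_doubling_with (real K) C\<^sub>0 \<omega>" using assms(7) by blast
  obtain D where "lacunary_weight \<omega> K C\<^sub>0 D" using lacunary_weight_doubling[OF assms(5,6) C0] by blast
  then interpret lacunary_weight \<omega> K C\<^sub>0 D .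
  obtain B where B: "0 < B" "\<And>\<mu> \<nu> C. measure_data \<mu> \<nu> \<Longrightarrow> 0 < C \<Longrightarrow>
    sequence_inequality p q s t \<omega> n K \<mu> \<nu> C \<Longrightarrow> function_inequality p q s t \<omega> n \<mu> \<nu> (B * C)"
    using function_inequality_from_sequence[OF assms(1-4)] by blast
  obtain B' where B': "0 < B'" "\<And>\<mu> \<nu> C. measure_data \<mu> \<nu> \<Longrightarrow> 0 < C \<Longrightarrow>
    function_inequality p q s t \<omega> n \<mu> \<nu> C \<Longrightarrow> sequence_inequality p q s t \<omega> n K \<mu> \<nu> (B' * C)"
    using sequence_inequality_from_function[OF assms(1-4)] by blast
  show ?thesis
  proof (intro conjI allI impI exI[of _ "max B B'"])
    fix \<mu> \<nu> assume data: "measure_data \<mu> \<nu>"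
    have up: "function_inequality p q s t \<omega> n \<mu> \<nu> (B * C)"
      if "0 < C" "sequence_inequality p q s t \<omega> n K \<mu> \<nu> C" for C using B(2)[OF data that] .
    have down: "sequence_inequality p q s t \<omega> n K \<mu> \<nu> (B' * C)"
      if "0 < C" "function_inequality p q s t \<omega> n \<mu> \<nu> C" for C using B'(2)[OF data that] .
    show "(\<exists>C>0. function_inequality p q s t \<omega> n \<mu> \<nu> C) \<longleftrightarrow> (\<exists>C>0. sequence_inequality p q s t \<omega> n K \<mu> \<nu> C)"
    proof
      assume "\<exists>C>0. function_inequality p q s t \<omega> n \<mu> \<nu> C"
      then obtain C where "0 < C" "function_inequality p q s t \<omega> n \<mu> \<nu> C" by blast
      then show "\<exists>C>0. sequence_inequality p q s t \<omega> n K \<mu> \<nu> C"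
        using down B'(1) by (intro exI[of _ "B' * C"]) simp
    next
      assume "\<exists>C>0. sequence_inequality p q s t \<omega> n K \<mu> \<nu> C"
      then obtain C where "0 < C" "sequence_inequality p q s t \<omega> n K \<mu> \<nu> C" by blast
      then show "\<exists>C>0. function_inequality p q s t \<omega> n \<mu> \<nu> C"
        using up B(1) by (intro exI[of _ "B * C"]) simp
    qed
    show "ennreal (1 / max B B') * best_constant (sequence_inequality p q s t \<omega> n K \<mu> \<nu>)
        \<le> best_constant (function_inequality p q s t \<omega> n \<mu> \<nu>)"
      by (rule best_constant_transfer(1)[where B = B']) (use B'(1) down in auto)
    show "best_constant (function_inequality p q s t \<omega> n \<mu> \<nu>)
        \<le> ennreal (max B B') * best_constant (sequence_inequality p q s t \<omega> n K \<mu> \<nu>)"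
      by (rule best_constant_transfer(2)[where B = B]) (use B(1) up in auto)
  qed (use B B' in simp)
qed


end
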